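(* Let $p>2$. The compact operator $T(0)$ on $L^p(\mathbb{C})$ given by $$T(0)h=-\,\mathcal{C}\Big(\rho^{-2}\,\overline{\mathcal{C}}\big(\rho^{-2}h\big)\Big),\qquad \rho(z)=(1+|z|^2)^{1/2},$$ has $\lambda=1$ as a semisimple eigenvalue of multiplicity $2$; equivalently, $0$ is a semisimple eigenvalue of $I-T(0)$ of multiplicity $2$.
   Context: $dm$ is Lebesgue measure on $\mathbb{C}$. The Cauchy transforms are $$\mathcal{C}[f](z)=\frac1\pi\int_{\mathbb{C}}\frac{f(\zeta)}{z-\zeta}\,dm(\zeta),\qquad \overline{\mathcal{C}}[f](z)=\frac1\pi\int_{\mathbb{C}}\frac{f(\zeta)}{\overline{z}-\overline{\zeta}}\,dm(\zeta).$$ An eigenvalue is semisimple if its algebraic and geometric multiplicities coincide. *)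

theory Defs
  imports "HOL-Analysis.Analysis"
begin

section \<open>Eigenvalues and multiplicities\<close>

locale complex_vector_space = vector_space scale
  for scale :: "complex \<Rightarrow> 'b::ab_group_add \<Rightarrow> 'b"  (infixr \<open>*s\<close> 75)
begin

definition eigenspace :: "'b set \<Rightarrow> ('b \<Rightarrow> 'b) \<Rightarrow> complex \<Rightarrow> 'b set" where
  "eigenspace V A l = {x \<in> V. A x = l *s x}"

definition generalized_eigenspace :: "'b set \<Rightarrow> ('b \<Rightarrow> 'b) \<Rightarrow> complex \<Rightarrow> 'b set" where
  "generalized_eigenspace V A l = {x \<in> V. \<exists>k. ((\<lambda>y. A y - l *s y) ^^ k) x = 0}"

definition eigenvalue_on :: "'b set \<Rightarrow> ('b \<Rightarrow> 'b) \<Rightarrow> complex \<Rightarrow> bool" where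
  "eigenvalue_on V A l \<longleftrightarrow> (\<exists>x\<in>V. x \<noteq> 0 \<and> A x = l *s x)"

text \<open>
  The library's \<open>dim\<close> is \<open>0\<close> on infinite-dimensional spaces, so the two multiplicities are
  meaningful only when finite; a nonzero value certifies finite dimensionality.
\<close>

definition geometric_multiplicity :: "'b set \<Rightarrow> ('b \<Rightarrow> 'b) \<Rightarrow> complex \<Rightarrow> nat" where
  "geometric_multiplicity V A l = dim (eigenspace V A l)"

definition algebraic_multiplicity :: "'b set \<Rightarrow> ('b \<Rightarrow> 'b) \<Rightarrow> complex \<Rightarrow> nat" where
  "algebraic_multiplicity V A l = dim (generalized_eigenspace V A l)"

definition semisimple_eigenvalue :: "'b set \<Rightarrow> ('b \<Rightarrow> 'b) \<Rightarrow> complex \<Rightarrow> bool" where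
  "semisimple_eigenvalue V A l \<longleftrightarrow>
     eigenvalue_on V A l \<and> algebraic_multiplicity V A l = geometric_multiplicity V A l"

definition compact_operator_on :: "'b set \<Rightarrow> ('b \<Rightarrow> real) \<Rightarrow> ('b \<Rightarrow> 'b) \<Rightarrow> bool" where
  "compact_operator_on V nrm A \<longleftrightarrow>
     (\<forall>x\<in>V. A x \<in> V) \<and>
     (\<forall>x\<in>V. \<forall>y\<in>V. A (x + y) = A x + A y) \<and>
     (\<forall>c. \<forall>x\<in>V. A (c *s x) = c *s A x) \<and>
     (\<forall>X :: nat \<Rightarrow> 'b. (\<forall>n. X n \<in> V) \<and> bounded (range (\<lambda>n. nrm (X n))) \<longrightarrow>
        (\<exists>y\<in>V. \<exists>r. strict_mono r \<and> (\<lambda>n. nrm (A (X (r n)) - y)) \<longlonglongrightarrow> 0))"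

end

section \<open>Measurable functions on the plane modulo null sets, and the spaces $L^p$\<close>

definition ae_eq :: "(complex \<Rightarrow> complex) \<Rightarrow> (complex \<Rightarrow> complex) \<Rightarrow> bool" where
  "ae_eq f g \<longleftrightarrow> f \<in> borel_measurable lborel \<and> g \<in> borel_measurable lborel \<and>
     (AE z in lborel. f z = g z)"

text \<open>
  Every Lebesgue measurable function agrees almost everywhere with a Borel function, so using
  Borel representatives yields the usual classes.
\<close>

quotient_type mclass = "complex \<Rightarrow> complex" / partial: ae_eq
proof (rule part_equivpI)
  show "\<exists>f. ae_eq f f" by (rule exI[of _ "\<lambda>_. 0"]) (simp add: ae_eq_def)
  show "symp ae_eq" by (rule sympI) (auto simp: ae_eq_def eq_commute)
  show "transp ae_eq"
  proof (rule transpI)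
    fix f g h assume "ae_eq f g" "ae_eq g h"
    then have *: "AE z in lborel. f z = g z" "AE z in lborel. g z = h z"
      and m: "f \<in> borel_measurable lborel" "h \<in> borel_measurable lborel"
      by (auto simp: ae_eq_def)
    from * have "AE z in lborel. f z = h z" by eventually_elim simp
    with m show "ae_eq f h" by (simp add: ae_eq_def)
  qed
qed

instantiation mclass :: ab_group_add
begin

lift_definition zero_mclass :: mclass is "\<lambda>_. 0"
  by (simp add: ae_eq_def)

lift_definition plus_mclass :: "mclass \<Rightarrow> mclass \<Rightarrow> mclass" is "\<lambda>f g z. f z + g z"
  unfolding ae_eq_def by (auto elim: eventually_elim2)

lift_definition uminus_mclass :: "mclass \<Rightarrow> mclass" is "\<lambda>f z. - f z"
  unfolding ae_eq_def by auto

lift_definition minus_mclass :: "mclass \<Rightarrow> mclass \<Rightarrow> mclass" is "\<lambda>f g z. f z - g z"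
  unfolding ae_eq_def by (auto elim: eventually_elim2)

instance
  by standard (transfer; auto simp: ae_eq_def algebra_simps)+

end

lift_definition scale_mclass :: "complex \<Rightarrow> mclass \<Rightarrow> mclass" is "\<lambda>c f z. c * f z"
  unfolding ae_eq_def by auto

interpretation mclass: complex_vector_space scale_mclass
  by standard (transfer; auto simp: ae_eq_def algebra_simps)+

lift_definition in_Lp :: "real \<Rightarrow> mclass \<Rightarrow> bool" is
  "\<lambda>p f. integrable lborel (\<lambda>z. norm (f z) powr p)"
  unfolding ae_eq_def by (intro integrable_cong_AE) auto

definition Lp :: "real \<Rightarrow> mclass set" where
  "Lp p = {h. in_Lp p h}"

lift_definition Lp_norm :: "real \<Rightarrow> mclass \<Rightarrow> real" is
  "\<lambda>p f. (\<integral>z. norm (f z) powr p \<partial>lborel) powr (1 / p)"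
  unfolding ae_eq_def by (intro arg_cong[where f = "\<lambda>x. x powr _"] integral_cong_AE) auto

section \<open>Cauchy transforms and the operator $T(0)$\<close>

definition cauchy_transform :: "(complex \<Rightarrow> complex) \<Rightarrow> complex \<Rightarrow> complex" where
  "cauchy_transform f z = of_real (1 / pi) * (\<integral>\<zeta>. f \<zeta> / (z - \<zeta>) \<partial>lborel)"

definition conj_cauchy_transform :: "(complex \<Rightarrow> complex) \<Rightarrow> complex \<Rightarrow> complex" where
  "conj_cauchy_transform f z = of_real (1 / pi) * (\<integral>\<zeta>. f \<zeta> / (cnj z - cnj \<zeta>) \<partial>lborel)"

definition rho :: "complex \<Rightarrow> real" where
  "rho z = sqrt (1 + (cmod z)\<^sup>2)"

lemma borel_measurable_rho [measurable]: "rho \<in> borel_measurable borel"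
  unfolding rho_def by measurable

lemma borel_measurable_cnj [measurable]: "cnj \<in> borel_measurable borel"
  by (intro borel_measurable_continuous_onI continuous_intros)

definition T0_fun :: "(complex \<Rightarrow> complex) \<Rightarrow> complex \<Rightarrow> complex" where
  "T0_fun h = (\<lambda>z. - cauchy_transform
     (\<lambda>w. of_real (rho w powi (-2)) *
        conj_cauchy_transform (\<lambda>\<zeta>. of_real (rho \<zeta> powi (-2)) * h \<zeta>) w) z)"

lemma cauchy_transform_measurable [measurable]:
  assumes [measurable]: "f \<in> borel_measurable borel"
  shows "cauchy_transform f \<in> borel_measurable borel"
  unfolding cauchy_transform_def by measurable

lemma conj_cauchy_transform_measurable [measurable]:
  assumes [measurable]: "f \<in> borel_measurable borel"
  shows "conj_cauchy_transform f \<in> borel_measurable borel"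
  unfolding conj_cauchy_transform_def by measurable

lemma T0_fun_measurable [measurable]:
  assumes [measurable]: "h \<in> borel_measurable borel"
  shows "T0_fun h \<in> borel_measurable borel"
  unfolding T0_fun_def power_int_def by measurable

lemma conj_cauchy_transform_cong_AE:
  assumes [measurable]: "f \<in> borel_measurable borel" "g \<in> borel_measurable borel"
    and "AE z in lborel. f z = g z"
  shows "conj_cauchy_transform f = conj_cauchy_transform g"
  unfolding conj_cauchy_transform_def
  by (intro ext arg_cong2[where f = "(*)"] refl integral_cong_AE) (use assms(3) in auto)

lift_definition T0 :: "mclass \<Rightarrow> mclass" is T0_fun
proof -
  fix f g assume "ae_eq f g"
  then have [measurable]: "f \<in> borel_measurable borel" "g \<in> borel_measurable borel"
    and eq: "AE z in lborel. f z = g z"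
    by (auto simp: ae_eq_def)
  have "conj_cauchy_transform (\<lambda>\<zeta>. of_real (rho \<zeta> powi (-2)) * f \<zeta>) =
        conj_cauchy_transform (\<lambda>\<zeta>. of_real (rho \<zeta> powi (-2)) * g \<zeta>)"
    by (rule conj_cauchy_transform_cong_AE)
       (use eq in \<open>auto simp: power_int_def\<close>)
  then show "ae_eq (T0_fun f) (T0_fun g)"
    using T0_fun_measurable[of f] by (simp add: ae_eq_def T0_fun_def)
qed

end

theory Submission
  imports Defs "HOL-Complex_Analysis.Great_Picard" "HOL-Real_Asymp.Real_Asymp"
begin

text \<open>
  A fixed point \<open>h\<close> of \<open>T(0)\<close> solves, with \<open>g\<close> the inner transform and \<open>r = 1 + \<bar>z\<bar>\<^sup>2\<close>, the first order
  system in which \<open>h\<close> has \<open>cnj z\<close>-derivative \<open>- g / r\<close> and \<open>g\<close> has \<open>z\<close>-derivative \<open>h / r\<close>. Tested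
  against \<open>(1 + z cnj a) log (\<bar>z - a\<bar>\<^sup>2 / r) / r\<close>, regularised near \<open>a\<close>, this system gives the reproducing
  formula \<open>(1 + \<bar>a\<bar>\<^sup>2) h(a) = 2 / pi * \<integral> h (1 + z cnj a) / r\<^sup>2\<close>. Its right-hand side is affine in
  \<open>cnj a\<close>, so the eigenspace is spanned by \<open>1 / r\<close> and \<open>cnj z / r\<close>, and these are indeed fixed.
  The eigenvalue is semisimple because \<open>T(0)\<close> is symmetric in \<open>L\<^sup>2\<close> with weight \<open>1 / r\<close>. For compactness,
  the inner transform maps bounded sets of \<open>L\<^sup>p\<close> to uniformly bounded functions, and the outer one maps
  these to functions that are uniformly Hoelder continuous and dominated by a fixed function in \<open>L\<^sup>p\<close>.
\<close>

section \<open>Lebesgue measure on the plane\<close>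

text \<open>Eliminating \<open>h\<close> from the system shows where the test function comes from:
  \<open>r\<close> times the \<open>z\<close>-derivative of \<open>g\<close> has
  \<open>cnj z\<close>-derivative \<open>- g / r\<close>. The quotient
  \<open>(1 + z * cnj a) / r\<close> solves this equation, being
  \<open>coeigenfun (cnj a) (-1)\<close>. Multiplying it by the logarithm of the squared chordal
  distance plants a point mass at \<open>a\<close>; all terms with an undifferentiated logarithm
  cancel, and a smooth remainder \<open>- 2 * (1 + z * cnj a) / r\<^sup>2\<close> is left. It cannot
  be absent, since an exact Green function would force every fixed point to vanish. This remainder
  becomes the reproducing kernel.

  Elements of \<open>Lp p\<close> are classes, whereas the formula evaluates \<open>h\<close> at a
  point. As \<open>T0_fun\<close> does not see null sets, applying it once to a representative of a
  fixed class gives a continuous, decaying function that is fixed at every point.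

  The hypothesis \<open>p > 2\<close> enters twice: the dual exponent is below 2, so that the Cauchy
  kernel lies locally in the dual space, and \<open>rho powr (-b)\<close> is in \<open>Lp p\<close>
  for some \<open>b < 1\<close>, a decay that the Cauchy transform provides.\<close>

lemma measurable_Complex [measurable]:
  "(\<lambda>(x, y). Complex x y) \<in> borel_measurable (lborel \<Otimes>\<^sub>M lborel)"
  unfolding lborel_prod measurable_lborel1 measurable_lborel2
  by (intro borel_measurable_continuous_onI) (simp add: Complex_eq case_prod_unfold continuous_intros)

text \<open>A measure that gives every box its area is \<open>lborel\<close>, so comparing boxes
  suffices. This opens the plane to Tonelli and Fubini in the coordinates.\<close>

lemma lborel_complex:
  "(lborel :: complex measure) = distr (lborel \<Otimes>\<^sub>M lborel) borel (\<lambda>(x, y). Complex x y)"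
proof (rule lborel_eqI)
  fix l u :: complex
  assume le: "\<And>b. b \<in> Basis \<Longrightarrow> l \<bullet> b \<le> u \<bullet> b"
  have *: "Re l \<le> Re u" "Im l \<le> Im u"
    using le[of 1] le[of \<i>] by (auto simp: Basis_complex_def)
  have v: "(\<lambda>(x, y). Complex x y) -` box l u \<inter> space (lborel \<Otimes>\<^sub>M lborel)
    = {Re l <..< Re u} \<times> {Im l <..< Im u}"
    by (auto simp: box_def Basis_complex_def space_pair_measure)
  show "emeasure (distr (lborel \<Otimes>\<^sub>M lborel) borel (\<lambda>(x, y). Complex x y)) (box l u)
    = ennreal (\<Prod>b\<in>Basis. (u - l) \<bullet> b)"
    using * by (subst emeasure_distr) (auto simp: v lborel.emeasure_pair_measure_Times Basis_complex_def ennreal_mult[symmetric])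
qed simp

lemma nn_integral_complex:
  assumes [measurable]: "f \<in> borel_measurable borel"
  shows "(\<integral>\<^sup>+z. f z \<partial>lborel) = (\<integral>\<^sup>+x. (\<integral>\<^sup>+y. f (Complex x y) \<partial>lborel) \<partial>lborel)"
proof -
  have "(\<integral>\<^sup>+z. f z \<partial>lborel) = (\<integral>\<^sup>+z. f ((\<lambda>(x, y). Complex x y) z) \<partial>(lborel \<Otimes>\<^sub>M lborel))"
    by (subst lborel_complex, subst nn_integral_distr) auto
  then show ?thesis
    using lborel.nn_integral_fst[of "\<lambda>(x, y). f (Complex x y)" lborel] by (simp add: case_prod_unfold)
qed

lemma
  fixes f :: "complex \<Rightarrow> complex"
  assumes "integrable lborel f"
  shows integral_complex: "(\<integral>z. f z \<partial>lborel) = (\<integral>x. (\<integral>y. f (Complex x y) \<partial>lborel) \<partial>lborel)"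
    and integral_complex_swap: "(\<integral>z. f z \<partial>lborel) = (\<integral>y. (\<integral>x. f (Complex x y) \<partial>lborel) \<partial>lborel)"
proof -
  from assms have [measurable]: "f \<in> borel_measurable borel" by simp
  have i: "integrable (lborel \<Otimes>\<^sub>M lborel) (\<lambda>(x, y). f (Complex x y))"
    using assms by (subst (asm) lborel_complex, subst (asm) integrable_distr_eq) (auto simp: case_prod_unfold)
  have e: "(\<integral>z. f z \<partial>lborel) = (\<integral>z. (\<lambda>(x, y). f (Complex x y)) z \<partial>(lborel \<Otimes>\<^sub>M lborel))"
    by (subst lborel_complex, subst integral_distr) (auto simp: case_prod_unfold)
  show "(\<integral>z. f z \<partial>lborel) = (\<integral>x. (\<integral>y. f (Complex x y) \<partial>lborel) \<partial>lborel)"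
    using lborel_pair.integral_fst[OF i] e by simp
  show "(\<integral>z. f z \<partial>lborel) = (\<integral>y. (\<integral>x. f (Complex x y) \<partial>lborel) \<partial>lborel)"
    using lborel_pair.integral_snd[OF i] e by simp
qed

text \<open>Takes the place of polar coordinates: a radial function is dominated by a product of one
  function of each coordinate, and Tonelli reduces the question to the line.\<close>

lemma integrable_product_bound:
  fixes f :: "complex \<Rightarrow> real" and g :: "real \<Rightarrow> real"
  assumes [measurable]: "f \<in> borel_measurable borel"
    and g: "integrable lborel g"
    and b: "\<And>x y. \<bar>f (Complex x y)\<bar> \<le> g x * g y"
  shows "integrable lborel f"
proof (rule integrableI_bounded)
  have [measurable]: "g \<in> borel_measurable borel" using g by simp
  have "(\<integral>\<^sup>+z. ennreal (norm (f z)) \<partial>lborel)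
      = (\<integral>\<^sup>+x. (\<integral>\<^sup>+y. ennreal (norm (f (Complex x y))) \<partial>lborel) \<partial>lborel)"
    by (rule nn_integral_complex) simp
  also have "\<dots> \<le> (\<integral>\<^sup>+x. (\<integral>\<^sup>+y. ennreal \<bar>g x\<bar> * ennreal \<bar>g y\<bar> \<partial>lborel) \<partial>lborel)"
  proof (intro nn_integral_mono)
    fix x y
    \<comment> \<open>The hypothesis allows both factors to be negative, hence the absolute
      values.\<close>
    have "\<bar>f (Complex x y)\<bar> \<le> \<bar>g x\<bar> * \<bar>g y\<bar>"
      using b[of x y] by (metis abs_ge_self abs_mult order_trans)
    then show "ennreal (norm (f (Complex x y))) \<le> ennreal \<bar>g x\<bar> * ennreal \<bar>g y\<bar>"
      by (simp add: ennreal_mult[symmetric])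
  qed
  also have "\<dots> = (\<integral>\<^sup>+x. ennreal \<bar>g x\<bar> \<partial>lborel) * (\<integral>\<^sup>+x. ennreal \<bar>g x\<bar> \<partial>lborel)"
    by (simp add: nn_integral_cmult nn_integral_multc)
  also have "\<dots> < \<infinity>"
    using g unfolding integrable_iff_bounded by (auto simp: ennreal_mult_less_top)
  finally show "(\<integral>\<^sup>+z. ennreal (norm (f z)) \<partial>lborel) < \<infinity>" .
qed simp

section \<open>Integrable powers on the line and on the plane\<close>

lemma integrable_abs_powr_near:
  assumes "s < 1"
  shows "integrable lborel (\<lambda>x::real. indicator {-1..1} x * \<bar>x\<bar> powr (-s))"
proof -
  have "(\<lambda>x::real. x powr (-s)) integrable_on {0..1}"
    using assms by (intro integrable_on_powr_from_0) auto
  then have "(\<lambda>x::real. x powr (-s)) absolutely_integrable_on {0..1}"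
    by (subst absolutely_integrable_on_iff_nonneg) auto
  then have i: "integrable lborel (\<lambda>x::real. indicator {0..1} x * x powr (-s))"
    unfolding set_integrable_def by (subst (asm) integrable_completion) auto
  \<comment> \<open>The reflection to the negative half-line is kept in the unsimplified form in
    which affine substitution delivers it.\<close>
  have "integrable lborel (\<lambda>x::real. indicator {0..1} (0 + (-1) * x) * (0 + (-1) * x) powr (-s))"
    using lborel_integrable_real_affine[OF i, of "-1" 0] by simp
  with i have "integrable lborel (\<lambda>x::real. indicator {0..1} x * x powr (-s)
      + indicator {0..1} (0 + (-1) * x) * (0 + (-1) * x) powr (-s))"
    by (rule Bochner_Integration.integrable_add)
  then show ?thesis
    by (rule Bochner_Integration.integrable_bound) (auto simp: indicator_def)
qed

lemma integrable_one_plus_square_powr: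
  assumes "b > 1"
  shows "integrable lborel (\<lambda>x::real. (1 + x\<^sup>2) powr (-b/2))"
proof -
  have "(\<lambda>x::real. x powr (-b)) integrable_on {1..}"
    using has_integral_powr_to_inf[of "-b" 1] assms unfolding integrable_on_def by fastforce
  then have "(\<lambda>x::real. x powr (-b)) absolutely_integrable_on {1..}"
    by (subst absolutely_integrable_on_iff_nonneg) auto
  then have i: "integrable lborel (\<lambda>x::real. indicator {1..} x * x powr (-b))"
    unfolding set_integrable_def by (subst (asm) integrable_completion) auto
  have "integrable lborel (\<lambda>x::real. indicator {1..} (0 + (-1) * x) * (0 + (-1) * x) powr (-b))"
    using lborel_integrable_real_affine[OF i, of "-1" 0] by simp
  with i have "integrable lborel (\<lambda>x::real. indicator {1..} x * x powr (-b)
      + indicator {1..} (0 + (-1) * x) * (0 + (-1) * x) powr (-b))"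
    by (rule Bochner_Integration.integrable_add)
  moreover have "integrable lborel (indicat_real {-1..1::real})" by simp
  ultimately have "integrable lborel (\<lambda>x::real. (indicator {1..} x * x powr (-b)
      + indicator {1..} (0 + (-1) * x) * (0 + (-1) * x) powr (-b)) + indicator {-1..1} x)"
    by (rule Bochner_Integration.integrable_add)
  then show ?thesis
  proof (rule Bochner_Integration.integrable_bound)
    have *: "(1 + x\<^sup>2) powr (-b/2) \<le> \<bar>x\<bar> powr (-b)" if "\<bar>x\<bar> \<ge> 1" for x :: real
    proof -
      have "(1 + x\<^sup>2) powr (-b/2) \<le> (\<bar>x\<bar> powr 2) powr (-b/2)"
        using that assms by (intro powr_mono2') auto
      also have "\<dots> = \<bar>x\<bar> powr (-b)" by (subst powr_powr) simp
      finally show ?thesis .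
    qed
    have **: "(1 + x\<^sup>2) powr (-b/2) \<le> 1" for x :: real
      using powr_mono2'[of "-b/2" 1 "1 + x\<^sup>2"] assms by simp
    show "AE x in lborel. norm ((1 + x\<^sup>2) powr (- b / 2))
       \<le> norm (indicat_real {1..} x * x powr - b + indicat_real {1..} (0 + - 1 * x) * (0 + - 1 * x) powr - b +
               indicat_real {- 1..1} x)"
    proof (rule AE_I2)
      fix x :: real
      consider "x \<ge> 1" | "x \<le> -1" | "-1 < x" "x < 1" by linarith
      then show "norm ((1 + x\<^sup>2) powr (- b / 2))
       \<le> norm (indicat_real {1..} x * x powr - b + indicat_real {1..} (0 + - 1 * x) * (0 + - 1 * x) powr - b +
               indicat_real {- 1..1} x)"
        using *[of x] **[of x] by cases (auto simp: indicator_def)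
    qed
  qed simp
qed

lemma rho_ge_1: "rho z \<ge> 1" and rho_pos: "rho z > 0" and rho_ge_cmod: "rho z \<ge> cmod z"
  by (auto simp: rho_def add_pos_nonneg intro: real_le_rsqrt)

lemma rho_power2: "(rho z)\<^sup>2 = 1 + (cmod z)\<^sup>2"
  by (simp add: rho_def)

lemma rho_powr: "rho z powr q = (1 + (cmod z)\<^sup>2) powr (q / 2)"
  unfolding rho_def by (simp add: powr_half_sqrt[symmetric] powr_powr)

text \<open>Half of the exponent is spent on each coordinate, and \<open>q / 2 > 1\<close> is what
  the integral on the line requires.\<close>

lemma integrable_rho_powr:
  assumes "q > 2"
  shows "integrable lborel (\<lambda>z. rho z powr (-q))"
proof (rule integrable_product_bound)
  show "integrable lborel (\<lambda>x::real. (1 + x\<^sup>2) powr (-(q/2)/2))"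
    using assms by (intro integrable_one_plus_square_powr) auto
  fix x y :: real
  have "rho (Complex x y) powr (-q) = (1 + x\<^sup>2 + y\<^sup>2) powr (-(q/2)/2) * (1 + x\<^sup>2 + y\<^sup>2) powr (-(q/2)/2)"
    by (simp add: rho_powr cmod_power2 powr_add[symmetric] add.assoc)
  also have "\<dots> \<le> (1 + x\<^sup>2) powr (-(q/2)/2) * (1 + y\<^sup>2) powr (-(q/2)/2)"
    using assms by (intro mult_mono powr_mono2') (auto simp: add_pos_nonneg)
  finally show "\<bar>rho (Complex x y) powr (-q)\<bar> \<le> (1 + x\<^sup>2) powr (-(q/2)/2) * (1 + y\<^sup>2) powr (-(q/2)/2)"
    by simp
qed simp

text \<open>The exponent is again split evenly, and \<open>s / 2 < 1\<close> makes each factor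
  integrable at 0.\<close>

lemma integrable_cmod_powr_near:
  assumes "0 \<le> s" "s < 2"
  shows "integrable lborel (\<lambda>z. indicator (cball 0 1) z * cmod z powr (-s))"
proof -
  have [measurable]: "Re \<in> borel_measurable borel" "Im \<in> borel_measurable borel"
    by (auto intro!: borel_measurable_continuous_onI continuous_intros)
  have [measurable]: "cball (0::complex) 1 \<in> sets borel" by simp
  \<comment> \<open>On the axes one factor of the product bound is
    \<open>0 powr (-(s/2)) = 0\<close>, so the bound fails there; the function is set to 0 on this
    null set.\<close>
  have "integrable lborel (\<lambda>z. if Re z = 0 \<or> Im z = 0 then 0 else indicator (cball 0 1) z * cmod z powr (-s))"
  proof (rule integrable_product_bound)
    show "integrable lborel (\<lambda>x::real. indicator {-1..1} x * \<bar>x\<bar> powr (-(s/2)))"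
      using assms by (intro integrable_abs_powr_near) auto
    fix x y :: real
    let ?z = "Complex x y"
    have c: "\<bar>x\<bar> \<le> cmod ?z" "\<bar>y\<bar> \<le> cmod ?z"
      using abs_Re_le_cmod[of ?z] abs_Im_le_cmod[of ?z] by auto
    have "cmod ?z powr (-s) \<le> \<bar>x\<bar> powr (-(s/2)) * \<bar>y\<bar> powr (-(s/2))" if "x \<noteq> 0" "y \<noteq> 0"
    proof -
      have "cmod ?z powr (-s) = cmod ?z powr (-(s/2)) * cmod ?z powr (-(s/2))"
        by (simp add: powr_add[symmetric])
      also have "\<dots> \<le> \<bar>x\<bar> powr (-(s/2)) * \<bar>y\<bar> powr (-(s/2))"
        using assms that c by (intro mult_mono powr_mono2') auto
      finally show ?thesis .
    qed
    with c show "\<bar>if Re ?z = 0 \<or> Im ?z = 0 then 0 else indicator (cball 0 1) ?z * cmod ?z powr (-s)\<bar>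
      \<le> indicator {-1..1} x * \<bar>x\<bar> powr (-(s/2)) * (indicator {-1..1} y * \<bar>y\<bar> powr (-(s/2)))"
      by (auto simp: indicator_def)
  qed simp
  moreover have "AE z in lborel. Re z \<noteq> 0 \<and> Im z \<noteq> 0"
  proof -
    have "emeasure lborel {z. Re z = 0 \<or> Im z = 0}
      = (\<integral>\<^sup>+z. indicator {z. Re z = 0 \<or> Im z = 0} z \<partial>lborel)" by simp
    also have "\<dots> = (\<integral>\<^sup>+x. (\<integral>\<^sup>+y. indicator {z. Re z = 0 \<or> Im z = 0} (Complex x y) \<partial>lborel) \<partial>lborel)"
      by (rule nn_integral_complex) simp
    also have "\<dots> = (\<integral>\<^sup>+x. 0 \<partial>(lborel::real measure))"
    proof (rule nn_integral_cong_AE)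
      have "AE x in lborel. x \<noteq> (0::real)" by (rule AE_lborel_singleton)
      then show "AE x in lborel. (\<integral>\<^sup>+y. indicator {z. Re z = 0 \<or> Im z = 0} (Complex x y) \<partial>lborel) = 0"
      proof eventually_elim
        case (elim x)
        have "(\<integral>\<^sup>+y. indicator {z. Re z = 0 \<or> Im z = 0} (Complex x y) \<partial>lborel)
          = (\<integral>\<^sup>+y. indicator {0} y \<partial>(lborel::real measure))"
          using elim by (intro nn_integral_cong) (auto simp: indicator_def)
        then show ?case by simp
      qed
    qed
    finally have "emeasure lborel {z. Re z = 0 \<or> Im z = 0} = 0" by simp
    then show ?thesis by (intro AE_I[of _ _ "{z. Re z = 0 \<or> Im z = 0}"]) auto
  qed
  ultimately show ?thesis
    by (subst integrable_cong_AE[where g = "\<lambda>z. if Re z = 0 \<or> Im z = 0 then 0 else indicator (cball 0 1) z * cmod z powr (-s)"])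
       auto
qed

section \<open>Weighted Cauchy kernels\<close>

lemma
  fixes f :: "complex \<Rightarrow> 'a::{banach, second_countable_topology}"
  assumes f: "integrable lborel f" and t: "t \<noteq> 0"
  shows integrable_complex_affine: "integrable lborel (\<lambda>x. f (a + of_real t * x))"
    and integral_complex_affine: "(\<integral>x. f x \<partial>lborel) = t\<^sup>2 *\<^sub>R (\<integral>x. f (a + of_real t * x) \<partial>lborel)"
proof -
  from f have [measurable]: "f \<in> borel_measurable borel" by simp
  have l: "(lborel :: complex measure) = density (distr lborel borel (\<lambda>x. a + of_real t * x)) (\<lambda>_. ennreal (t\<^sup>2))"
    using lborel_affine[of t a] t by (simp add: scaleR_conv_of_real ennreal_power[symmetric])
  from f have "integrable (density (distr lborel borel (\<lambda>x. a + of_real t * x)) (\<lambda>_. ennreal (t\<^sup>2))) f"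
    using l by simp
  then have "integrable lborel (\<lambda>x. t\<^sup>2 *\<^sub>R f (a + of_real t * x))"
    by (subst (asm) integrable_density) (auto simp: integrable_distr_eq)
  then show "integrable lborel (\<lambda>x. f (a + of_real t * x))"
    using integrable_scaleR_right[of "inverse (t\<^sup>2)" lborel "\<lambda>x. t\<^sup>2 *\<^sub>R f (a + of_real t * x)"] t by simp
  have "(\<integral>x. f x \<partial>lborel) = integral\<^sup>L (density (distr lborel borel (\<lambda>x. a + of_real t * x)) (\<lambda>_. ennreal (t\<^sup>2))) f"
    using l by simp
  also have "\<dots> = t\<^sup>2 *\<^sub>R (\<integral>x. f (a + of_real t * x) \<partial>lborel)"
    by (subst integral_density) (auto simp: integral_distr)
  finally show "(\<integral>x. f x \<partial>lborel) = t\<^sup>2 *\<^sub>R (\<integral>x. f (a + of_real t * x) \<partial>lborel)" .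
qed

lemma
  fixes f :: "complex \<Rightarrow> 'a::{banach, second_countable_topology}"
  assumes f: "integrable lborel f"
  shows integrable_complex_reflect: "integrable lborel (\<lambda>x. f (a - x))"
    and integral_complex_reflect: "(\<integral>x. f (a - x) \<partial>lborel) = (\<integral>x. f x \<partial>lborel)"
  using integrable_complex_affine[OF f, of "-1" a] integral_complex_affine[OF f, of "-1" a] by simp_all

lemma powr_add_le:
  fixes x y b :: real
  assumes "0 \<le> x" "0 \<le> y" "0 \<le> b"
  shows "(x + y) powr b \<le> 2 powr b * (x powr b + y powr b)"
proof -
  have "(x + y) powr b \<le> (2 * max x y) powr b"
    using assms by (intro powr_mono2) auto
  also have "\<dots> = 2 powr b * max x y powr b"
    using assms by (subst powr_mult) auto
  also have "\<dots> \<le> 2 powr b * (x powr b + y powr b)"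
    by (intro mult_left_mono) (auto simp: max_def)
  finally show ?thesis .
qed

lemma rho_le_add: "rho z \<le> rho x + cmod (z - x)"
proof -
  have "cmod z \<le> cmod x + cmod (z - x)"
    by (metis add.commute diff_add_cancel norm_triangle_ineq)
  then have "(cmod z)\<^sup>2 \<le> (cmod x + cmod (z - x))\<^sup>2" by (intro power_mono) auto
  moreover have "cmod x * cmod (z - x) \<le> rho x * cmod (z - x)"
    by (intro mult_right_mono rho_ge_cmod) auto
  ultimately have "(rho z)\<^sup>2 \<le> (rho x + cmod (z - x))\<^sup>2"
    by (simp add: rho_power2 power2_sum)
  then show ?thesis
    by (rule power2_le_imp_le) (simp add: add_nonneg_nonneg less_imp_le[OF rho_pos])
qed

lemma rho_powr_le_1: "0 \<le> t \<Longrightarrow> rho z powr (-t) \<le> 1"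
  using powr_mono2'[of "-t" 1 "rho z"] rho_ge_1[of z] by simp

lemma rho_powr_mono: "s \<le> t \<Longrightarrow> rho z powr (-t) \<le> rho z powr (-s)"
  using rho_ge_1[of z] by (intro powr_mono) auto

lemma half_powr: "0 < x \<Longrightarrow> (x / 2) powr (-q) = 2 powr q * x powr (-q)" for x :: real
  by (simp only: powr_divide powr_minus less_imp_le) (simp add: field_simps)

text \<open>The constant is uniform in \<open>z\<close>. Within distance 1 of \<open>z\<close> the
  kernel is integrable because \<open>s < 2\<close>. Farther away the larger of \<open>rho x\<close>
  and \<open>cmod (z - x)\<close> is replaced by the smaller one, which then carries the whole
  exponent \<open>t + s > 2\<close>; this leaves an integrable power centred at \<open>0\<close> or
  at \<open>z\<close>.\<close>

lemma kernel_bound: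
  assumes "0 \<le> s" "s < 2" "0 \<le> t" "t + s > 2"
  obtains K where "K \<ge> 0"
    and "\<And>z. integrable lborel (\<lambda>x. rho x powr (-t) * cmod (z - x) powr (-s))"
    and "\<And>z. (\<integral>x. rho x powr (-t) * cmod (z - x) powr (-s) \<partial>lborel) \<le> K"
proof -
  let ?q = "t + s"
  let ?n = "\<lambda>u. indicator (cball 0 1) u * cmod u powr (-s)"
  let ?r = "\<lambda>u. rho u powr (-?q)"
  let ?G = "\<lambda>z x. (?n (z - x) + 2 powr ?q * ?r (z - x)) + ?r x"
  let ?K = "((\<integral>u. ?n u \<partial>lborel) + 2 powr ?q * (\<integral>u. ?r u \<partial>lborel)) + (\<integral>u. ?r u \<partial>lborel)"
  have n: "integrable lborel ?n" using assms by (intro integrable_cmod_powr_near) auto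
  have r: "integrable lborel ?r" using assms by (intro integrable_rho_powr) auto
  have G: "integrable lborel (?G z)" for z
    using integrable_complex_reflect[OF n, of z] integrable_complex_reflect[OF r, of z] r
    by (intro Bochner_Integration.integrable_add integrable_mult_right) auto
  have Gi: "(\<integral>x. ?G z x \<partial>lborel) = ?K" for z
    using integrable_complex_reflect[OF n, of z] integrable_complex_reflect[OF r, of z] r
      integral_complex_reflect[OF n, of z] integral_complex_reflect[OF r, of z]
    by (simp add: Bochner_Integration.integral_add)
  have le: "rho x powr (-t) * cmod (z - x) powr (-s) \<le> ?G z x" for z x
  proof (cases "cmod (z - x) \<le> 1")
    case True
    have "rho x powr (-t) * cmod (z - x) powr (-s) \<le> 1 * cmod (z - x) powr (-s)"
      using assms by (intro mult_right_mono rho_powr_le_1) auto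
    also have "\<dots> \<le> ?G z x" using True by simp
    finally show ?thesis .
  next
    case False
    let ?d = "cmod (z - x)"
    show ?thesis
    proof (cases "rho x \<le> ?d")
      case True
      have "rho x powr (-t) * ?d powr (-s) \<le> rho x powr (-t) * rho x powr (-s)"
        using True rho_pos[of x] assms by (intro mult_left_mono powr_mono2') auto
      also have "\<dots> = ?r x" by (simp add: powr_add[symmetric])
      also have "\<dots> \<le> ?G z x" by simp
      finally show ?thesis .
    next
      case f: False
      have "rho x powr (-t) * ?d powr (-s) \<le> ?d powr (-t) * ?d powr (-s)"
        using False f assms by (intro mult_right_mono powr_mono2') auto
      also have "\<dots> = ?d powr (-?q)" by (simp add: powr_add[symmetric])
      also have "\<dots> \<le> (rho (z - x) / 2) powr (-?q)"
      proof (rule powr_mono2')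
        have "rho (z - x) \<le> 1 + ?d" using rho_le_add[of "z - x" 0] by (simp add: rho_def)
        then show "rho (z - x) / 2 \<le> ?d" using False by simp
      qed (use assms rho_pos in auto)
      also have "\<dots> = 2 powr ?q * ?r (z - x)"
        by (rule half_powr[OF rho_pos])
      also have "\<dots> \<le> ?G z x" by simp
      finally show ?thesis .
    qed
  qed
  have i: "integrable lborel (\<lambda>x. rho x powr (-t) * cmod (z - x) powr (-s))" for z
    by (rule Bochner_Integration.integrable_bound[OF G[of z]]) (use le in \<open>auto intro!: AE_I2 order_trans[OF le]\<close>)
  show thesis
  proof (rule that[of ?K])
    show "(\<integral>x. rho x powr (-t) * cmod (z - x) powr (-s) \<partial>lborel) \<le> ?K" for z
      using integral_mono[OF i[of z] G[of z]] le Gi[of z] by simp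
    show "?K \<ge> 0" by (intro add_nonneg_nonneg mult_nonneg_nonneg integral_nonneg_AE) auto
  qed (rule i)
qed

text \<open>By \<open>rho z \<le> rho x + cmod (z - x)\<close>, the factor
  \<open>rho z powr b\<close> can be charged either to the weight, lowering its exponent to
  \<open>2 - b\<close>, or to the kernel, lowering its exponent to \<open>1 - b\<close>. In both
  cases the total exponent is \<open>3 - b\<close>, which exceeds 2 because
  \<open>b < 1\<close>.\<close>

lemma kernel_decay:
  assumes b: "0 \<le> b" "b < 1"
  obtains K where "K \<ge> 0"
    and "\<And>z. (\<integral>x. rho x powr (-2) * cmod (z - x) powr (-1) \<partial>lborel) \<le> K * rho z powr (-b)"
proof -
  obtain K1 where K1: "K1 \<ge> 0"
    "\<And>z. integrable lborel (\<lambda>x. rho x powr (-(2-b)) * cmod (z - x) powr (-1))"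
    "\<And>z. (\<integral>x. rho x powr (-(2-b)) * cmod (z - x) powr (-1) \<partial>lborel) \<le> K1"
    by (rule kernel_bound[of 1 "2 - b"]) (use b in auto)
  obtain K2 where K2: "K2 \<ge> 0"
    "\<And>z. integrable lborel (\<lambda>x. rho x powr (-2) * cmod (z - x) powr (-(1-b)))"
    "\<And>z. (\<integral>x. rho x powr (-2) * cmod (z - x) powr (-(1-b)) \<partial>lborel) \<le> K2"
    by (rule kernel_bound[of "1 - b" 2]) (use b in auto)
  obtain K0 where K0: 
    "\<And>z. integrable lborel (\<lambda>x. rho x powr (-2) * cmod (z - x) powr (-1))"
    by (rule kernel_bound[of "1" 2]) auto
  let ?G = "\<lambda>z x. 2 powr b * (rho x powr (-(2-b)) * cmod (z - x) powr (-1)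
      + rho x powr (-2) * cmod (z - x) powr (-(1-b)))"
  show thesis
  proof (rule that[of "2 powr b * (K1 + K2)"])
    show "0 \<le> 2 powr b * (K1 + K2)" using K1 K2 by simp
    fix z
    have le: "rho z powr b * (rho x powr (-2) * cmod (z - x) powr (-1)) \<le> ?G z x" for x
    proof -
      have "rho z powr b \<le> (rho x + cmod (z - x)) powr b"
        using b rho_pos[of z] by (intro powr_mono2 rho_le_add) auto
      also have "\<dots> \<le> 2 powr b * (rho x powr b + cmod (z - x) powr b)"
        using b rho_pos[of x] by (intro powr_add_le) auto
      finally have "rho z powr b * (rho x powr (-2) * cmod (z - x) powr (-1))
        \<le> 2 powr b * (rho x powr b + cmod (z - x) powr b) * (rho x powr (-2) * cmod (z - x) powr (-1))"
        by (rule mult_right_mono) simp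
      also have "\<dots> = 2 powr b * ((rho x powr b * rho x powr (-2)) * cmod (z - x) powr (-1)
         + rho x powr (-2) * (cmod (z - x) powr b * cmod (z - x) powr (-1)))"
        by (simp add: algebra_simps)
      also have "\<dots> = ?G z x" by (simp only: powr_add[symmetric]) simp
      finally show ?thesis .
    qed
    have "rho z powr b * (\<integral>x. rho x powr (-2) * cmod (z - x) powr (-1) \<partial>lborel)
      = (\<integral>x. rho z powr b * (rho x powr (-2) * cmod (z - x) powr (-1)) \<partial>lborel)"
      by (rule Bochner_Integration.integral_mult_right_zero[symmetric])
    also have "\<dots> \<le> (\<integral>x. ?G z x \<partial>lborel)"
      using K0 K1(2) K2(2) le by (intro integral_mono integrable_mult_right Bochner_Integration.integrable_add) auto
    also have "\<dots> \<le> 2 powr b * (K1 + K2)"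
      using K1(2,3)[of z] K2(2,3)[of z] by (simp add: Bochner_Integration.integral_add)
    finally show "(\<integral>x. rho x powr (-2) * cmod (z - x) powr (-1) \<partial>lborel) \<le> 2 powr b * (K1 + K2) * rho z powr (-b)"
      using rho_pos[of z] by (simp add: powr_minus field_simps)
  qed
qed

section \<open>Decay and Hoelder continuity of Cauchy transforms\<close>

lemma conj_cauchy_transform_cnj: "conj_cauchy_transform f z = cnj (cauchy_transform (\<lambda>x. cnj (f x)) z)"
proof -
  have "(\<lambda>x. f x / (cnj z - cnj x)) = (\<lambda>x. cnj (cnj (f x) / (z - x)))" by simp
  then show ?thesis
    unfolding conj_cauchy_transform_def cauchy_transform_def
    by (simp only: Bochner_Integration.integral_cnj complex_cnj_mult complex_cnj_complex_of_real)
qed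

text \<open>At \<open>z = x\<close> both sides are 0, since \<open>f / 0 = 0\<close> and
  \<open>0 powr (-1) = 0\<close>; hence no exceptional point has to be carried along.\<close>

lemma norm_cauchy_kernel: "cmod (f / (z - x)) = cmod f * cmod (z - x) powr (-1)"
  by (cases "z = x") (auto simp: norm_divide powr_minus_divide)

lemma cauchy_integrable:
  fixes f :: "complex \<Rightarrow> complex"
  assumes [measurable]: "f \<in> borel_measurable borel"
    and le: "\<And>x. cmod (f x) \<le> M * rho x powr (-2)"
  shows "integrable lborel (\<lambda>x. f x / (z - x))"
proof -
  obtain K where 
    "\<And>z. integrable lborel (\<lambda>x. rho x powr (-2) * cmod (z - x) powr (-1))"
    by (rule kernel_bound[of "1" 2]) auto
  then have "integrable lborel (\<lambda>x. M * (rho x powr (-2) * cmod (z - x) powr (-1)))"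
    by (intro integrable_mult_right)
  then show ?thesis
  proof (rule Bochner_Integration.integrable_bound)
    show "AE x in lborel. norm (f x / (z - x)) \<le> norm (M * (rho x powr (-2) * cmod (z - x) powr (-1)))"
    proof (rule AE_I2)
      fix x
      have "norm (f x / (z - x)) \<le> (M * rho x powr (-2)) * cmod (z - x) powr (-1)"
        unfolding norm_cauchy_kernel by (intro mult_right_mono le) auto
      also have "\<dots> \<le> norm (M * (rho x powr (-2) * cmod (z - x) powr (-1)))"
        by (simp only: mult.assoc real_norm_def abs_ge_self)
      finally show "norm (f x / (z - x)) \<le> norm (M * (rho x powr (-2) * cmod (z - x) powr (-1)))" .
    qed
  qed simp
qed

lemma one_div_pi_le: "0 \<le> x \<Longrightarrow> 1 / pi * x \<le> x"
  using pi_gt3 mult_right_mono[of 1 pi x] by (simp add: field_simps)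

text \<open>\<open>K\<close> is chosen before \<open>f\<close> and \<open>M\<close>: compactness
  needs one bound for a whole sequence of functions.\<close>

lemma cauchy_decay:
  assumes b: "0 \<le> b" "b < 1"
  obtains K where "K \<ge> 0"
    and "\<And>f M z. f \<in> borel_measurable borel \<Longrightarrow> (\<And>x. cmod (f x) \<le> M * rho x powr (-2)) \<Longrightarrow>
      cmod (cauchy_transform f z) \<le> M * (K * rho z powr (-b))"
proof -
  obtain K where K: "K \<ge> 0"
    "\<And>z. (\<integral>x. rho x powr (-2) * cmod (z - x) powr (-1) \<partial>lborel) \<le> K * rho z powr (-b)"
    using kernel_decay[OF b] by metis
  obtain K0 where K0: 
    "\<And>z. integrable lborel (\<lambda>x. rho x powr (-2) * cmod (z - x) powr (-1))"
    by (rule kernel_bound[of "1" 2]) auto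
  show thesis
  proof (rule that[of K])
    fix f :: "complex \<Rightarrow> complex" and M z
    assume [measurable]: "f \<in> borel_measurable borel" and le: "\<And>x. cmod (f x) \<le> M * rho x powr (-2)"
    \<comment> \<open>\<open>rho 0 = 1\<close>, so the hypothesis at 0 bounds a norm by
      \<open>M\<close>.\<close>
    have M: "M \<ge> 0" using le[of 0] by (simp add: rho_def) (meson norm_ge_zero order_trans)
    have "cmod (cauchy_transform f z) = 1 / pi * cmod (\<integral>x. f x / (z - x) \<partial>lborel)"
      by (simp add: cauchy_transform_def norm_mult norm_divide)
    also have "\<dots> \<le> cmod (\<integral>x. f x / (z - x) \<partial>lborel)" by (rule one_div_pi_le) simp
    also have "\<dots> \<le> (\<integral>x. cmod (f x / (z - x)) \<partial>lborel)" by simp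
    also have "\<dots> \<le> (\<integral>x. M * (rho x powr (-2) * cmod (z - x) powr (-1)) \<partial>lborel)"
    proof (rule integral_mono)
      show "cmod (f x / (z - x)) \<le> M * (rho x powr (-2) * cmod (z - x) powr (-1))" for x
        unfolding norm_cauchy_kernel mult.assoc[symmetric] by (intro mult_right_mono le) auto
      show "integrable lborel (\<lambda>x. M * (rho x powr (-2) * cmod (z - x) powr (-1)))"
        by (intro integrable_mult_right K0)
      show "integrable lborel (\<lambda>x. cmod (f x / (z - x)))"
        using cauchy_integrable[OF _ le, of z] by simp
    qed
    also have "\<dots> \<le> M * (K * rho z powr (-b))"
      using mult_left_mono[OF K(2)[of z] M] by (subst Bochner_Integration.integral_mult_right_zero)
    finally show "cmod (cauchy_transform f z) \<le> M * (K * rho z powr (-b))" .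
  qed (rule K(1))
qed

lemma square_powr_minus: "0 < c \<Longrightarrow> (c\<^sup>2) powr (-3/2) = 1 / c ^ 3" for c :: real
proof -
  assume c: "0 < c"
  then have "(c\<^sup>2) powr (-3/2) = (c powr 2) powr (-3/2)" by simp
  also have "\<dots> = c powr (-3)" by (subst powr_powr) simp
  also have "\<dots> = 1 / c ^ 3" using c by (subst powr_minus_divide) simp
  finally show ?thesis .
qed

text \<open>Of the factor \<open>cmod (z - y)\<close> in the numerator one square root is kept, and
  the other is at most the sum of the square roots of \<open>cmod (z - x)\<close> and
  \<open>cmod (y - x)\<close>. With \<open>u\<close> and \<open>v\<close> the inverses of these
  roots, the mixed terms \<open>u * v * v + u * u * v\<close> are separated into
  \<open>u ^ 3 + v ^ 3\<close>, so that each singularity stands alone and has order 3/2, still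
  integrable in the plane.\<close>

lemma kernel_difference:
  "cmod (1 / (z - x) - 1 / (y - x)) \<le>
    sqrt (cmod (z - y)) * (2 * (cmod (z - x) powr (-3/2) + cmod (y - x) powr (-3/2)))"
  if "x \<noteq> z" "x \<noteq> y"
proof -
  define c d where "c = sqrt (cmod (z - x))" and "d = sqrt (cmod (y - x))"
  have cd: "c > 0" "d > 0" using that by (auto simp: c_def d_def)
  have cc: "cmod (z - x) = c\<^sup>2" "cmod (y - x) = d\<^sup>2" by (auto simp: c_def d_def)
  have "1 / (z - x) - 1 / (y - x) = (y - z) / ((z - x) * (y - x))"
    using that by (simp add: field_simps)
  then have "cmod (1 / (z - x) - 1 / (y - x)) = sqrt (cmod (z - y)) * sqrt (cmod (z - y)) / (c\<^sup>2 * d\<^sup>2)"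
    by (simp add: norm_mult norm_divide cc norm_minus_commute[of y z])
  also have "\<dots> \<le> sqrt (cmod (z - y)) * (c + d) / (c\<^sup>2 * d\<^sup>2)"
  proof (intro divide_right_mono mult_left_mono)
    have "cmod (z - y) \<le> c\<^sup>2 + d\<^sup>2"
      using norm_triangle_ineq4[of "z - x" "y - x"] by (simp add: cc)
    also have "\<dots> \<le> (c + d)\<^sup>2" using cd by (simp add: power2_sum)
    finally show "sqrt (cmod (z - y)) \<le> c + d" using cd by (intro real_le_lsqrt) auto
  qed auto
  also have "\<dots> \<le> sqrt (cmod (z - y)) * (2 * (1 / c ^ 3 + 1 / d ^ 3))"
  proof -
    define u v where "u = 1 / c" and "v = 1 / d"
    have uv: "u > 0" "v > 0" using cd by (auto simp: u_def v_def)
    have e: "(c + d) / (c\<^sup>2 * d\<^sup>2) = u * v * v + u * u * v"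
      using cd by (simp add: u_def v_def field_simps power2_eq_square)
    have "u * v * v + u * u * v \<le> u ^ 3 + v ^ 3"
    proof -
      have "u ^ 3 + v ^ 3 - (u * v * v + u * u * v) = (u + v) * (u - v)\<^sup>2"
        by (simp add: power2_eq_square power3_eq_cube algebra_simps)
      moreover have "\<dots> \<ge> 0" using uv by simp
      ultimately show ?thesis by linarith
    qed
    also have "\<dots> \<le> 2 * (u ^ 3 + v ^ 3)" using uv by simp
    finally have "(c + d) / (c\<^sup>2 * d\<^sup>2) \<le> 2 * (1 / c ^ 3 + 1 / d ^ 3)"
      unfolding e by (simp add: u_def v_def power_one_over)
    from mult_left_mono[OF this, of "sqrt (cmod (z - y))"] show ?thesis by simp
  qed
  also have "1 / c ^ 3 = cmod (z - x) powr (-3/2)"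
    using cd unfolding cc by (simp only: square_powr_minus)
  also have "1 / d ^ 3 = cmod (y - x) powr (-3/2)"
    using cd unfolding cc by (simp only: square_powr_minus)
  finally show ?thesis .
qed

text \<open>In the constant \<open>4 * K\<close> one factor 2 comes from
  \<open>kernel_difference\<close> and one from its two singularities. Like the decay bound it is
  uniform in \<open>f\<close>, so it yields equicontinuity.\<close>

lemma cauchy_holder:
  obtains K where "K \<ge> 0"
    and "\<And>f M z y. f \<in> borel_measurable borel \<Longrightarrow> (\<And>x. cmod (f x) \<le> M * rho x powr (-2)) \<Longrightarrow>
      cmod (cauchy_transform f z - cauchy_transform f y) \<le> M * K * sqrt (cmod (z - y))"
proof -
  obtain K where K: "K \<ge> 0"
    "\<And>z. integrable lborel (\<lambda>x. rho x powr (-2) * cmod (z - x) powr (-(3/2)))"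
    "\<And>z. (\<integral>x. rho x powr (-2) * cmod (z - x) powr (-(3/2)) \<partial>lborel) \<le> K"
    by (rule kernel_bound[of "3/2" 2]) auto
  show thesis
  proof (rule that[of "4 * K"])
    fix f :: "complex \<Rightarrow> complex" and M z y
    assume [measurable]: "f \<in> borel_measurable borel" and le: "\<And>x. cmod (f x) \<le> M * rho x powr (-2)"
    have M: "M \<ge> 0" using le[of 0] by (simp add: rho_def) (meson norm_ge_zero order_trans)
    let ?s = "sqrt (cmod (z - y))"
    let ?G = "\<lambda>x. (2 * M * ?s) * (rho x powr (-2) * cmod (z - x) powr (-(3/2)) + rho x powr (-2) * cmod (y - x) powr (-(3/2)))"
    have i: "integrable lborel (\<lambda>x. f x / (w - x))" for w by (rule cauchy_integrable[OF _ le]) simp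
    have "cauchy_transform f z - cauchy_transform f y
      = of_real (1 / pi) * ((\<integral>x. f x / (z - x) \<partial>lborel) - (\<integral>x. f x / (y - x) \<partial>lborel))"
      by (simp add: cauchy_transform_def right_diff_distrib)
    also have "(\<integral>x. f x / (z - x) \<partial>lborel) - (\<integral>x. f x / (y - x) \<partial>lborel)
      = (\<integral>x. f x / (z - x) - f x / (y - x) \<partial>lborel)"
      using i by (simp add: Bochner_Integration.integral_diff)
    finally have "cmod (cauchy_transform f z - cauchy_transform f y)
      = 1 / pi * cmod (\<integral>x. f x / (z - x) - f x / (y - x) \<partial>lborel)"
      by (simp add: norm_mult norm_divide)
    also have "\<dots> \<le> cmod (\<integral>x. f x / (z - x) - f x / (y - x) \<partial>lborel)" by (rule one_div_pi_le) simp
    also have "\<dots> \<le> (\<integral>x. cmod (f x / (z - x) - f x / (y - x)) \<partial>lborel)" by simp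
    also have "\<dots> \<le> (\<integral>x. ?G x \<partial>lborel)"
    proof (rule integral_mono_AE)
      have "AE x in lborel. x \<noteq> z" "AE x in lborel. x \<noteq> y" by (rule AE_lborel_singleton)+
      then show "AE x in lborel. cmod (f x / (z - x) - f x / (y - x)) \<le> ?G x"
      proof eventually_elim
        case (elim x)
        have "f x / (z - x) - f x / (y - x) = f x * (1 / (z - x) - 1 / (y - x))"
          by (simp add: right_diff_distrib)
        then have "cmod (f x / (z - x) - f x / (y - x)) = cmod (f x) * cmod (1 / (z - x) - 1 / (y - x))"
          by (simp add: norm_mult)
        also have "\<dots> \<le> (M * rho x powr (-2)) * (?s * (2 * (cmod (z - x) powr (-3/2) + cmod (y - x) powr (-3/2))))"
          using elim M by (intro mult_mono le kernel_difference) auto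
        also have "\<dots> = ?G x" by (simp add: algebra_simps)
        finally show ?case .
      qed
    qed (use i K in auto)
    also have "\<dots> \<le> (2 * M * ?s) * (K + K)"
    proof -
      have "(\<integral>x. ?G x \<partial>lborel) = (2 * M * ?s) * ((\<integral>x. rho x powr (-2) * cmod (z - x) powr (-(3/2)) \<partial>lborel)
          + (\<integral>x. rho x powr (-2) * cmod (y - x) powr (-(3/2)) \<partial>lborel))"
        using K(2) by (subst Bochner_Integration.integral_mult_right_zero, subst Bochner_Integration.integral_add) auto
      also have "\<dots> \<le> (2 * M * ?s) * (K + K)"
        using K(3) M by (intro mult_left_mono add_mono) auto
      finally show ?thesis .
    qed
    finally show "cmod (cauchy_transform f z - cauchy_transform f y) \<le> M * (4 * K) * ?s"
      by (simp add: algebra_simps)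
  qed (use K in simp)
qed

section \<open>Wirtinger derivatives and Green's theorem\<close>

text \<open>
  The arguments \<open>a\<close> and \<open>b\<close> are the derivatives of \<open>u\<close> with respect to \<open>z\<close> and \<open>cnj z\<close>.
\<close>

definition has_wirtinger :: "(complex \<Rightarrow> complex) \<Rightarrow> complex \<Rightarrow> complex \<Rightarrow> complex \<Rightarrow> bool" where
  "has_wirtinger u a b z \<longleftrightarrow> (u has_derivative (\<lambda>d. a * d + b * cnj d)) (at z)"

lemma has_wirtinger_eq_rhs:
  "has_wirtinger u a b z \<Longrightarrow> a = a' \<Longrightarrow> b = b' \<Longrightarrow> has_wirtinger u a' b' z"
  by simp

lemma has_wirtinger_const: "has_wirtinger (\<lambda>_. c) 0 0 z"
  by (simp add: has_wirtinger_def)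

lemma has_wirtinger_ident: "has_wirtinger (\<lambda>x. x) 1 0 z"
  by (simp add: has_wirtinger_def)

lemma has_wirtinger_cnj_ident: "has_wirtinger cnj 0 1 z"
  by (simp add: has_wirtinger_def bounded_linear_imp_has_derivative[OF bounded_linear_cnj])

lemma has_wirtinger_cnj: "has_wirtinger u a b z \<Longrightarrow> has_wirtinger (\<lambda>x. cnj (u x)) (cnj b) (cnj a) z"
  unfolding has_wirtinger_def by (drule has_derivative_cnj) (simp add: add.commute)

lemma has_wirtinger_add:
  "has_wirtinger u a b z \<Longrightarrow> has_wirtinger v c d z \<Longrightarrow> has_wirtinger (\<lambda>x. u x + v x) (a + c) (b + d) z"
  unfolding has_wirtinger_def by (drule (1) has_derivative_add) (simp add: algebra_simps)

lemma has_wirtinger_diff: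
  "has_wirtinger u a b z \<Longrightarrow> has_wirtinger v c d z \<Longrightarrow> has_wirtinger (\<lambda>x. u x - v x) (a - c) (b - d) z"
  unfolding has_wirtinger_def by (drule (1) has_derivative_diff) (simp add: algebra_simps)

lemma has_wirtinger_mult:
  "has_wirtinger u a b z \<Longrightarrow> has_wirtinger v c d z \<Longrightarrow>
    has_wirtinger (\<lambda>x. u x * v x) (u z * c + a * v z) (u z * d + b * v z) z"
  unfolding has_wirtinger_def by (drule (1) has_derivative_mult) (simp add: algebra_simps)

lemma has_wirtinger_holomorphic:
  assumes "(g has_field_derivative g') (at (u z))" "has_wirtinger u a b z"
  shows "has_wirtinger (\<lambda>x. g (u x)) (g' * a) (g' * b) z"
  using has_derivative_compose[of u "\<lambda>d. a * d + b * cnj d" z UNIV g "(*) g'"] assms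
  unfolding has_wirtinger_def has_field_derivative_def by (simp add: algebra_simps)

lemma has_wirtinger_divide:
  assumes "has_wirtinger u a b z" "has_wirtinger v c d z" "v z \<noteq> 0"
  shows "has_wirtinger (\<lambda>x. u x / v x) ((a * v z - u z * c) / (v z)\<^sup>2) ((b * v z - u z * d) / (v z)\<^sup>2) z"
proof -
  have "has_wirtinger (\<lambda>x. inverse (v x)) (- (inverse (v z) ^ 2) * c) (- (inverse (v z) ^ 2) * d) z"
    using assms(3) by (intro has_wirtinger_holomorphic[OF _ assms(2)])
      (auto intro!: derivative_eq_intros simp: power2_eq_square)
  from has_wirtinger_mult[OF assms(1) this] show ?thesis
    unfolding divide_inverse by (rule has_wirtinger_eq_rhs) (use assms(3) in \<open>auto simp: field_simps power2_eq_square\<close>)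
qed

lemma has_wirtinger_Ln:
  assumes "has_wirtinger u a b z" "u z \<notin> \<real>\<^sub>\<le>\<^sub>0"
  shows "has_wirtinger (\<lambda>x. Ln (u x)) (a / u z) (b / u z) z"
  using has_wirtinger_holomorphic[OF has_field_derivative_Ln[OF assms(2)] assms(1)]
  by (simp add: field_simps)

lemma has_wirtinger_isCont: "has_wirtinger u a b z \<Longrightarrow> isCont u z"
  unfolding has_wirtinger_def by (rule has_derivative_continuous)

lemma norm_integral_interval_le:
  fixes g :: "real \<Rightarrow> complex"
  assumes "continuous_on {-R..R} g" "R \<ge> 0" "\<And>y. y \<in> {-R..R} \<Longrightarrow> norm (g y) \<le> N"
  shows "norm (\<integral>y. indicator {-R..R} y *\<^sub>R g y \<partial>lborel) \<le> 2 * R * N"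
proof -
  have i: "integrable lborel (\<lambda>y. indicator {-R..R} y *\<^sub>R g y)"
    using borel_integrable_atLeastAtMost'[OF assms(1)] by (simp add: set_integrable_def)
  have "norm (\<integral>y. indicator {-R..R} y *\<^sub>R g y \<partial>lborel) \<le> (\<integral>y. norm (indicator {-R..R} y *\<^sub>R g y) \<partial>lborel)"
    by (rule integral_norm_bound)
  also have "\<dots> \<le> (\<integral>y. indicator {-R..R} y *\<^sub>R N \<partial>lborel)"
  proof (rule integral_mono)
    show "integrable lborel (\<lambda>y. indicator {-R..R} y *\<^sub>R N)"
      using assms(2) by (intro integrable_scaleR_left integrable_real_indicator) auto
  qed (use i assms(3) in \<open>auto simp: indicator_def simp del: norm_scaleR\<close>)
  also have "\<dots> = 2 * R * N" using assms(2) by simp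
  finally show ?thesis .
qed

text \<open>Green's theorem on a square, reduced to the estimate that is used. Along the two axes
  \<open>W\<close> has derivatives \<open>A + B\<close> and \<open>\<i> * (A - B)\<close>;
  integrating each first in its own direction leaves boundary values only. Then \<open>B\<close> is
  recovered from \<open>2 * B = (A + B) + \<i> * (\<i> * (A - B))\<close>.\<close>

lemma norm_integral_box_le:
  assumes W: "\<And>z. has_wirtinger W (A z) (B z) z"
    and A: "continuous_on UNIV A" and B: "continuous_on UNIV B"
    and R: "R \<ge> 0"
    and N: "\<And>z. \<bar>Re z\<bar> = R \<or> \<bar>Im z\<bar> = R \<Longrightarrow> cmod (W z) \<le> N"
  shows "norm (\<integral>z. indicator (cbox (Complex (-R) (-R)) (Complex R R)) z *\<^sub>R B z \<partial>lborel) \<le> 4 * R * N"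
proof -
  let ?S = "cbox (Complex (-R) (-R)) (Complex R R)"
  let ?I = "\<lambda>f. (\<integral>z. indicator ?S z *\<^sub>R f z \<partial>lborel) :: complex"
  have ind: "indicator ?S (Complex x y) = (indicator {-R..R} x * indicator {-R..R} y :: real)" for x y
    by (auto simp: in_cbox_complex_iff indicator_def)
  have cW: "continuous_on UNIV W"
    using W by (intro continuous_at_imp_continuous_on ballI has_wirtinger_isCont)
  have int: "integrable lborel (\<lambda>z. indicator ?S z *\<^sub>R f z)" if "continuous_on UNIV f" for f :: "complex \<Rightarrow> complex"
    using borel_integrable_compact[OF compact_cbox continuous_on_subset[OF that]] by (simp add: set_integrable_def)
  have cf: "continuous_on T (\<lambda>x. f (Complex (a x) (b x)))"
    if "continuous_on UNIV f" "continuous_on T a" "continuous_on T b" for f :: "complex \<Rightarrow> complex" and a b :: "real \<Rightarrow> real" and T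
    using that(2,3) by (intro continuous_on_compose2[OF that(1)]) (auto simp: Complex_eq intro!: continuous_intros)
  have dx: "((\<lambda>x. W (Complex x y)) has_vector_derivative (A (Complex x y) + B (Complex x y))) (at x within T)" for x y T
  proof -
    have "((\<lambda>x. Complex x y) has_derivative of_real) (at x within T)"
      unfolding Complex_eq by (auto intro!: derivative_eq_intros)
    from has_derivative_compose[OF this W[unfolded has_wirtinger_def]]
    show ?thesis unfolding has_vector_derivative_def by (simp add: scaleR_conv_of_real algebra_simps)
  qed
  have dy: "((\<lambda>y. W (Complex x y)) has_vector_derivative (\<i> * (A (Complex x y) - B (Complex x y)))) (at y within T)" for x y T
  proof -
    have "((\<lambda>y. Complex x y) has_derivative (\<lambda>d. \<i> * of_real d)) (at y within T)"
      unfolding Complex_eq by (auto intro!: derivative_eq_intros)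
    from has_derivative_compose[OF this W[unfolded has_wirtinger_def]]
    show ?thesis unfolding has_vector_derivative_def by (simp add: scaleR_conv_of_real algebra_simps)
  qed
  have cAB: "continuous_on UNIV (\<lambda>z. A z + B z)" "continuous_on UNIV (\<lambda>z. \<i> * (A z - B z))"
    using A B by (auto intro!: continuous_intros)
  have "?I (\<lambda>z. A z + B z) = (\<integral>y. (\<integral>x. indicator ?S (Complex x y) *\<^sub>R (A (Complex x y) + B (Complex x y)) \<partial>lborel) \<partial>lborel)"
    by (rule integral_complex_swap[OF int]) (rule cAB)
  also have "\<dots> = (\<integral>y. indicator {-R..R} y *\<^sub>R (\<integral>x. indicator {-R..R} x *\<^sub>R (A (Complex x y) + B (Complex x y)) \<partial>lborel) \<partial>lborel)"
  proof (rule Bochner_Integration.integral_cong[OF refl])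
    fix y
    have "(\<lambda>x. indicator ?S (Complex x y) *\<^sub>R (A (Complex x y) + B (Complex x y)))
      = (\<lambda>x. indicator {-R..R} y *\<^sub>R (indicator {-R..R} x *\<^sub>R (A (Complex x y) + B (Complex x y))))"
      by (simp add: ind mult.commute)
    then show "(\<integral>x. indicator ?S (Complex x y) *\<^sub>R (A (Complex x y) + B (Complex x y)) \<partial>lborel)
      = indicator {-R..R} y *\<^sub>R (\<integral>x. indicator {-R..R} x *\<^sub>R (A (Complex x y) + B (Complex x y)) \<partial>lborel)"
      by (simp only: integral_scaleR_right)
  qed
  also have "\<dots> = (\<integral>y. indicator {-R..R} y *\<^sub>R (W (Complex R y) - W (Complex (-R) y)) \<partial>lborel)"
    using R by (subst integral_FTC_atLeastAtMost[OF _ dx]) (auto intro!: cf A B continuous_intros)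
  also have "norm \<dots> \<le> 2 * R * (N + N)"
    using R by (intro norm_integral_interval_le continuous_intros cf cW order_trans[OF norm_triangle_ineq4] add_mono N) auto
  finally have 1: "norm (?I (\<lambda>z. A z + B z)) \<le> 4 * R * N" by simp
  have "?I (\<lambda>z. \<i> * (A z - B z)) = (\<integral>x. (\<integral>y. indicator ?S (Complex x y) *\<^sub>R (\<i> * (A (Complex x y) - B (Complex x y))) \<partial>lborel) \<partial>lborel)"
    by (rule integral_complex[OF int]) (rule cAB)
  also have "\<dots> = (\<integral>x. indicator {-R..R} x *\<^sub>R (\<integral>y. indicator {-R..R} y *\<^sub>R (\<i> * (A (Complex x y) - B (Complex x y))) \<partial>lborel) \<partial>lborel)"
    by (simp only: ind scaleR_scaleR[symmetric] integral_scaleR_right)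
  also have "\<dots> = (\<integral>x. indicator {-R..R} x *\<^sub>R (W (Complex x R) - W (Complex x (-R))) \<partial>lborel)"
    using R by (subst integral_FTC_atLeastAtMost[OF _ dy]) (auto intro!: cf A B continuous_intros)
  also have "norm \<dots> \<le> 2 * R * (N + N)"
    using R by (intro norm_integral_interval_le continuous_intros cf cW order_trans[OF norm_triangle_ineq4] add_mono N) auto
  finally have 2: "norm (?I (\<lambda>z. \<i> * (A z - B z))) \<le> 4 * R * N" by simp
  have "2 * ?I B = (\<integral>z. 2 * (indicator ?S z *\<^sub>R B z) \<partial>lborel)"
    by (rule Bochner_Integration.integral_mult_right_zero[symmetric])
  also have "\<dots> = (\<integral>z. indicator ?S z *\<^sub>R (A z + B z) + \<i> * (indicator ?S z *\<^sub>R (\<i> * (A z - B z))) \<partial>lborel)"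
    by (intro Bochner_Integration.integral_cong) (auto simp: indicator_def algebra_simps)
  also have "\<dots> = ?I (\<lambda>z. A z + B z) + \<i> * ?I (\<lambda>z. \<i> * (A z - B z))"
    using int[OF cAB(1)] int[OF cAB(2)]
    by (simp only: Bochner_Integration.integral_add integrable_mult_right Bochner_Integration.integral_mult_right_zero)
  finally have "norm (2 * ?I B) \<le> norm (?I (\<lambda>z. A z + B z)) + norm (\<i> * ?I (\<lambda>z. \<i> * (A z - B z)))"
    by (simp only: norm_triangle_ineq)
  also have "\<dots> \<le> 4 * R * N + 4 * R * N"
    using 1 2 unfolding norm_mult by (intro add_mono) simp_all
  finally show ?thesis by (simp only: norm_mult) (simp add: mult_ac)
qed

text \<open>On a square of half-side \<open>R\<close> the boundary has length of order
  \<open>R\<close> and \<open>W\<close> is there of order \<open>1 / R\<^sup>2\<close>, so the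
  boundary contribution vanishes as \<open>R\<close> grows.\<close>

lemma integral_dbar_eq_0:
  assumes W: "\<And>z. has_wirtinger W (A z) (B z) z"
    and A: "continuous_on UNIV A" and B: "continuous_on UNIV B"
    and bd: "\<And>z. cmod (W z) \<le> K * rho z powr (-2)"
    and int: "integrable lborel B"
  shows "(\<integral>z. B z \<partial>lborel) = 0"
proof -
  \<comment> \<open>\<open>Suc n\<close> keeps the half-side positive, as the division by it
    requires.\<close>
  let ?S = "\<lambda>n. cbox (Complex (- real (Suc n)) (- real (Suc n))) (Complex (real (Suc n)) (real (Suc n)))"
  have K: "K \<ge> 0" using bd[of 0] by (simp add: rho_def) (meson norm_ge_zero order_trans)
  have lim: "(\<lambda>n. \<integral>z. indicator (?S n) z *\<^sub>R B z \<partial>lborel) \<longlonglongrightarrow> (\<integral>z. B z \<partial>lborel)"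
  proof (rule integral_dominated_convergence[where w = "\<lambda>z. norm (B z)"])
    show "AE z in lborel. (\<lambda>n. indicator (?S n) z *\<^sub>R B z) \<longlonglongrightarrow> B z"
    proof (rule AE_I2)
      fix z
      obtain m :: nat where m: "real m \<ge> cmod z" using real_arch_simple by blast
      have "\<forall>\<^sub>F n in sequentially. indicator (?S n) z *\<^sub>R B z = B z"
      proof (rule eventually_sequentiallyI[of m])
        fix n assume "m \<le> n"
        then have "z \<in> ?S n" using m abs_Re_le_cmod[of z] abs_Im_le_cmod[of z]
          by (auto simp: in_cbox_complex_iff)
        then show "indicator (?S n) z *\<^sub>R B z = B z" by simp
      qed
      then show "(\<lambda>n. indicator (?S n) z *\<^sub>R B z) \<longlonglongrightarrow> B z" by (rule tendsto_eventually)
    qed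
  qed (use int in \<open>auto simp: indicator_def\<close>)
  have "(\<lambda>n. \<integral>z. indicator (?S n) z *\<^sub>R B z \<partial>lborel) \<longlonglongrightarrow> 0"
  proof (rule Lim_null_comparison)
    have "norm (\<integral>z. indicator (?S n) z *\<^sub>R B z \<partial>lborel) \<le> 4 * K * (1 / real (Suc n))" for n
    proof -
      have "norm (\<integral>z. indicator (?S n) z *\<^sub>R B z \<partial>lborel) \<le> 4 * real (Suc n) * (K * (1 / (real (Suc n))\<^sup>2))"
      proof (rule norm_integral_box_le[OF W A B])
        fix z assume z: "\<bar>Re z\<bar> = real (Suc n) \<or> \<bar>Im z\<bar> = real (Suc n)"
        then have "real (Suc n) \<le> cmod z"
          using abs_Re_le_cmod[of z] abs_Im_le_cmod[of z] by linarith
        then have "(real (Suc n))\<^sup>2 \<le> 1 + (cmod z)\<^sup>2" using power_mono[of "real (Suc n)" "cmod z" 2] by linarith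
        moreover have "rho z powr (-2) = 1 / (1 + (cmod z)\<^sup>2)" by (simp add: rho_powr powr_minus_divide add_pos_nonneg)
        ultimately have "rho z powr (-2) \<le> 1 / (real (Suc n))\<^sup>2"
          by (simp only:) (intro divide_left_mono mult_pos_pos; simp add: add_pos_nonneg)
        then show "cmod (W z) \<le> K * (1 / (real (Suc n))\<^sup>2)"
          using bd[of z] K by (meson mult_left_mono order_trans)
      qed simp
      also have "\<dots> = 4 * K * (1 / real (Suc n))" by (simp add: power2_eq_square del: of_nat_Suc)
      finally show ?thesis .
    qed
    then show "\<forall>\<^sub>F n in sequentially. norm (\<integral>z. indicator (?S n) z *\<^sub>R B z \<partial>lborel) \<le> 4 * K * (1 / real (Suc n))"
      by simp
    show "(\<lambda>n. 4 * K * (1 / real (Suc n))) \<longlonglongrightarrow> 0"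
      by (intro tendsto_mult_right_zero lim_inverse_n'[THEN LIMSEQ_Suc])
  qed
  with lim show ?thesis using LIMSEQ_unique by blast
qed

section \<open>The total mass of the spherical density\<close>

lemma nn_integral_FTC_UNIV:
  fixes f F :: "real \<Rightarrow> real"
  assumes F: "\<And>x. (F has_real_derivative f x) (at x)" and f: "\<And>x. isCont f x" and pos: "\<And>x. f x \<ge> 0"
    and A: "(F \<longlongrightarrow> A) at_bot" and B: "(F \<longlongrightarrow> B) at_top"
  shows "(\<integral>\<^sup>+x. ennreal (f x) \<partial>lborel) = ennreal (B - A)"
proof -
  have *: "set_integrable lborel (einterval (-\<infinity>) \<infinity>) f" "(LBINT x=-\<infinity>..\<infinity>. f x) = B - A"
    by (rule interval_integral_FTC_nonneg[where F = F];
        use assms in \<open>simp add: ereal_tendsto_simps\<close>)+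
  then have "integrable lborel f" "(\<integral>x. f x \<partial>lborel) = B - A"
    by (simp_all add: set_integrable_def interval_lebesgue_integral_def set_lebesgue_integral_def)
  then show ?thesis using pos by (simp add: nn_integral_eq_integral)
qed

lemma nn_integral_one_plus_squares:
  assumes "A > 0"
  shows "(\<integral>\<^sup>+y. ennreal (1 / (A + y\<^sup>2)\<^sup>2) \<partial>lborel) = ennreal (pi / (2 * A * sqrt A))"
proof -
  \<comment> \<open>The antiderivative given by the reduction formula for powers of
    \<open>A + y\<^sup>2\<close>; only its arctangent part contributes at infinity.\<close>
  let ?F = "\<lambda>y. y / (2 * A * (A + y\<^sup>2)) + arctan (y / sqrt A) / (2 * A * sqrt A)"
  have p: "A + y\<^sup>2 > 0" for y using assms by (simp add: add_pos_nonneg)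
  have "(\<integral>\<^sup>+y. ennreal (1 / (A + y\<^sup>2)\<^sup>2) \<partial>lborel)
    = ennreal ((pi/2) / (2 * A * sqrt A) - (- (pi/2)) / (2 * A * sqrt A))"
  proof (rule nn_integral_FTC_UNIV[where F = ?F])
    show "(?F has_real_derivative 1 / (A + y\<^sup>2)\<^sup>2) (at y)" for y
    proof -
      have n: "A + y\<^sup>2 \<noteq> 0" "A \<noteq> 0" "sqrt A \<noteq> 0" using p[of y] assms by auto
      have d1: "((\<lambda>y. y / (2 * A * (A + y\<^sup>2))) has_real_derivative ((A - y\<^sup>2) / (2 * A * (A + y\<^sup>2)\<^sup>2))) (at y)"
        using n by (auto intro!: derivative_eq_intros simp: divide_simps) (simp add: algebra_simps power2_eq_square)?
      have d2: "((\<lambda>y. arctan (y / sqrt A) / (2 * A * sqrt A)) has_real_derivative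
         (inverse (1 + (y / sqrt A)\<^sup>2) * (1 / sqrt A) / (2 * A * sqrt A))) (at y)"
        using n by (auto intro!: derivative_eq_intros)
      have e: "inverse (1 + (y / sqrt A)\<^sup>2) = A / (A + y\<^sup>2)"
        using n assms by (simp add: power_divide divide_simps)
      have "inverse (1 + (y / sqrt A)\<^sup>2) * (1 / sqrt A) / (2 * A * sqrt A) = 1 / (2 * A * (A + y\<^sup>2))"
        unfolding e using n assms by (simp add: divide_simps)
      then have "(A - y\<^sup>2) / (2 * A * (A + y\<^sup>2)\<^sup>2) + inverse (1 + (y / sqrt A)\<^sup>2) * (1 / sqrt A) / (2 * A * sqrt A)
        = (A - y\<^sup>2) / (2 * A * (A + y\<^sup>2)\<^sup>2) + (A + y\<^sup>2) / (2 * A * (A + y\<^sup>2)\<^sup>2)"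
        using n by (simp add: power2_eq_square)
      also have "\<dots> = 1 / (A + y\<^sup>2)\<^sup>2"
        using n by (simp add: add_divide_distrib[symmetric])
      finally show ?thesis using DERIV_add[OF d1 d2] by simp
    qed
    show "isCont (\<lambda>y. 1 / (A + y\<^sup>2)\<^sup>2) y" for y using p[of y] by (intro continuous_intros) auto
    have 1: "((\<lambda>y. y / (2 * A * (A + y\<^sup>2))) \<longlongrightarrow> 0) at_top" "((\<lambda>y. y / (2 * A * (A + y\<^sup>2))) \<longlongrightarrow> 0) at_bot"
      using assms by real_asymp+
    have "filterlim (\<lambda>y. y / sqrt A) at_top at_top" "filterlim (\<lambda>y. y / sqrt A) at_bot at_bot"
      using assms by real_asymp+
    then have 2: "((\<lambda>y. arctan (y / sqrt A)) \<longlongrightarrow> pi / 2) at_top" "((\<lambda>y. arctan (y / sqrt A)) \<longlongrightarrow> - (pi / 2)) at_bot"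
      using filterlim_compose tendsto_arctan_at_top tendsto_arctan_at_bot by blast+
    have n: "2 * A * sqrt A \<noteq> 0" using assms by simp
    show "(?F \<longlongrightarrow> pi / 2 / (2 * A * sqrt A)) at_top"
      using tendsto_add[OF 1(1) tendsto_divide[OF 2(1) tendsto_const n]] by simp
    show "(?F \<longlongrightarrow> - (pi / 2) / (2 * A * sqrt A)) at_bot"
      using tendsto_add[OF 1(2) tendsto_divide[OF 2(2) tendsto_const n]] by simp
  qed simp
  then show ?thesis by (simp add: field_simps)
qed

text \<open>This \<open>pi\<close> is the mass of the approximate identity below and cancels the
  factor \<open>1 / pi\<close> of the Cauchy transforms. Integrating first in \<open>y\<close>
  leaves a multiple of \<open>(1 + x\<^sup>2) powr (-3/2)\<close>, whose antiderivative is
  algebraic.\<close>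

lemma integral_rho_minus4: "(\<integral>z. rho z powr (-4) \<partial>lborel) = pi"
proof -
  have "(\<integral>\<^sup>+z. ennreal (rho z powr (-4)) \<partial>lborel)
     = (\<integral>\<^sup>+x. (\<integral>\<^sup>+y. ennreal (rho (Complex x y) powr (-4)) \<partial>lborel) \<partial>lborel)"
    by (rule nn_integral_complex) simp
  also have "\<dots> = (\<integral>\<^sup>+x. (\<integral>\<^sup>+y. ennreal (1 / ((1 + x\<^sup>2) + y\<^sup>2)\<^sup>2) \<partial>lborel) \<partial>lborel)"
  proof (intro nn_integral_cong)
    fix x y :: real
    have "rho (Complex x y) powr (-4) = 1 / ((1 + x\<^sup>2) + y\<^sup>2)\<^sup>2"
      by (simp add: rho_powr powr_minus_divide cmod_power2 add_pos_nonneg add.assoc)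
    then show "ennreal (rho (Complex x y) powr (-4)) = ennreal (1 / ((1 + x\<^sup>2) + y\<^sup>2)\<^sup>2)" by simp
  qed
  also have "\<dots> = (\<integral>\<^sup>+x. ennreal (pi / 2) * ennreal (1 / ((1 + x\<^sup>2) * sqrt (1 + x\<^sup>2))) \<partial>lborel)"
    by (subst nn_integral_one_plus_squares)
       (auto simp: add_pos_nonneg ennreal_mult[symmetric] intro!: nn_integral_cong arg_cong[where f = ennreal])
  also have "\<dots> = ennreal (pi / 2) * (\<integral>\<^sup>+x. ennreal (1 / ((1 + x\<^sup>2) * sqrt (1 + x\<^sup>2))) \<partial>lborel)"
    by (rule nn_integral_cmult) simp
  also have "(\<integral>\<^sup>+x. ennreal (1 / ((1 + x\<^sup>2) * sqrt (1 + x\<^sup>2))) \<partial>lborel) = ennreal (1 - (-1))"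
  proof (rule nn_integral_FTC_UNIV[where F = "\<lambda>x. x / sqrt (1 + x\<^sup>2)"])
    fix x :: real
    have p: "1 + x\<^sup>2 > 0" by (simp add: add_pos_nonneg)
    show "((\<lambda>x. x / sqrt (1 + x\<^sup>2)) has_real_derivative 1 / ((1 + x\<^sup>2) * sqrt (1 + x\<^sup>2))) (at x)"
      using p by (auto intro!: derivative_eq_intros simp: divide_simps) (simp add: algebra_simps power2_eq_square)?
    show "isCont (\<lambda>x. 1 / ((1 + x\<^sup>2) * sqrt (1 + x\<^sup>2))) x"
      using p by (intro continuous_intros) auto
    show "0 \<le> 1 / ((1 + x\<^sup>2) * sqrt (1 + x\<^sup>2))" using p by simp
  next
    show "((\<lambda>x::real. x / sqrt (1 + x\<^sup>2)) \<longlongrightarrow> 1) at_top" by real_asymp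
    show "((\<lambda>x::real. x / sqrt (1 + x\<^sup>2)) \<longlongrightarrow> -1) at_bot" by real_asymp
  qed
  also have "ennreal (pi / 2) * ennreal (1 - (-1)) = ennreal pi"
    by (subst ennreal_mult[symmetric]) auto
  finally show ?thesis by (simp add: integral_eq_nn_integral)
qed

section \<open>The Cauchy-Pompeiu formula\<close>

lemma rho_powr_neg_eq: "rho z powr (-2) = 1 / (1 + (cmod z)\<^sup>2)" "rho z powr (-4) = 1 / (1 + (cmod z)\<^sup>2)\<^sup>2"
  by (simp_all add: rho_powr powr_minus_divide add_pos_nonneg)

lemma one_plus_cmod_le_rho: "1 + cmod z \<le> 2 * rho z"
  using rho_ge_1[of z] rho_ge_cmod[of z] by simp

text \<open>The kernel is the density \<open>rho powr (-4)\<close> of mass \<open>pi\<close>,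
  rescaled by \<open>t\<close> around \<open>a\<close>. Linear growth of \<open>f\<close> is
  admissible because it lowers the decay only to \<open>rho powr (-3)\<close>, which is still
  integrable in the plane.\<close>

lemma
  fixes f :: "complex \<Rightarrow> complex"
  assumes [measurable]: "f \<in> borel_measurable borel" and f: "isCont f a"
    and le: "\<And>z. cmod (f z) \<le> K * (1 + cmod (z - a))"
  shows approximate_identity_integrable:
      "\<And>t. t > 0 \<Longrightarrow> integrable lborel (\<lambda>z. f z * of_real (t\<^sup>2 / ((cmod (z - a))\<^sup>2 + t\<^sup>2)\<^sup>2))" (is "\<And>t. _ \<Longrightarrow> ?int t")
    and approximate_identity:
      "(\<lambda>n. \<integral>z. f z * of_real ((1 / real (Suc n))\<^sup>2 / ((cmod (z - a))\<^sup>2 + (1 / real (Suc n))\<^sup>2)\<^sup>2) \<partial>lborel)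
        \<longlonglongrightarrow> of_real pi * f a" (is ?lim)
proof -
  define G where "G t x = f (a + of_real t * x) * of_real (rho x powr (-4))" for t :: real and x
  have [measurable]: "G t \<in> borel_measurable borel" for t unfolding G_def by measurable
  have K: "K \<ge> 0" using le[of a] by simp (meson norm_ge_zero order_trans)
  have r3: "integrable lborel (\<lambda>x. 2 * K * rho x powr (-3))"
    using integrable_rho_powr[of 3] by (intro integrable_mult_right) auto
  have Gle': "norm (G t x) \<le> (max t 1 * (2 * K)) * rho x powr (-3)" if "0 \<le> t" for t x
  proof -
    have "t * cmod x \<le> max t 1 * cmod x" by (intro mult_right_mono) auto
    then have "1 + t * cmod x \<le> max t 1 * (1 + cmod x)" by (simp add: distrib_left)
    then have "cmod (f (a + of_real t * x)) \<le> K * (max t 1 * (1 + cmod x))"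
      using le[of "a + of_real t * x"] that K by (auto simp: norm_mult intro: order_trans mult_left_mono)
    also have "\<dots> \<le> K * (max t 1 * (2 * rho x powr 1))"
      using K one_plus_cmod_le_rho[of x] rho_pos[of x] by (intro mult_left_mono) auto
    finally have "norm (G t x) \<le> K * (max t 1 * (2 * rho x powr 1)) * rho x powr (-4)"
      unfolding G_def by (simp add: norm_mult mult_right_mono)
    also have "\<dots> = (max t 1 * (2 * K)) * (rho x powr 1 * rho x powr (-4))" by (simp only: mult_ac)
    also have "rho x powr 1 * rho x powr (-4) = rho x powr (-3)" by (simp only: powr_add[symmetric]) simp
    finally show ?thesis .
  qed
  \<comment> \<open>For \<open>t \<le> 1\<close> the bound is free of \<open>t\<close> and can serve
    in dominated convergence; the general version only gives integrability.\<close>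
  have Gle: "norm (G t x) \<le> 2 * K * rho x powr (-3)" if "0 \<le> t" "t \<le> 1" for t x
    using Gle'[of t x] that by (simp add: max_def)
  have Gint: "integrable lborel (G t)" if "0 \<le> t" for t
  proof (rule Bochner_Integration.integrable_bound)
    show "integrable lborel (\<lambda>x. (max t 1 * (2 * K)) * rho x powr (-3))"
      using integrable_rho_powr[of 3] by (intro integrable_mult_right) auto
    show "AE x in lborel. norm (G t x) \<le> norm ((max t 1 * (2 * K)) * rho x powr (-3))"
      using order_trans[OF Gle'[OF that] abs_ge_self] by (intro AE_I2) (simp only: real_norm_def)
  qed simp
  \<comment> \<open>The argument is \<open>(z - a) / t\<close>, written in the affine form of the
    substitution lemma.\<close>
  have scale: "G t (- a / of_real t + of_real (1 / t) * z)
      = of_real (t\<^sup>2) * (f z * of_real (t\<^sup>2 / ((cmod (z - a))\<^sup>2 + t\<^sup>2)\<^sup>2))" if t: "t > 0" for t z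
  proof -
    let ?x = "- a / of_real t + of_real (1 / t) * z"
    have x: "?x = (z - a) / of_real t" by (simp add: diff_divide_distrib)
    have "a + of_real t * ?x = z" unfolding x using t by simp
    moreover have "rho ?x powr (-4) = 1 / (1 + (cmod (z - a) / t)\<^sup>2)\<^sup>2"
      using t unfolding x rho_powr_neg_eq by (simp add: norm_divide)
    moreover have "1 / (1 + (cmod (z - a) / t)\<^sup>2)\<^sup>2 = t\<^sup>2 * (t\<^sup>2 / ((cmod (z - a))\<^sup>2 + t\<^sup>2)\<^sup>2)"
    proof -
      have "1 + (cmod (z - a) / t)\<^sup>2 = ((cmod (z - a))\<^sup>2 + t\<^sup>2) / t\<^sup>2"
        using t by (simp add: power_divide field_simps)
      then show ?thesis by (simp add: power_divide power2_eq_square)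
    qed
    ultimately show ?thesis unfolding G_def by (simp only: of_real_mult mult_ac)
  qed
  have i: "?int t" if t: "t > 0" for t
  proof -
    have "integrable lborel (\<lambda>z. of_real (t\<^sup>2) * (f z * of_real (t\<^sup>2 / ((cmod (z - a))\<^sup>2 + t\<^sup>2)\<^sup>2)))"
      using integrable_complex_affine[OF Gint[of t], of "1 / t" "- a / of_real t"] t
      by (simp only: scale[OF t]) simp
    from integrable_mult_right[OF this, of "inverse (of_real (t\<^sup>2))"] t
    show ?thesis by (simp add: mult.assoc[symmetric])
  qed
  then show "\<And>t. t > 0 \<Longrightarrow> ?int t" .
  have eq: "(\<integral>z. f z * of_real (t\<^sup>2 / ((cmod (z - a))\<^sup>2 + t\<^sup>2)\<^sup>2) \<partial>lborel) = (\<integral>x. G t x \<partial>lborel)"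
    (is "(\<integral>z. ?h t z \<partial>lborel) = _") if t: "t > 0" for t
  proof -
    have "(\<integral>x. G t x \<partial>lborel) = (1 / t)\<^sup>2 *\<^sub>R (\<integral>z. of_real (t\<^sup>2) * ?h t z \<partial>lborel)"
      using integral_complex_affine[OF Gint[of t], of "1 / t" "- a / of_real t"] t
      by (simp only: scale[OF t]) simp
    also have "\<dots> = (1 / t)\<^sup>2 *\<^sub>R (of_real (t\<^sup>2) * (\<integral>z. ?h t z \<partial>lborel))"
      by (simp only: Bochner_Integration.integral_mult_right_zero)
    also have "\<dots> = (\<integral>z. ?h t z \<partial>lborel)"
      using t by (simp add: scaleR_conv_of_real power_divide mult.assoc[symmetric])
    finally show ?thesis by simp
  qed
  have "(\<lambda>n. \<integral>x. G (1 / real (Suc n)) x \<partial>lborel) \<longlonglongrightarrow> (\<integral>x. f a * of_real (rho x powr (-4)) \<partial>lborel)"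
  proof (rule integral_dominated_convergence[OF _ _ r3])
    show "AE x in lborel. (\<lambda>n. G (1 / real (Suc n)) x) \<longlonglongrightarrow> f a * of_real (rho x powr (-4))"
    proof (rule AE_I2)
      fix x
      have "(\<lambda>n. a + of_real (1 / real (Suc n)) * x) \<longlonglongrightarrow> a + of_real 0 * x"
        by (intro tendsto_intros lim_inverse_n'[THEN LIMSEQ_Suc])
      then have "(\<lambda>n. f (a + of_real (1 / real (Suc n)) * x)) \<longlonglongrightarrow> f a"
        using isCont_tendsto_compose[OF f] by simp
      then show "(\<lambda>n. G (1 / real (Suc n)) x) \<longlonglongrightarrow> f a * of_real (rho x powr (-4))"
        unfolding G_def by (intro tendsto_intros)
    qed
    show "AE x in lborel. norm (G (1 / real (Suc n)) x) \<le> 2 * K * rho x powr (-3)" for n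
      by (intro AE_I2 Gle) auto
  qed simp_all
  also have "(\<integral>x. f a * of_real (rho x powr (-4)) \<partial>lborel) = f a * of_real (\<integral>x. rho x powr (-4) \<partial>lborel)"
    by (simp only: Bochner_Integration.integral_mult_right_zero integral_complex_of_real)
  finally have "(\<lambda>n. \<integral>x. G (1 / real (Suc n)) x \<partial>lborel) \<longlonglongrightarrow> of_real pi * f a"
    by (simp only: integral_rho_minus4 mult.commute)
  then show ?lim by (simp only: eq of_nat_0_less_iff zero_less_Suc zero_less_divide_1_iff)
qed

text \<open>
  The kernel \<open>1 / (z - x)\<close> is replaced by \<open>cnj (z - x) / (\<bar>z - x\<bar>\<^sup>2 + t\<^sup>2)\<close>, so that Green's theorem applies
  on the whole plane and no disc has to be removed; then \<open>t\<close> tends to \<open>0\<close>.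
\<close>

lemma cauchy_transform_dbar:
  assumes u: "\<And>z. has_wirtinger u (A z) (B z) z"
    and A: "continuous_on UNIV A" and B: "continuous_on UNIV B"
    and ule: "\<And>z. cmod (u z) \<le> K * rho z powr (-1)"
    and Ble: "\<And>z. cmod (B z) \<le> L * rho z powr (-2)"
  shows "cauchy_transform B z = u z"
proof -
  have K: "K \<ge> 0" using ule[of 0] by (simp add: rho_def) (meson norm_ge_zero order_trans)
  have cu: "continuous_on UNIV u"
    using u by (intro continuous_at_imp_continuous_on ballI has_wirtinger_isCont)
  have [measurable]: "u \<in> borel_measurable borel" "B \<in> borel_measurable borel"
    using cu B by (auto intro: borel_measurable_continuous_onI)
  define q where "q t x = (z - x) * cnj (z - x) + of_real (t\<^sup>2)" for t :: real and x
  define k where "k t x = cnj (z - x) / q t x" for t :: real and x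
  have q: "q t x = of_real ((cmod (x - z))\<^sup>2 + t\<^sup>2)" for t x
    unfolding q_def complex_norm_square[symmetric] by (simp add: norm_minus_commute)
  have q0: "q t x \<noteq> 0" if "t > 0" for t x
    using that by (simp only: q of_real_eq_0_iff) (simp add: add_nonneg_pos less_imp_neq[symmetric])
  \<comment> \<open>The second derivative is minus the approximate identity at \<open>z\<close>, so
    the product rule for \<open>u * k t\<close> pairs \<open>B\<close> with the kernel and
    \<open>u\<close> with the approximate identity.\<close>
  have k: "has_wirtinger (k t) ((cnj (z - x))\<^sup>2 / (q t x)\<^sup>2) (- of_real (t\<^sup>2) / (q t x)\<^sup>2) x" if t: "t > 0" for t x
  proof -
    have "has_wirtinger (\<lambda>x. cnj (z - x)) 0 (-1) x"
      using has_wirtinger_cnj[OF has_wirtinger_diff[OF has_wirtinger_const has_wirtinger_ident]] by simp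
    moreover have "has_wirtinger (q t) (- cnj (z - x)) (- (z - x)) x"
      unfolding q_def
      using has_wirtinger_add[OF has_wirtinger_mult[OF
          has_wirtinger_diff[OF has_wirtinger_const has_wirtinger_ident]
          has_wirtinger_cnj[OF has_wirtinger_diff[OF has_wirtinger_const has_wirtinger_ident]]] has_wirtinger_const]
      by simp
    ultimately have "has_wirtinger (\<lambda>x. cnj (z - x) / q t x)
        ((0 * q t x - cnj (z - x) * (- cnj (z - x))) / (q t x)\<^sup>2)
        (((-1) * q t x - cnj (z - x) * (- (z - x))) / (q t x)\<^sup>2) x"
      using q0[OF t] by (rule has_wirtinger_divide)
    then show ?thesis unfolding k_def
      by (rule has_wirtinger_eq_rhs) (simp_all add: q_def power2_eq_square algebra_simps)
  qed
  have cq: "continuous_on UNIV (q t)" for t unfolding q_def by (intro continuous_intros)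
  have ck: "continuous_on UNIV (k t)" if "t > 0" for t
    unfolding k_def using q0[OF that] by (intro continuous_intros cq) auto
  have nk: "cmod (k t x) = cmod (z - x) / ((cmod (z - x))\<^sup>2 + t\<^sup>2)" for t x
    unfolding k_def q norm_divide norm_of_real complex_mod_cnj by (simp add: norm_minus_commute)
  \<comment> \<open>The regularised kernel never exceeds the Cauchy kernel, which provides the
    domination for the limit in \<open>t\<close>.\<close>
  have kle: "cmod (k t x) \<le> cmod (z - x) powr (-1)" if t: "t > 0" for t x
  proof (cases "x = z")
    case False
    then have "cmod (z - x) / ((cmod (z - x))\<^sup>2 + t\<^sup>2) \<le> cmod (z - x) / (cmod (z - x))\<^sup>2"
      by (intro divide_left_mono mult_pos_pos add_pos_nonneg) auto
    then show ?thesis using False unfolding nk by (simp add: powr_minus_divide power2_eq_square)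
  qed (simp add: nk)
  \<comment> \<open>\<open>u\<close> alone decays only like \<open>rho powr (-1)\<close>; the second
    factor needed for Green's theorem has to come from the kernel. The dependence on
    \<open>t\<close> is harmless, as \<open>t\<close> is fixed there.\<close>
  have klow: "cmod (k t x) \<le> (rho z / t + 1) * rho x powr (-1)" if t: "t > 0" for t x
  proof -
    define d where "d = cmod (z - x)"
    have d: "d \<ge> 0" by (simp add: d_def)
    have p: "d\<^sup>2 + t\<^sup>2 > 0" using t by (simp add: add_nonneg_pos)
    have "d * rho x \<le> d * (rho z + d)"
      using rho_le_add[of x z] d by (intro mult_left_mono) (auto simp: d_def norm_minus_commute)
    also have "d * (rho z + d) \<le> (rho z / t + 1) * (d\<^sup>2 + t\<^sup>2)"
    proof -
      have "d * t \<le> d\<^sup>2 + t\<^sup>2" using sum_squares_bound[of d t] mult_nonneg_nonneg[OF d less_imp_le[OF t]] by linarith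
      then have "d \<le> (d\<^sup>2 + t\<^sup>2) / t" using t by (simp add: pos_le_divide_eq)
      from mult_left_mono[OF this, of "rho z"] have "rho z * d \<le> rho z / t * (d\<^sup>2 + t\<^sup>2)"
        using rho_pos[of z] by simp
      then show ?thesis by (simp add: algebra_simps power2_eq_square add_increasing)
    qed
    finally show ?thesis using p rho_pos[of x]
      by (simp add: nk d_def[symmetric] powr_minus_divide divide_simps mult_ac)
  qed
  have main: "(\<integral>x. B x * k t x \<partial>lborel) = (\<integral>x. u x * of_real (t\<^sup>2 / ((cmod (x - z))\<^sup>2 + t\<^sup>2)\<^sup>2) \<partial>lborel)"
    and intk: "integrable lborel (\<lambda>x. B x * k t x)" if t: "t > 0" for t
  proof -
    have mk: "k t \<in> borel_measurable borel" using ck[OF t] by (rule borel_measurable_continuous_onI)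
    have "isCont u z" using u by (rule has_wirtinger_isCont)
    then have iu: "integrable lborel (\<lambda>x. u x * of_real (t\<^sup>2 / ((cmod (x - z))\<^sup>2 + t\<^sup>2)\<^sup>2))"
    proof (rule approximate_identity_integrable[rotated])
      show "cmod (u x) \<le> K * (1 + cmod (x - z))" for x
        using ule[of x] rho_powr_le_1[of 1 x] K
        by (smt (verit) mult_left_mono norm_ge_zero)
    qed (use t in simp_all)
    show ik: "integrable lborel (\<lambda>x. B x * k t x)"
    proof (rule Bochner_Integration.integrable_bound[OF cauchy_integrable[OF _ Ble, of z]])
      show "AE x in lborel. norm (B x * k t x) \<le> norm (B x / (z - x))"
        unfolding norm_cauchy_kernel norm_mult by (intro AE_I2 mult_left_mono kle t) simp
    qed (use mk in simp_all)
    have s: "B x * k t x - u x * of_real (t\<^sup>2 / ((cmod (x - z))\<^sup>2 + t\<^sup>2)\<^sup>2)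
       = u x * (- of_real (t\<^sup>2) / (q t x)\<^sup>2) + B x * k t x" for x
      by (simp add: q)
    have "(\<integral>x. u x * (- of_real (t\<^sup>2) / (q t x)\<^sup>2) + B x * k t x \<partial>lborel) = 0"
    proof (rule integral_dbar_eq_0)
      show "has_wirtinger (\<lambda>x. u x * k t x) (u x * ((cnj (z - x))\<^sup>2 / (q t x)\<^sup>2) + A x * k t x)
         (u x * (- of_real (t\<^sup>2) / (q t x)\<^sup>2) + B x * k t x) x" for x
        by (rule has_wirtinger_mult[OF u k[OF t]])
      show "continuous_on UNIV (\<lambda>x. u x * ((cnj (z - x))\<^sup>2 / (q t x)\<^sup>2) + A x * k t x)"
        "continuous_on UNIV (\<lambda>x. u x * (- of_real (t\<^sup>2) / (q t x)\<^sup>2) + B x * k t x)"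
        using q0[OF t] by (auto intro!: continuous_intros cu A B cq ck[OF t])
      show "integrable lborel (\<lambda>x. u x * (- of_real (t\<^sup>2) / (q t x)\<^sup>2) + B x * k t x)"
        unfolding s[symmetric] using ik iu by (rule Bochner_Integration.integrable_diff)
      show "cmod (u x * k t x) \<le> (K * (rho z / t + 1)) * rho x powr (-2)" for x
      proof -
        have "cmod (u x * k t x) \<le> (K * rho x powr (-1)) * ((rho z / t + 1) * rho x powr (-1))"
          unfolding norm_mult using K by (intro mult_mono ule klow t) auto
        also have "\<dots> = (K * (rho z / t + 1)) * (rho x powr (-1) * rho x powr (-1))" by (simp only: mult_ac)
        also have "rho x powr (-1) * rho x powr (-1) = rho x powr (-2)" by (simp only: powr_add[symmetric]) simp
        finally show ?thesis .
      qed
    qed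
    then show "(\<integral>x. B x * k t x \<partial>lborel) = (\<integral>x. u x * of_real (t\<^sup>2 / ((cmod (x - z))\<^sup>2 + t\<^sup>2)\<^sup>2) \<partial>lborel)"
      unfolding s[symmetric] using ik iu by (subst (asm) Bochner_Integration.integral_diff) auto
  qed
  have 1: "(\<lambda>n. \<integral>x. B x * k (1 / real (Suc n)) x \<partial>lborel) \<longlonglongrightarrow> of_real pi * u z"
  proof -
    have "(\<lambda>n. \<integral>x. u x * of_real ((1 / real (Suc n))\<^sup>2 / ((cmod (x - z))\<^sup>2 + (1 / real (Suc n))\<^sup>2)\<^sup>2) \<partial>lborel)
        \<longlonglongrightarrow> of_real pi * u z"
    proof (rule approximate_identity)
      show "isCont u z" using u by (rule has_wirtinger_isCont)
      show "cmod (u x) \<le> K * (1 + cmod (x - z))" for x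
        using ule[of x] rho_powr_le_1[of 1 x] K
        by (smt (verit) mult_left_mono norm_ge_zero)
    qed simp
    then show ?thesis by (simp only: main of_nat_0_less_iff zero_less_Suc zero_less_divide_1_iff)
  qed
  have 2: "(\<lambda>n. \<integral>x. B x * k (1 / real (Suc n)) x \<partial>lborel) \<longlonglongrightarrow> (\<integral>x. B x / (z - x) \<partial>lborel)"
  proof (rule integral_dominated_convergence[where w = "\<lambda>x. norm (B x / (z - x))"])
    show "integrable lborel (\<lambda>x. norm (B x / (z - x)))"
      using cauchy_integrable[OF _ Ble, of z] by simp
    show "AE x in lborel. (\<lambda>n. B x * k (1 / real (Suc n)) x) \<longlonglongrightarrow> B x / (z - x)"
    proof (rule AE_I2)
      fix x
      show "(\<lambda>n. B x * k (1 / real (Suc n)) x) \<longlonglongrightarrow> B x / (z - x)"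
      \<comment> \<open>At \<open>x = z\<close> the regularised kernel vanishes, and so does
        \<open>B x / (z - x)\<close> by the convention for division.\<close>
      proof (cases "x = z")
        case False
        have "(\<lambda>n. B x * (cnj (z - x) / ((z - x) * cnj (z - x) + of_real ((1 / real (Suc n))\<^sup>2))))
          \<longlonglongrightarrow> B x * (cnj (z - x) / ((z - x) * cnj (z - x) + of_real (0\<^sup>2)))"
          using False by (intro tendsto_intros lim_inverse_n'[THEN LIMSEQ_Suc]) auto
        then show ?thesis using False by (simp add: k_def q_def)
      qed (simp add: k_def)
    qed
    show "AE x in lborel. norm (B x * k (1 / real (Suc n)) x) \<le> norm (B x / (z - x))" for n
      unfolding norm_cauchy_kernel norm_mult by (intro AE_I2 mult_left_mono kle) auto
    show "(\<lambda>x. B x * k (1 / real (Suc n)) x) \<in> borel_measurable lborel" for n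
      using intk[of "1 / real (Suc n)"] by auto
  qed simp
  have "(\<integral>x. B x / (z - x) \<partial>lborel) = of_real pi * u z"
    using LIMSEQ_unique[OF 2 1] .
  then show ?thesis by (simp add: cauchy_transform_def)
qed

lemma conj_cauchy_transform_d:
  assumes u: "\<And>z. has_wirtinger u (A z) (B z) z"
    and A: "continuous_on UNIV A" and B: "continuous_on UNIV B"
    and ule: "\<And>z. cmod (u z) \<le> K * rho z powr (-1)"
    and Ale: "\<And>z. cmod (A z) \<le> L * rho z powr (-2)"
  shows "conj_cauchy_transform A z = u z"
proof -
  have "cauchy_transform (\<lambda>x. cnj (A x)) z = cnj (u z)"
    by (rule cauchy_transform_dbar[OF has_wirtinger_cnj[OF u], of K L])
       (use ule Ale in \<open>auto intro!: continuous_intros A B\<close>)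
  then show ?thesis by (simp add: conj_cauchy_transform_cnj)
qed

section \<open>Duality and the eigenfunctions\<close>

lemma rho_square_complex: "1 + z * cnj z = of_real ((rho z)\<^sup>2)"
  unfolding rho_power2 of_real_add complex_norm_square by simp

lemma rho_square_nonzero [simp]: "1 + z * cnj z \<noteq> 0"
  unfolding rho_square_complex using rho_pos[of z] by simp

text \<open>Makes the weight a rational expression in \<open>z\<close> and \<open>cnj z\<close>, on
  which the Wirtinger rules act.\<close>

lemma weight_eq: "complex_of_real (rho z powi (-2)) = 1 / (1 + z * cnj z)"
  unfolding rho_square_complex by (simp add: power_int_def field_simps power2_eq_square)

lemma rho_powr_minus: "rho z powr (-1) = 1 / rho z" "rho z powr (-2) = 1 / (rho z)\<^sup>2"
  using rho_pos[of z] by (simp_all add: powr_minus_divide)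

lemma norm_weight_mult: "cmod (of_real (rho z powi (-2)) * h) = cmod h * rho z powr (-2)"
  unfolding norm_mult norm_of_real rho_powr_minus using rho_pos[of z]
  by (simp add: power_int_def field_simps)

lemma weight_measurable [measurable]: "(\<lambda>z. complex_of_real (rho z powi (-2))) \<in> borel_measurable borel"
  unfolding power_int_def by measurable

lemma weight_measurable' [measurable]: "(\<lambda>z. complex_of_real (rho z) powi (-2)) \<in> borel_measurable borel"
  using weight_measurable by simp

text \<open>Fubini's theorem; the sign is the antisymmetry of \<open>1 / (z - x)\<close>. The work
  lies in the absolute integrability of the double integral, where \<open>kernel_decay\<close>
  handles the inner variable.\<close>

lemma cauchy_duality:
  fixes f k :: "complex \<Rightarrow> complex"
  assumes [measurable]: "f \<in> borel_measurable borel" "k \<in> borel_measurable borel"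
    and f: "\<And>x. cmod (f x) \<le> M * rho x powr (-2)" and k: "\<And>x. cmod (k x) \<le> N * rho x powr (-2)"
  shows "(\<integral>z. k z * cauchy_transform f z \<partial>lborel) = - (\<integral>z. f z * cauchy_transform k z \<partial>lborel)"
proof -
  \<comment> \<open>The weight of \<open>k\<close> alone gives \<open>rho z powr (-2)\<close>, which
    just fails to be integrable on the plane. Any decay exponent strictly between 0 and 1 closes the
    gap.\<close>
  obtain K where K: "\<And>z. (\<integral>x. rho x powr (-2) * cmod (z - x) powr (-1) \<partial>lborel) \<le> K * rho z powr (-(1/2))"
    using kernel_decay[of "1/2"] by auto
  obtain K0 where K0: "\<And>z. integrable lborel (\<lambda>x. rho x powr (-2) * cmod (z - x) powr (-1))"
    by (rule kernel_bound[of 1 2]) auto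
  have M: "M \<ge> 0" using f[of 0] by (simp add: rho_def) (meson norm_ge_zero order_trans)
  have N: "N \<ge> 0" using k[of 0] by (simp add: rho_def) (meson norm_ge_zero order_trans)
  let ?F = "\<lambda>z x. k z * f x / (z - x)"
  have le: "cmod (?F z x) \<le> (N * rho z powr (-2) * M) * (rho x powr (-2) * cmod (z - x) powr (-1))" for z x
  proof -
    have "cmod (?F z x) = cmod (k z) * cmod (f x) * cmod (z - x) powr (-1)"
      by (simp only: norm_cauchy_kernel norm_mult)
    also have "\<dots> \<le> (N * rho z powr (-2)) * (M * rho x powr (-2)) * cmod (z - x) powr (-1)"
      using M N by (intro mult_right_mono mult_mono f k) auto
    finally show ?thesis by (simp only: mult_ac)
  qed
  have iF: "integrable lborel (\<lambda>x. ?F z x)" for z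
  proof (rule Bochner_Integration.integrable_bound[OF integrable_mult_right[OF K0[of z], of "N * rho z powr (-2) * M"]])
    show "AE x in lborel. norm (?F z x) \<le> norm ((N * rho z powr (-2) * M) * (rho x powr (-2) * cmod (z - x) powr (-1)))"
      using order_trans[OF le abs_ge_self] by (intro AE_I2) (simp only: real_norm_def)
  qed measurable
  have int: "integrable (lborel \<Otimes>\<^sub>M lborel) (\<lambda>(z, x). ?F z x)"
  proof (rule lborel_pair.Fubini_integrable)
    show "integrable lborel (\<lambda>z. \<integral>x. norm (case (z, x) of (z, x) \<Rightarrow> ?F z x) \<partial>lborel)"
    proof (rule Bochner_Integration.integrable_bound)
      show "integrable lborel (\<lambda>z. (N * M * K) * rho z powr (-(5/2)))"
        by (intro integrable_mult_right integrable_rho_powr) simp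
      show "AE z in lborel. norm (\<integral>x. norm (case (z, x) of (z, x) \<Rightarrow> ?F z x) \<partial>lborel)
          \<le> norm ((N * M * K) * rho z powr (-(5/2)))"
      proof (rule AE_I2)
        fix z
        have "(\<integral>x. norm (?F z x) \<partial>lborel)
          \<le> (\<integral>x. (N * rho z powr (-2) * M) * (rho x powr (-2) * cmod (z - x) powr (-1)) \<partial>lborel)"
          by (intro integral_mono integrable_norm iF integrable_mult_right K0 le)
        also have "\<dots> = (N * rho z powr (-2) * M) * (\<integral>x. rho x powr (-2) * cmod (z - x) powr (-1) \<partial>lborel)"
          by (rule Bochner_Integration.integral_mult_right_zero)
        also have "\<dots> \<le> (N * rho z powr (-2) * M) * (K * rho z powr (-(1/2)))"
          using M N by (intro mult_left_mono K) auto
        also have "\<dots> = (N * M * K) * (rho z powr (-2) * rho z powr (-(1/2)))" by (simp only: mult_ac)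
        also have "rho z powr (-2) * rho z powr (-(1/2)) = rho z powr (-(5/2))"
          by (simp only: powr_add[symmetric]) simp
        finally show "norm (\<integral>x. norm (case (z, x) of (z, x) \<Rightarrow> ?F z x) \<partial>lborel)
          \<le> norm ((N * M * K) * rho z powr (-(5/2)))"
          by (simp only: prod.case real_norm_def abs_of_nonneg[OF integral_nonneg_AE[OF AE_I2[OF norm_ge_zero]]])
      qed
    qed measurable
    show "AE z in lborel. integrable lborel (\<lambda>x. case (z, x) of (z, x) \<Rightarrow> ?F z x)"
      using iF by simp
  qed measurable
  have "(\<integral>z. k z * cauchy_transform f z \<partial>lborel) = (\<integral>z. of_real (1 / pi) * (\<integral>x. ?F z x \<partial>lborel) \<partial>lborel)"
  proof (rule Bochner_Integration.integral_cong[OF refl])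
    fix z
    have "(\<integral>x. ?F z x \<partial>lborel) = (\<integral>x. k z * (f x / (z - x)) \<partial>lborel)" by simp
    also have "\<dots> = k z * (\<integral>x. f x / (z - x) \<partial>lborel)" by (rule Bochner_Integration.integral_mult_right_zero)
    finally show "k z * cauchy_transform f z = of_real (1 / pi) * (\<integral>x. ?F z x \<partial>lborel)"
      by (simp add: cauchy_transform_def)
  qed
  also have "\<dots> = of_real (1 / pi) * (\<integral>z. (\<integral>x. ?F z x \<partial>lborel) \<partial>lborel)"
    by (rule Bochner_Integration.integral_mult_right_zero)
  also have "(\<integral>z. (\<integral>x. ?F z x \<partial>lborel) \<partial>lborel) = (\<integral>x. (\<integral>z. ?F z x \<partial>lborel) \<partial>lborel)"
    by (rule lborel_pair.Fubini_integral[OF int, symmetric])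
  also have "of_real (1 / pi) * (\<integral>x. (\<integral>z. ?F z x \<partial>lborel) \<partial>lborel) = (\<integral>x. of_real (1 / pi) * (\<integral>z. ?F z x \<partial>lborel) \<partial>lborel)"
    by (rule Bochner_Integration.integral_mult_right_zero[symmetric])
  also have "\<dots> = (\<integral>x. - (f x * cauchy_transform k x) \<partial>lborel)"
  proof (rule Bochner_Integration.integral_cong[OF refl])
    fix x
    have "(\<integral>z. ?F z x \<partial>lborel) = (\<integral>z. (- f x) * (k z / (x - z)) \<partial>lborel)"
    proof (rule Bochner_Integration.integral_cong[OF refl])
      \<comment> \<open>On the diagonal both sides are 0 by the convention for division.\<close>
      fix z show "?F z x = (- f x) * (k z / (x - z))"
        by (cases "x = z") (auto simp: field_simps)
    qed
    also have "\<dots> = (- f x) * (\<integral>z. k z / (x - z) \<partial>lborel)" by (rule Bochner_Integration.integral_mult_right_zero)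
    finally show "of_real (1 / pi) * (\<integral>z. ?F z x \<partial>lborel) = - (f x * cauchy_transform k x)"
      by (simp add: cauchy_transform_def)
  qed
  finally show ?thesis by simp
qed

lemma conj_cauchy_duality:
  fixes f k :: "complex \<Rightarrow> complex"
  assumes [measurable]: "f \<in> borel_measurable borel" "k \<in> borel_measurable borel"
    and f: "\<And>x. cmod (f x) \<le> M * rho x powr (-2)" and k: "\<And>x. cmod (k x) \<le> N * rho x powr (-2)"
  shows "(\<integral>z. k z * conj_cauchy_transform f z \<partial>lborel) = - (\<integral>z. f z * conj_cauchy_transform k z \<partial>lborel)"
proof -
  have "(\<integral>z. cnj (k z) * cauchy_transform (\<lambda>x. cnj (f x)) z \<partial>lborel)
    = - (\<integral>z. cnj (f z) * cauchy_transform (\<lambda>x. cnj (k x)) z \<partial>lborel)"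
    by (rule cauchy_duality[of _ _ M N]) (use f k in simp_all)
  then have "cnj (\<integral>z. cnj (k z) * cauchy_transform (\<lambda>x. cnj (f x)) z \<partial>lborel)
    = cnj (- (\<integral>z. cnj (f z) * cauchy_transform (\<lambda>x. cnj (k x)) z \<partial>lborel))" by (rule arg_cong)
  then show ?thesis
    unfolding conj_cauchy_transform_cnj complex_cnj_minus Bochner_Integration.integral_cnj[symmetric]
    by (simp only: complex_cnj_mult complex_cnj_cnj)
qed

lemma conj_cauchy_weighted_bounded:
  obtains K where "K \<ge> 0"
    and "\<And>h M z. h \<in> borel_measurable borel \<Longrightarrow> (\<And>x. cmod (h x) \<le> M) \<Longrightarrow>
      cmod (conj_cauchy_transform (\<lambda>x. of_real (rho x powi (-2)) * h x) z) \<le> M * K"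
proof -
  obtain K where K: "K \<ge> 0" "\<And>f M z. f \<in> borel_measurable borel \<Longrightarrow> (\<And>x. cmod (f x) \<le> M * rho x powr (-2)) \<Longrightarrow>
      cmod (cauchy_transform f z) \<le> M * (K * rho z powr (-0))"
    by (rule cauchy_decay[of 0]) auto
  show thesis
  proof (rule that[OF K(1)])
    fix h :: "complex \<Rightarrow> complex" and M z
    assume [measurable]: "h \<in> borel_measurable borel" and h: "\<And>x. cmod (h x) \<le> M"
    have "cmod (cnj (of_real (rho x powi (-2)) * h x)) \<le> M * rho x powr (-2)" for x
      unfolding complex_mod_cnj norm_weight_mult by (intro mult_right_mono h) simp
    from K(2)[OF _ this, of z] show "cmod (conj_cauchy_transform (\<lambda>x. of_real (rho x powi (-2)) * h x) z) \<le> M * K"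
      unfolding conj_cauchy_transform_cnj complex_mod_cnj using rho_pos[of z] by simp
  qed
qed

section \<open>Explicit eigenfunctions and their inner transforms\<close>

definition eigenfun :: "complex \<Rightarrow> complex \<Rightarrow> complex \<Rightarrow> complex" where
  "eigenfun a b z = (a + b * cnj z) / (1 + z * cnj z)"

text \<open>The second component \<open>g\<close> of the first order system whose first component is
  \<open>eigenfun a b\<close>.\<close>

definition coeigenfun :: "complex \<Rightarrow> complex \<Rightarrow> complex \<Rightarrow> complex" where
  "coeigenfun a b z = (a * z - b) / (1 + z * cnj z)"

lemma affine_over_rho_square:
  assumes "cmod u \<le> C * rho z"
  shows "cmod (u / (1 + z * cnj z)) \<le> C * rho z powr (-1)"
  using assms rho_pos[of z] unfolding rho_square_complex norm_divide norm_of_real rho_powr_minus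
  by (simp add: power2_eq_square divide_simps)

lemma norm_affine_le_rho: "cmod (a + b * z) \<le> (cmod a + cmod b) * rho z"
proof -
  have "cmod (a + b * z) \<le> cmod a * 1 + cmod b * cmod z"
    using norm_triangle_ineq[of a "b * z"] by (simp add: norm_mult)
  also have "\<dots> \<le> cmod a * rho z + cmod b * rho z"
    using rho_ge_1[of z] rho_ge_cmod[of z] by (intro add_mono mult_left_mono) auto
  finally show ?thesis by (simp add: distrib_right)
qed

lemma rho_cnj [simp]: "rho (cnj z) = rho z"
  by (simp add: rho_def)

lemma norm_eigenfun_le: "cmod (eigenfun a b z) \<le> (cmod a + cmod b) * rho z powr (-1)"
  unfolding eigenfun_def using norm_affine_le_rho[of a b "cnj z"] by (intro affine_over_rho_square) simp

lemma norm_coeigenfun_le: "cmod (coeigenfun a b z) \<le> (cmod a + cmod b) * rho z powr (-1)"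
  unfolding coeigenfun_def using norm_affine_le_rho[of "-b" a z] by (intro affine_over_rho_square) (simp add: add.commute)

lemma continuous_on_eigenfun: "continuous_on S (eigenfun a b)"
  and continuous_on_coeigenfun: "continuous_on S (coeigenfun a b)"
  unfolding eigenfun_def coeigenfun_def by (intro continuous_intros ballI rho_square_nonzero)+

lemma measurable_eigenfun [measurable]: "eigenfun a b \<in> borel_measurable borel"
  and measurable_coeigenfun [measurable]: "coeigenfun a b \<in> borel_measurable borel"
  by (simp_all add: borel_measurable_continuous_onI continuous_on_eigenfun continuous_on_coeigenfun)

lemma has_wirtinger_rho_square: "has_wirtinger (\<lambda>z. 1 + z * cnj z) (cnj z) z z"
  using has_wirtinger_add[OF has_wirtinger_const has_wirtinger_mult[OF has_wirtinger_ident has_wirtinger_cnj_ident]]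
  by simp

lemma weight_decay:
  assumes "cmod u \<le> C * rho z powr (-1)" "C \<ge> 0"
  shows "cmod (of_real (rho z powi (-2)) * u) \<le> C * rho z powr (-2)"
proof -
  have "C * rho z powr (-1) \<le> C * 1" using assms by (intro mult_left_mono rho_powr_le_1) auto
  with assms have "cmod u \<le> C" by simp
  then show ?thesis unfolding norm_weight_mult by (intro mult_right_mono) auto
qed

text \<open>By the inversion formula a differentiation suffices: the numerator of the
  \<open>z\<close>-derivative of \<open>coeigenfun a b\<close> is
  \<open>a * (1 + z * cnj z) - (a * z - b) * cnj z = a + b * cnj z\<close>.\<close>

lemma conj_cauchy_eigenfun:
  "conj_cauchy_transform (\<lambda>z. of_real (rho z powi (-2)) * eigenfun a b z) z = coeigenfun a b z"
proof (rule conj_cauchy_transform_d[where B = "\<lambda>z. - (a * z - b) * z / (1 + z * cnj z)\<^sup>2" and K = "cmod a + cmod b" and L = "cmod a + cmod b"])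
  fix z
  have "has_wirtinger (\<lambda>z. (a * z - b) / (1 + z * cnj z))
    ((a * (1 + z * cnj z) - (a * z - b) * cnj z) / (1 + z * cnj z)\<^sup>2)
    ((0 * (1 + z * cnj z) - (a * z - b) * z) / (1 + z * cnj z)\<^sup>2) z"
    by (rule has_wirtinger_divide[OF _ has_wirtinger_rho_square rho_square_nonzero])
       (use has_wirtinger_diff[OF has_wirtinger_mult[OF has_wirtinger_const has_wirtinger_ident] has_wirtinger_const] in simp)
  then show "has_wirtinger (coeigenfun a b) (of_real (rho z powi (-2)) * eigenfun a b z)
       (- (a * z - b) * z / (1 + z * cnj z)\<^sup>2) z"
    unfolding coeigenfun_def[abs_def]
    unfolding weight_eq
    by (rule has_wirtinger_eq_rhs) (simp_all add: eigenfun_def power2_eq_square algebra_simps)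
  show "cmod (coeigenfun a b z) \<le> (cmod a + cmod b) * rho z powr - 1" by (rule norm_coeigenfun_le)
  show "cmod (of_real (rho z powi (-2)) * eigenfun a b z) \<le> (cmod a + cmod b) * rho z powr (-2)"
    by (intro weight_decay norm_eigenfun_le) simp
qed (unfold weight_eq, auto intro!: continuous_intros continuous_on_eigenfun)

text \<open>The mirror computation, now with the \<open>cnj z\<close>-derivative:
  \<open>(a + b * cnj z) * z - b * (1 + z * cnj z) = a * z - b\<close>.\<close>

lemma cauchy_coeigenfun:
  "cauchy_transform (\<lambda>z. of_real (rho z powi (-2)) * coeigenfun a b z) z = - eigenfun a b z"
proof (rule cauchy_transform_dbar[where A = "\<lambda>z. (a + b * cnj z) * cnj z / (1 + z * cnj z)\<^sup>2" and K = "cmod a + cmod b" and L = "cmod a + cmod b"])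
  fix z
  have "has_wirtinger (\<lambda>z. 0 - (a + b * cnj z) / (1 + z * cnj z))
    (0 - (0 * (1 + z * cnj z) - (a + b * cnj z) * cnj z) / (1 + z * cnj z)\<^sup>2)
    (0 - (b * (1 + z * cnj z) - (a + b * cnj z) * z) / (1 + z * cnj z)\<^sup>2) z"
    by (rule has_wirtinger_diff[OF has_wirtinger_const has_wirtinger_divide[OF _ has_wirtinger_rho_square rho_square_nonzero]])
       (use has_wirtinger_add[OF has_wirtinger_const has_wirtinger_mult[OF has_wirtinger_const has_wirtinger_cnj_ident]] in simp)
  then show "has_wirtinger (\<lambda>z. - eigenfun a b z) ((a + b * cnj z) * cnj z / (1 + z * cnj z)\<^sup>2)
      (of_real (rho z powi (-2)) * coeigenfun a b z) z"
    unfolding eigenfun_def diff_0 weight_eq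
    by (rule has_wirtinger_eq_rhs)
       (simp_all add: coeigenfun_def power2_eq_square algebra_simps minus_divide_left)
  show "cmod (- eigenfun a b z) \<le> (cmod a + cmod b) * rho z powr - 1" using norm_eigenfun_le by simp
  show "cmod (of_real (rho z powi (-2)) * coeigenfun a b z) \<le> (cmod a + cmod b) * rho z powr (-2)"
    by (intro weight_decay norm_coeigenfun_le) simp
qed (unfold weight_eq, auto intro!: continuous_intros continuous_on_coeigenfun)

lemma T0_fun_eigenfun: "T0_fun (eigenfun a b) = eigenfun a b"
  unfolding T0_fun_def conj_cauchy_eigenfun cauchy_coeigenfun by simp

text \<open>A nonzero affine function of \<open>cnj z\<close> has at most one zero, and points are
  null. Linear independence of the two eigenclasses rests on this.\<close>

lemma eigenfun_AE_eq_0: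
  assumes "AE z in lborel. eigenfun a b z = 0"
  shows "a = 0 \<and> b = 0"
proof (rule ccontr)
  assume n: "\<not> (a = 0 \<and> b = 0)"
  \<comment> \<open>For \<open>b = 0\<close> the excluded point is 0 by the convention for division,
    while the numerator is then a nonzero constant.\<close>
  have "AE z in lborel. z \<noteq> cnj (- a / b)" by (rule AE_lborel_singleton)
  with assms have "AE z in (lborel :: complex measure). False"
  proof eventually_elim
    case (elim z)
    then have "a + b * cnj z = 0" using rho_square_nonzero[of z] by (simp add: eigenfun_def)
    with n have b: "b \<noteq> 0" and e: "b * cnj z = - a" by (auto simp: eq_neg_iff_add_eq_0 add.commute)
    from b have "cnj z = b * cnj z / b" by simp
    also have "\<dots> = - a / b" by (simp only: e)
    finally have "cnj z = - a / b" .
    then have "z = cnj (- a / b)" by (metis complex_cnj_cnj)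
    with elim show False by simp
  qed
  then have "emeasure lborel (UNIV :: complex set) = 0"
    by (simp add: AE_iff_measurable[where N = UNIV])
  then show False by simp
qed

section \<open>Logarithmic test functions\<close>

text \<open>The algebra of \<open>wirt_v\<close>. Here \<open>Z\<close>, \<open>A\<close> and
  \<open>e\<close> stand for \<open>cnj z\<close>, \<open>cnj a\<close> and the squared
  regularisation parameter; treated as independent, they are tied only by the relations that define
  \<open>q\<close> and \<open>r\<close>. These turn \<open>(A - Z) * (z - a)\<close> into
  \<open>e - q\<close> and \<open>(A - Z) * z\<close> into \<open>(1 + z * A) - r\<close>, which
  removes \<open>Z\<close> and reduces the claim to an identity between fractions in
  \<open>q\<close> and \<open>r\<close>.\<close>

lemma dbar_test_identity:
  fixes z Z a A q r e l :: complex
  assumes "q \<noteq> 0" "r \<noteq> 0" "(z - a) * (Z - A) = q - e" "z * Z = r - 1"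
  shows "(((- l + (A - Z) * ((z - a) / q - z / r)) * r - (A - Z) * l * z) / r\<^sup>2) + (1 + z * A) * (e / q\<^sup>2 - 1 / r\<^sup>2)
    = e * (1 + z * A) / q\<^sup>2 + e / (r * q) - 2 * (1 + z * A) / r\<^sup>2 - (1 + z * A) * l / r\<^sup>2"
proof -
  have 1: "(A - Z) * (z - a) = e - q" using assms(3) by (simp add: algebra_simps)
  have 2: "(A - Z) * z = (1 + z * A) - r" using assms(4) by (simp add: algebra_simps)
  have "(A - Z) * ((z - a) / q - z / r) = ((A - Z) * (z - a)) / q - ((A - Z) * z) / r"
    by (simp only: right_diff_distrib times_divide_eq_right)
  also have "\<dots> = e / q - (1 + z * A) / r"
    using assms(1,2) unfolding 1 2 by (simp add: diff_divide_distrib)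
  finally have 3: "(A - Z) * ((z - a) / q - z / r) = e / q - (1 + z * A) / r" .
  have "(- l + (A - Z) * ((z - a) / q - z / r)) * r - (A - Z) * l * z
    = - l * r + (e / q - (1 + z * A) / r) * r - ((A - Z) * z) * l"
    unfolding 3 by (simp add: algebra_simps)
  also have "\<dots> = - l * r + (e / q - (1 + z * A) / r) * r - ((1 + z * A) - r) * l"
    unfolding 2 ..
  also have "\<dots> = (e / q) * r - (1 + z * A) - (1 + z * A) * l"
    using assms(2) by (simp add: left_diff_distrib mult.commute[of l r])
  finally have "(- l + (A - Z) * ((z - a) / q - z / r)) * r - (A - Z) * l * z
    = (e / q) * r - (1 + z * A) - (1 + z * A) * l" .
  moreover have "(e / q * r - C - C * l) / r\<^sup>2 + C * (e / q\<^sup>2 - 1 / r\<^sup>2)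
      = e * C / q\<^sup>2 + e / (r * q) - 2 * C / r\<^sup>2 - C * l / r\<^sup>2" for C
    using assms(1,2) by (simp add: divide_simps) (simp add: algebra_simps power2_eq_square)
  ultimately show ?thesis by (simp only:)
qed

text \<open>
  Up to the regularisation by \<open>t\<close>, the function \<open>l\<close> is the logarithm of the squared chordal distance
  from \<open>z\<close> to \<open>a\<close>; further \<open>v = r \<partial>w\<close> and \<open>dv\<close> is the derivative of \<open>v\<close> with respect to \<open>cnj z\<close>.
\<close>

locale test_functions =
  fixes a :: complex and t :: real
  assumes t: "t > 0"
begin

definition q :: "complex \<Rightarrow> complex" where "q z = (z - a) * cnj (z - a) + of_real (t\<^sup>2)"
definition r :: "complex \<Rightarrow> complex" where "r z = 1 + z * cnj z"
definition c :: "complex \<Rightarrow> complex" where "c z = 1 + z * cnj a"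
definition l :: "complex \<Rightarrow> complex" where "l z = Ln (q z) - Ln (r z)"
definition m :: "complex \<Rightarrow> complex" where "m z = cnj (z - a) / q z - cnj z / r z"
definition n :: "complex \<Rightarrow> complex" where "n z = (z - a) / q z - z / r z"
definition w :: "complex \<Rightarrow> complex" where "w z = c z * l z / r z"
definition v :: "complex \<Rightarrow> complex" where "v z = (cnj a - cnj z) * l z / r z + c z * m z"
definition dv :: "complex \<Rightarrow> complex" where
  "dv z = of_real (t\<^sup>2) * c z / (q z)\<^sup>2 + of_real (t\<^sup>2) / (r z * q z) - 2 * c z / (r z)\<^sup>2 - c z * l z / (r z)\<^sup>2"

lemma q_real: "q z = of_real ((cmod (z - a))\<^sup>2 + t\<^sup>2)"
  unfolding q_def complex_norm_square[symmetric] by simp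

lemma r_real: "r z = of_real ((rho z)\<^sup>2)"
  unfolding r_def by (rule rho_square_complex)

lemma q_pos: "(cmod (z - a))\<^sup>2 + t\<^sup>2 > 0"
  using t by (simp add: add_nonneg_pos)

lemma nonzero [simp]: "q z \<noteq> 0" "r z \<noteq> 0"
  using q_pos[of z] rho_pos[of z] unfolding q_real r_real of_real_eq_0_iff by auto

lemma not_neg: "q z \<notin> \<real>\<^sub>\<le>\<^sub>0" "r z \<notin> \<real>\<^sub>\<le>\<^sub>0"
  unfolding q_real r_real using q_pos[of z] rho_pos[of z] by (auto simp del: of_real_power of_real_add)

lemma wirt_c: "has_wirtinger c (cnj a) 0 z"
  using has_wirtinger_add[OF has_wirtinger_const has_wirtinger_mult[OF has_wirtinger_ident has_wirtinger_const], of 1 "cnj a" z]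
  by (simp add: c_def[abs_def])

lemma wirt_cnj_shift: "has_wirtinger (\<lambda>z. cnj (z - a)) 0 1 z"
  using has_wirtinger_cnj[OF has_wirtinger_diff[OF has_wirtinger_ident has_wirtinger_const], of a z] by simp

lemma wirt_q: "has_wirtinger q (cnj (z - a)) (z - a) z"
  using has_wirtinger_add[OF has_wirtinger_mult[OF
      has_wirtinger_diff[OF has_wirtinger_ident has_wirtinger_const] wirt_cnj_shift] has_wirtinger_const]
  by (simp add: q_def[abs_def])

lemma wirt_r: "has_wirtinger r (cnj z) z z"
  using has_wirtinger_rho_square by (simp add: r_def[abs_def])

lemma wirt_l: "has_wirtinger l (m z) (n z) z"
  unfolding l_def[abs_def] m_def n_def
  by (rule has_wirtinger_diff[OF has_wirtinger_Ln[OF wirt_q not_neg(1)] has_wirtinger_Ln[OF wirt_r not_neg(2)]])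

lemma wirt_m: "has_wirtinger m ((cnj z)\<^sup>2 / (r z)\<^sup>2 - (cnj (z - a))\<^sup>2 / (q z)\<^sup>2)
    (of_real (t\<^sup>2) / (q z)\<^sup>2 - 1 / (r z)\<^sup>2) z"
  unfolding m_def[abs_def]
proof (rule has_wirtinger_eq_rhs[OF has_wirtinger_diff[OF
      has_wirtinger_divide[OF wirt_cnj_shift wirt_q nonzero(1)]
      has_wirtinger_divide[OF has_wirtinger_cnj_ident wirt_r nonzero(2)]]])
  have "1 * q z - cnj (z - a) * (z - a) = of_real (t\<^sup>2)" "1 * r z - cnj z * z = 1"
    by (simp_all add: q_def r_def)
  then show "(1 * q z - cnj (z - a) * (z - a)) / (q z)\<^sup>2 - (1 * r z - cnj z * z) / (r z)\<^sup>2
    = of_real (t\<^sup>2) / (q z)\<^sup>2 - 1 / (r z)\<^sup>2" by (simp only:)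
  show "(0 * q z - cnj (z - a) * cnj (z - a)) / (q z)\<^sup>2 - (0 * r z - cnj z * cnj z) / (r z)\<^sup>2
    = (cnj z)\<^sup>2 / (r z)\<^sup>2 - (cnj (z - a))\<^sup>2 / (q z)\<^sup>2" by (simp add: power2_eq_square)
qed

lemma wirt_w: "has_wirtinger w (v z / r z) (((c z * n z + 0 * l z) * r z - c z * l z * z) / (r z)\<^sup>2) z"
  unfolding w_def[abs_def]
proof (rule has_wirtinger_eq_rhs[OF has_wirtinger_divide[OF has_wirtinger_mult[OF wirt_c wirt_l] wirt_r nonzero(2)] _ refl])
  \<comment> \<open>The quadratic terms cancel, so the logarithmic part of \<open>v\<close> decays
    like \<open>rho powr (-1)\<close> instead of merely staying bounded.\<close>
  have e: "cnj a * r z - c z * cnj z = cnj a - cnj z" by (simp add: r_def c_def algebra_simps)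
  have "(c z * m z + cnj a * l z) * r z - c z * l z * cnj z = (cnj a * r z - c z * cnj z) * l z + c z * m z * r z"
    by (simp add: algebra_simps)
  also have "\<dots> = v z * r z"
    unfolding e v_def by (simp add: distrib_right)
  finally show "((c z * m z + cnj a * l z) * r z - c z * l z * cnj z) / (r z)\<^sup>2 = v z / r z"
    by (simp add: power2_eq_square)
qed

lemma wirt_v: "has_wirtinger v
    (((cnj a - cnj z) * m z * r z - (cnj a - cnj z) * l z * cnj z) / (r z)\<^sup>2
      + (c z * ((cnj z)\<^sup>2 / (r z)\<^sup>2 - (cnj (z - a))\<^sup>2 / (q z)\<^sup>2) + cnj a * m z)) (dv z) z"
  unfolding v_def[abs_def]
proof (rule has_wirtinger_eq_rhs[OF has_wirtinger_add[OF has_wirtinger_divide[OF has_wirtinger_mult[OF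
      has_wirtinger_diff[OF has_wirtinger_const has_wirtinger_cnj_ident] wirt_l] wirt_r nonzero(2)]
      has_wirtinger_mult[OF wirt_c wirt_m]]])
  have q: "(z - a) * (cnj z - cnj a) = q z - of_real (t\<^sup>2)" "z * cnj z = r z - 1"
    by (simp_all add: q_def r_def)
  show "(((cnj a - cnj z) * n z + (0 - 1) * l z) * r z - (cnj a - cnj z) * l z * z) / (r z)\<^sup>2
      + (c z * (of_real (t\<^sup>2) / (q z)\<^sup>2 - 1 / (r z)\<^sup>2) + 0 * m z) = dv z"
    using dbar_test_identity[OF nonzero q, of "l z"]
    unfolding dv_def n_def c_def by (simp add: algebra_simps)
qed (simp add: algebra_simps)

lemma continuous_q: "continuous_on S q" and continuous_r: "continuous_on S r" and continuous_c: "continuous_on S c"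
  unfolding q_def r_def c_def by (intro continuous_intros)+

lemma continuous_l: "continuous_on S l"
  using wirt_l by (intro continuous_at_imp_continuous_on ballI has_wirtinger_isCont)

lemma continuous_m: "continuous_on S m"
  using wirt_m by (intro continuous_at_imp_continuous_on ballI has_wirtinger_isCont)

lemma continuous_n: "continuous_on S n"
  unfolding n_def by (intro continuous_intros continuous_q continuous_r) auto

lemma continuous_v: "continuous_on S v"
  using wirt_v by (intro continuous_at_imp_continuous_on ballI has_wirtinger_isCont)

lemma continuous_w: "continuous_on S w"
  using wirt_w by (intro continuous_at_imp_continuous_on ballI has_wirtinger_isCont)

lemma continuous_dv: "continuous_on S dv"
  unfolding dv_def by (intro continuous_intros continuous_q continuous_r continuous_c continuous_l) auto

section \<open>Size of the test functions\<close>

lemma norm_r: "cmod (r z) = (rho z)\<^sup>2"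
  unfolding r_real norm_of_real by simp

lemma norm_q: "cmod (q z) = (cmod (z - a))\<^sup>2 + t\<^sup>2"
  unfolding q_real norm_of_real using q_pos[of z] by simp

lemma norm_c_le: "cmod (c z) \<le> (1 + cmod a) * rho z"
  using norm_affine_le_rho[of 1 "cnj a" z] by (simp add: c_def mult.commute)

text \<open>With \<open>q_upper\<close> it makes \<open>cmod (q z)\<close> comparable to the square
  of \<open>rho z\<close>. The term \<open>t\<^sup>2\<close> of \<open>q\<close> absorbs the
  constants near \<open>a\<close>, at the price of a \<open>D\<close> that blows up as
  \<open>t\<close> tends to 0; these bounds are used at fixed \<open>t\<close> only, to justify
  Green's theorem and duality.\<close>

lemma q_lower: obtains D where "D > 0" "\<And>z. (rho z)\<^sup>2 \<le> D * cmod (q z)"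
proof (rule that[of "2 + (1 + 2 * (cmod a)\<^sup>2) / t\<^sup>2"])
  show "0 < 2 + (1 + 2 * (cmod a)\<^sup>2) / t\<^sup>2" by (simp add: add_pos_nonneg)
  fix z
  have "cmod z \<le> cmod (z - a) + cmod a" using norm_triangle_ineq[of "z - a" a] by simp
  then have "(cmod z)\<^sup>2 \<le> (cmod (z - a) + cmod a)\<^sup>2" by (intro power_mono) auto
  also have "\<dots> \<le> 2 * (cmod (z - a))\<^sup>2 + 2 * (cmod a)\<^sup>2"
    using sum_squares_bound[of "cmod (z - a)" "cmod a"] by (simp add: power2_sum)
  finally have "(rho z)\<^sup>2 \<le> 2 * (cmod (z - a))\<^sup>2 + (1 + 2 * (cmod a)\<^sup>2) / t\<^sup>2 * t\<^sup>2"
    using t by (simp add: rho_power2)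
  also have "\<dots> \<le> (2 + (1 + 2 * (cmod a)\<^sup>2) / t\<^sup>2) * cmod (q z)"
  proof -
    have le: "2 * d + C * e \<le> (2 + C) * (d + e)" if "d \<ge> 0" "e \<ge> 0" "C \<ge> 0" for d e C :: real
      using that by (simp add: algebra_simps)
    show ?thesis unfolding norm_q by (rule le) simp_all
  qed
  finally show "(rho z)\<^sup>2 \<le> (2 + (1 + 2 * (cmod a)\<^sup>2) / t\<^sup>2) * cmod (q z)" .
qed

lemma q_upper: obtains D where "D > 0" "\<And>z. cmod (q z) \<le> D * (rho z)\<^sup>2"
proof (rule that[of "2 + (2 * (cmod a)\<^sup>2 + t\<^sup>2)"])
  show "0 < 2 + (2 * (cmod a)\<^sup>2 + t\<^sup>2)" by (simp add: add_pos_nonneg)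
  fix z
  have "cmod (z - a) \<le> cmod z + cmod a" by (rule norm_triangle_ineq4)
  then have "(cmod (z - a))\<^sup>2 \<le> (cmod z + cmod a)\<^sup>2" by (intro power_mono) auto
  also have "\<dots> \<le> 2 * (cmod z)\<^sup>2 + 2 * (cmod a)\<^sup>2"
    using sum_squares_bound[of "cmod z" "cmod a"] by (simp add: power2_sum)
  finally have "cmod (q z) \<le> 2 * (rho z)\<^sup>2 + (2 * (cmod a)\<^sup>2 + t\<^sup>2) * 1"
    by (simp add: rho_power2 norm_q)
  also have "\<dots> \<le> 2 * (rho z)\<^sup>2 + (2 * (cmod a)\<^sup>2 + t\<^sup>2) * (rho z)\<^sup>2"
    using rho_ge_1[of z] by (intro add_left_mono mult_left_mono) auto
  finally show "cmod (q z) \<le> (2 + (2 * (cmod a)\<^sup>2 + t\<^sup>2)) * (rho z)\<^sup>2" by (simp add: distrib_right)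
qed

text \<open>Each logarithm is unbounded, but \<open>q\<close> and \<open>r\<close> are positive
  reals of comparable size, so the real logarithm of their quotient is bounded on both
  sides.\<close>

lemma l_bounded: obtains L where "L \<ge> 0" "\<And>z. cmod (l z) \<le> L"
proof -
  obtain D where D: "D > 0" "\<And>z. (rho z)\<^sup>2 \<le> D * cmod (q z)" using q_lower by blast
  obtain D' where D': "D' > 0" "\<And>z. cmod (q z) \<le> D' * (rho z)\<^sup>2" using q_upper by blast
  show thesis
  proof (rule that[of "\<bar>ln D\<bar> + \<bar>ln D'\<bar>"])
    fix z
    have q0: "cmod (q z) > 0" by simp
    have r0: "(rho z)\<^sup>2 > 0" using rho_pos[of z] by simp
    have "q z = of_real (cmod (q z))" unfolding norm_q by (rule q_real)
    then have "Ln (q z) = of_real (ln (cmod (q z)))" using Ln_of_real[OF q0] by simp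
    moreover have "Ln (r z) = of_real (ln ((rho z)\<^sup>2))" unfolding r_real by (rule Ln_of_real[OF r0])
    ultimately have "l z = of_real (ln (cmod (q z)) - ln ((rho z)\<^sup>2))" unfolding l_def of_real_diff by (simp only:)
    then have "cmod (l z) = \<bar>ln (cmod (q z)) - ln ((rho z)\<^sup>2)\<bar>" by (simp only: norm_of_real)
    moreover have "ln ((rho z)\<^sup>2) \<le> ln D + ln (cmod (q z))"
      using D(2)[of z] D(1) q0 r0 by (simp add: ln_mult_pos[symmetric] del: zero_less_norm_iff)
    moreover have "ln (cmod (q z)) \<le> ln D' + ln ((rho z)\<^sup>2)"
      using D'(2)[of z] D'(1) q0 r0 by (simp add: ln_mult_pos[symmetric] del: zero_less_norm_iff zero_less_power2)
    ultimately show "cmod (l z) \<le> \<bar>ln D\<bar> + \<bar>ln D'\<bar>" by linarith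
  qed simp
qed

text \<open>Each of the two fractions in \<open>m\<close> decays only to first order. Over the
  common denominator the cubic terms of the numerator cancel, leaving the quadratic
  \<open>?u\<close> against a denominator of order four.\<close>

lemma m_bound: obtains M where "M \<ge> 0" "\<And>z. cmod (m z) \<le> M * rho z powr (-2)"
proof -
  obtain D where D: "D > 0" "\<And>z. (rho z)\<^sup>2 \<le> D * cmod (q z)" using q_lower by blast
  let ?M = "((1 + cmod a) * (1 + cmod a) + t\<^sup>2) * D"
  show thesis
  proof (rule that[of ?M])
    show "?M \<ge> 0" using D by simp
    fix z
    let ?u = "(cnj z - cnj a) * cnj (c z) - of_real (t\<^sup>2) * cnj z"
    have "cnj (z - a) * r z - cnj z * q z = ?u"
      by (simp add: r_def q_def c_def algebra_simps)
    then have m: "m z = ?u / (q z * r z)"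
      unfolding m_def by (simp add: diff_frac_eq mult_ac)
    have "cmod ?u \<le> cmod (cnj z - cnj a) * cmod (c z) + t\<^sup>2 * cmod z"
      using norm_triangle_ineq4[of "(cnj z - cnj a) * cnj (c z)" "of_real (t\<^sup>2) * cnj z"]
      by (simp add: norm_mult norm_power)
    also have "\<dots> \<le> ((1 + cmod a) * rho z) * ((1 + cmod a) * rho z) + t\<^sup>2 * (rho z * rho z)"
    proof (intro add_mono mult_mono norm_c_le mult_left_mono)
      have "cmod (cnj z - cnj a) = cmod (- a + 1 * z)" by (metis complex_cnj_diff complex_mod_cnj diff_conv_add_uminus add.commute mult_1)
      also have "\<dots> \<le> (cmod a + 1) * rho z" using norm_affine_le_rho[of "-a" 1 z] by simp
      finally show "cmod (cnj z - cnj a) \<le> (1 + cmod a) * rho z" by (simp add: add.commute)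
      show "cmod z \<le> rho z * rho z"
        using rho_ge_cmod[of z] rho_ge_1[of z] mult_mono[of 1 "rho z" "cmod z" "rho z"] by simp
    qed (use rho_pos[of z] in auto)
    also have "\<dots> = ((1 + cmod a) * (1 + cmod a) + t\<^sup>2) * (rho z)\<^sup>2"
      by (simp add: algebra_simps power2_eq_square)
    finally have "cmod (m z) \<le> ((1 + cmod a) * (1 + cmod a) + t\<^sup>2) * (rho z)\<^sup>2 / (cmod (q z) * (rho z)\<^sup>2)"
      unfolding m norm_divide norm_mult norm_r using rho_pos[of z] by (intro divide_right_mono) auto
    also have "\<dots> = ((1 + cmod a) * (1 + cmod a) + t\<^sup>2) * (1 / cmod (q z))"
      using rho_pos[of z] by simp
    also have "\<dots> \<le> ((1 + cmod a) * (1 + cmod a) + t\<^sup>2) * (D / (rho z)\<^sup>2)"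
      using D(2)[of z] D(1) rho_pos[of z] by (intro mult_left_mono) (simp_all add: divide_simps mult_ac)
    finally show "cmod (m z) \<le> ?M * rho z powr (-2)"
      unfolding rho_powr_minus by simp
  qed
qed

lemma w_bound: obtains W where "W \<ge> 0" "\<And>z. cmod (w z) \<le> W * rho z powr (-1)"
proof -
  obtain L where L: "L \<ge> 0" "\<And>z. cmod (l z) \<le> L" using l_bounded by blast
  show thesis
  proof (rule that[of "(1 + cmod a) * L"])
    fix z
    have "cmod (c z * l z) \<le> ((1 + cmod a) * rho z) * L"
      unfolding norm_mult using rho_pos[of z] L by (intro mult_mono norm_c_le) auto
    also have "\<dots> = ((1 + cmod a) * L) * rho z" by (simp only: mult_ac)
    finally show "cmod (w z) \<le> ((1 + cmod a) * L) * rho z powr (-1)"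
      unfolding w_def r_def by (rule affine_over_rho_square)
  qed (use L in simp)
qed

lemma v_bound: obtains V where "V \<ge> 0" "\<And>z. cmod (v z) \<le> V * rho z powr (-1)"
proof -
  obtain L where L: "L \<ge> 0" "\<And>z. cmod (l z) \<le> L" using l_bounded by blast
  obtain M where M: "M \<ge> 0" "\<And>z. cmod (m z) \<le> M * rho z powr (-2)" using m_bound by blast
  show thesis
  proof (rule that[of "(cmod a + 1) * L + (1 + cmod a) * M"])
    fix z
    have "cmod (cnj a - cnj z) \<le> (cmod a + 1) * rho z"
      using norm_affine_le_rho[of "cnj a" "-1" "cnj z"] by simp
    then have "cmod ((cnj a - cnj z) * l z) \<le> ((cmod a + 1) * rho z) * L"
      unfolding norm_mult using rho_pos[of z] L by (intro mult_mono) auto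
    also have "\<dots> = ((cmod a + 1) * L) * rho z" by (simp only: mult_ac)
    finally have 1: "cmod ((cnj a - cnj z) * l z / r z) \<le> ((cmod a + 1) * L) * rho z powr (-1)"
      unfolding r_def by (rule affine_over_rho_square)
    have "cmod (c z * m z) \<le> ((1 + cmod a) * rho z powr 1) * (M * rho z powr (-2))"
      unfolding norm_mult using rho_pos[of z] M norm_c_le[of z] by (intro mult_mono) auto
    also have "\<dots> = ((1 + cmod a) * M) * (rho z powr 1 * rho z powr (-2))" by (simp only: mult_ac)
    also have "rho z powr 1 * rho z powr (-2) = rho z powr (-1)" by (simp only: powr_add[symmetric]) simp
    finally have 2: "cmod (c z * m z) \<le> ((1 + cmod a) * M) * rho z powr (-1)" .
    show "cmod (v z) \<le> ((cmod a + 1) * L + (1 + cmod a) * M) * rho z powr (-1)"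
      using norm_triangle_le[OF add_mono[OF 1 2]] unfolding v_def by (simp only: distrib_right)
  qed (use L M in simp)
qed

lemma norm_2c_le: "cmod (2 * c z) \<le> (2 * (1 + cmod a)) * rho z"
  using norm_c_le[of z]
  by (simp only: norm_mult norm_numeral mult.assoc mult_le_cancel_left_pos zero_less_numeral)

lemma r_square_bound:
  assumes "cmod u \<le> C * rho z" "C \<ge> 0"
  shows "cmod (u / (r z)\<^sup>2) \<le> C * rho z powr (-3)"
proof -
  have "cmod (u / (r z)\<^sup>2) \<le> (C * rho z) / (rho z) ^ 4"
  proof -
    have "((rho z)\<^sup>2)\<^sup>2 = rho z ^ 4" by (simp flip: power_mult)
    then show ?thesis unfolding norm_divide norm_power norm_r using assms(1) rho_pos[of z]
      by (simp only:) (intro divide_right_mono; simp)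
  qed
  also have "\<dots> = C * rho z powr (-3)"
    using rho_pos[of z] by (simp add: powr_minus_divide power_numeral_reduce)
  finally show ?thesis .
qed

lemma q_inverse_bound: obtains D where "D > 0" "\<And>z. 1 / cmod (q z) \<le> D * rho z powr (-2)"
proof -
  obtain D where D: "D > 0" "\<And>z. (rho z)\<^sup>2 \<le> D * cmod (q z)" using q_lower by blast
  have "1 / cmod (q z) \<le> D * rho z powr (-2)" for z
    unfolding rho_powr_minus using D(2)[of z] rho_pos[of z] by (simp add: divide_simps mult_ac)
  with D(1) show thesis by (rule that)
qed

lemma norm_inverse_r: "cmod (u / r z) = cmod u * rho z powr (-2)"
  unfolding rho_powr_minus norm_divide norm_r by simp

lemma dv_bound: obtains V where "V \<ge> 0" "\<And>z. cmod (dv z) \<le> V * rho z powr (-2)"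
proof -
  obtain L where L: "L \<ge> 0" "\<And>z. cmod (l z) \<le> L" using l_bounded by blast
  obtain D where D: "D > 0" "\<And>z. 1 / cmod (q z) \<le> D * rho z powr (-2)" using q_inverse_bound by blast
  let ?C = "1 + cmod a"
  let ?V = "t\<^sup>2 * ?C * D * D + t\<^sup>2 * D + 2 * ?C + ?C * L"
  show thesis
  proof (rule that[of ?V])
    show "?V \<ge> 0" using D L by simp
    fix z
    have e32: "rho z powr (-3) \<le> rho z powr (-2)" by (rule rho_powr_mono) simp
    have "cmod (of_real (t\<^sup>2) * c z / (q z)\<^sup>2) = t\<^sup>2 * cmod (c z) * ((1 / cmod (q z)) * (1 / cmod (q z)))"
      by (simp add: norm_mult norm_divide norm_power power2_eq_square)
    also have "\<dots> \<le> t\<^sup>2 * (?C * rho z powr 1) * ((D * rho z powr (-2)) * (D * rho z powr (-2)))"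
      using D(1) norm_c_le[of z] rho_pos[of z]
      by (intro mult_mono D(2)) (auto simp: mult_mono)
    also have "\<dots> = (t\<^sup>2 * ?C * D * D) * (rho z powr 1 * rho z powr (-2) * rho z powr (-2))" by (simp only: mult_ac)
    also have "rho z powr 1 * rho z powr (-2) * rho z powr (-2) = rho z powr (-3)"
      by (simp only: powr_add[symmetric]) simp
    also have "(t\<^sup>2 * ?C * D * D) * rho z powr (-3) \<le> (t\<^sup>2 * ?C * D * D) * rho z powr (-2)"
      using D(1) by (intro mult_left_mono e32) auto
    finally have 1: "cmod (of_real (t\<^sup>2) * c z / (q z)\<^sup>2) \<le> (t\<^sup>2 * ?C * D * D) * rho z powr (-2)" .
    have "cmod (of_real (t\<^sup>2) / (r z * q z)) = t\<^sup>2 * (1 / cmod (q z)) * rho z powr (-2)"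
      by (simp add: norm_mult norm_divide norm_power norm_r rho_powr_minus)
    also have "\<dots> \<le> t\<^sup>2 * (D * 1) * rho z powr (-2)"
      using D(1) rho_powr_le_1[of 2 z] by (intro mult_right_mono mult_left_mono order_trans[OF D(2)]) auto
    finally have 2: "cmod (of_real (t\<^sup>2) / (r z * q z)) \<le> (t\<^sup>2 * D) * rho z powr (-2)" by simp
    have "cmod (2 * c z / (r z)\<^sup>2) \<le> (2 * ?C) * rho z powr (-3)"
      by (rule r_square_bound[OF norm_2c_le]) simp
    also have "\<dots> \<le> (2 * ?C) * rho z powr (-2)" by (intro mult_left_mono e32) auto
    finally have 3: "cmod (2 * c z / (r z)\<^sup>2) \<le> (2 * ?C) * rho z powr (-2)" .
    have "cmod (c z * l z) \<le> (?C * rho z) * L"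
      unfolding norm_mult using rho_pos[of z] L by (intro mult_mono norm_c_le) auto
    then have "cmod (c z * l z / (r z)\<^sup>2) \<le> (?C * L) * rho z powr (-3)"
      using L by (intro r_square_bound) (simp_all add: mult_ac)
    also have "\<dots> \<le> (?C * L) * rho z powr (-2)" using L by (intro mult_left_mono e32) auto
    finally have 4: "cmod (c z * l z / (r z)\<^sup>2) \<le> (?C * L) * rho z powr (-2)" .
    have "cmod (dv z) \<le> (t\<^sup>2 * ?C * D * D) * rho z powr (-2) + (t\<^sup>2 * D) * rho z powr (-2)
        + (2 * ?C) * rho z powr (-2) + (?C * L) * rho z powr (-2)"
      unfolding dv_def
      by (intro order_trans[OF norm_triangle_ineq4] order_trans[OF norm_triangle_ineq] add_mono 1 2 3 4)
    also have "\<dots> = ?V * rho z powr (-2)" by (simp only: distrib_right)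
    finally show "cmod (dv z) \<le> ?V * rho z powr (-2)" .
  qed
qed

text \<open>Inversion applies because \<open>v / r\<close> is the \<open>z\<close>-derivative of
  \<open>w\<close>. Together with \<open>cauchy_dv\<close> it evaluates the transforms that duality
  moves onto the test functions.\<close>

lemma conj_cauchy_v: "conj_cauchy_transform (\<lambda>z. v z / r z) z = w z"
proof -
  obtain W where W: "W \<ge> 0" "\<And>z. cmod (w z) \<le> W * rho z powr (-1)" using w_bound by blast
  obtain V where V: "V \<ge> 0" "\<And>z. cmod (v z) \<le> V * rho z powr (-1)" using v_bound by blast
  show ?thesis
  proof (rule conj_cauchy_transform_d[OF wirt_w])
    show "continuous_on UNIV (\<lambda>z. v z / r z)"
      by (intro continuous_intros continuous_v continuous_r) simp
    show "continuous_on UNIV (\<lambda>z. ((c z * n z + 0 * l z) * r z - c z * l z * z) / (r z)\<^sup>2)"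
      by (intro continuous_intros continuous_c continuous_n continuous_l continuous_r) simp
    show "cmod (v z / r z) \<le> V * rho z powr (-2)" for z
    proof -
      have "cmod (v z) \<le> V * 1" using V rho_powr_le_1[of 1 z] by (meson mult_left_mono order_trans zero_le_one)
      then show ?thesis unfolding norm_inverse_r by (intro mult_right_mono) auto
    qed
  qed (rule W)
qed

lemma cauchy_dv: "cauchy_transform dv z = v z"
proof -
  obtain V where V: "V \<ge> 0" "\<And>z. cmod (v z) \<le> V * rho z powr (-1)" using v_bound by blast
  obtain V' where V': "V' \<ge> 0" "\<And>z. cmod (dv z) \<le> V' * rho z powr (-2)" using dv_bound by blast
  show ?thesis
  proof (rule cauchy_transform_dbar[OF wirt_v])
    show "continuous_on UNIV (\<lambda>z. ((cnj a - cnj z) * m z * r z - (cnj a - cnj z) * l z * cnj z) / (r z)\<^sup>2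
      + (c z * ((cnj z)\<^sup>2 / (r z)\<^sup>2 - (cnj (z - a))\<^sup>2 / (q z)\<^sup>2) + cnj a * m z))"
      by (intro continuous_intros continuous_c continuous_m continuous_l continuous_r continuous_q) simp_all
  qed (rule continuous_dv V(2) V'(2))+
qed

lemma measurable_test [measurable]:
  "v \<in> borel_measurable borel" "w \<in> borel_measurable borel" "dv \<in> borel_measurable borel"
  "r \<in> borel_measurable borel" "q \<in> borel_measurable borel" "c \<in> borel_measurable borel"
  by (auto intro!: borel_measurable_continuous_onI continuous_v continuous_w continuous_dv continuous_r continuous_q continuous_c)

text \<open>
  Testing \<open>h = T h\<close> against \<open>dv\<close> moves both Cauchy transforms onto the test functions, and
  \<open>dv + w / r\<close> no longer contains the logarithm.
\<close>

lemma fixed_point_tested: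
  assumes [measurable]: "h \<in> borel_measurable borel" and fp: "T0_fun h = h"
    and h: "\<And>z. cmod (h z) \<le> M * rho z powr (-(1/2))"
  shows "(\<integral>z. h z * c z * of_real (t\<^sup>2 / ((cmod (z - a))\<^sup>2 + t\<^sup>2)\<^sup>2) \<partial>lborel)
      + (\<integral>z. h z / r z * of_real (t\<^sup>2 / ((cmod (z - a))\<^sup>2 + t\<^sup>2)) \<partial>lborel)
    = 2 * (\<integral>z. h z * c z / (r z)\<^sup>2 \<partial>lborel)"
proof -
  have M: "M \<ge> 0" using h[of 0] by (simp add: rho_def) (meson norm_ge_zero order_trans)
  have hM: "cmod (h z) \<le> M" for z
    by (rule order_trans[OF h mult_left_le[OF rho_powr_le_1 M]]) simp
  obtain W where W: "W \<ge> 0" "\<And>z. cmod (w z) \<le> W * rho z powr (-1)" using w_bound by blast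
  obtain V where V: "V \<ge> 0" "\<And>z. cmod (v z) \<le> V * rho z powr (-1)" using v_bound by blast
  obtain V' where V': "V' \<ge> 0" "\<And>z. cmod (dv z) \<le> V' * rho z powr (-2)" using dv_bound by blast
  let ?wh = "\<lambda>z. of_real (rho z powi (-2)) * h z"
  let ?g = "conj_cauchy_transform ?wh"
  let ?f = "\<lambda>z. of_real (rho z powi (-2)) * ?g z"
  have wh: "cmod (?wh z) \<le> M * rho z powr (-2)" for z
    unfolding norm_weight_mult by (intro mult_right_mono hM) simp
  obtain K where g: "\<And>z. cmod (?g z) \<le> M * K"
    using conj_cauchy_weighted_bounded hM by (metis assms(1))
  have f: "cmod (?f z) \<le> (M * K) * rho z powr (-2)" for z
    unfolding norm_weight_mult by (intro mult_right_mono g) simp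
  have vr: "cmod (v z / r z) \<le> V * rho z powr (-2)" for z
  proof -
    have "cmod (v z) \<le> V * 1" using V rho_powr_le_1[of 1 z] by (meson mult_left_mono order_trans zero_le_one)
    then show ?thesis unfolding norm_inverse_r by (intro mult_right_mono) auto
  qed
  have hC: "h z = - cauchy_transform ?f z" for z
    using fun_cong[OF fp, of z] unfolding T0_fun_def by simp
  have "(\<integral>z. h z * dv z \<partial>lborel) = (\<integral>z. - (dv z * cauchy_transform ?f z) \<partial>lborel)"
    by (subst hC) (simp add: mult.commute)
  also have "\<dots> = (\<integral>z. ?f z * cauchy_transform dv z \<partial>lborel)"
    using cauchy_duality[of ?f dv, OF _ _ f V'(2)] by simp
  also have "\<dots> = (\<integral>z. v z / r z * ?g z \<partial>lborel)"
    unfolding cauchy_dv weight_eq r_def by (intro Bochner_Integration.integral_cong) auto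
  also have "\<dots> = - (\<integral>z. ?wh z * conj_cauchy_transform (\<lambda>z. v z / r z) z \<partial>lborel)"
    by (rule conj_cauchy_duality[OF _ _ wh vr]) simp_all
  also have "\<dots> = - (\<integral>z. h z * (w z / r z) \<partial>lborel)"
    unfolding conj_cauchy_v
    by (intro arg_cong[where f = uminus] Bochner_Integration.integral_cong refl) (unfold weight_eq r_def, simp)
  finally have eq: "(\<integral>z. h z * dv z \<partial>lborel) = - (\<integral>z. h z * (w z / r z) \<partial>lborel)" .
  \<comment> \<open>A bound by \<open>rho powr (-2)\<close> on the test functions does not make them
    integrable; the decay of \<open>h\<close> with exponent 1/2 supplies the margin.\<close>
  have r25: "integrable lborel (\<lambda>z. C * rho z powr (-(5/2)))" for C
    by (intro integrable_mult_right integrable_rho_powr) simp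
  have int: "integrable lborel (\<lambda>z. h z * u z)"
    if [measurable]: "u \<in> borel_measurable borel" and u: "\<And>z. cmod (u z) \<le> C * rho z powr (-2)" for u C
  proof (rule Bochner_Integration.integrable_bound[OF r25[of "M * C"]])
    show "AE z in lborel. norm (h z * u z) \<le> norm ((M * C) * rho z powr (-(5/2)))"
    proof (rule AE_I2)
      fix z
      have "norm (h z * u z) \<le> (M * rho z powr (-(1/2))) * (C * rho z powr (-2))"
        unfolding norm_mult using M by (intro mult_mono h u) auto
      also have "\<dots> = (M * C) * (rho z powr (-(1/2)) * rho z powr (-2))" by (simp only: mult_ac)
      also have "rho z powr (-(1/2)) * rho z powr (-2) = rho z powr (-(5/2))"
        by (simp only: powr_add[symmetric]) simp
      finally show "norm (h z * u z) \<le> norm ((M * C) * rho z powr (-(5/2)))" by simp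
    qed
  qed simp
  have iv: "integrable lborel (\<lambda>z. h z * dv z)" by (rule int[OF _ V'(2)]) simp
  have iw: "integrable lborel (\<lambda>z. h z * (w z / r z))"
  proof (rule int)
    show "cmod (w z / r z) \<le> W * rho z powr (-2)" for z
    proof -
      have "cmod (w z) \<le> W * 1" using W rho_powr_le_1[of 1 z] by (meson mult_left_mono order_trans zero_le_one)
      then show ?thesis unfolding norm_inverse_r by (intro mult_right_mono) auto
    qed
  qed simp
  have i2: "integrable lborel (\<lambda>z. h z * (of_real (t\<^sup>2) / (r z * q z)))"
  proof (rule int)
    show "cmod (of_real (t\<^sup>2) / (r z * q z)) \<le> 1 * rho z powr (-2)" for z
    proof -
      have "cmod (of_real (t\<^sup>2) / (r z * q z)) = (t\<^sup>2 / cmod (q z)) * rho z powr (-2)"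
        by (simp add: norm_mult norm_divide norm_power norm_r rho_powr_minus)
      also have "\<dots> \<le> 1 * rho z powr (-2)"
        using q_pos[of z] by (intro mult_right_mono) (auto simp: norm_q divide_simps)
      finally show ?thesis .
    qed
  qed simp
  have i3: "integrable lborel (\<lambda>z. h z * (2 * c z / (r z)\<^sup>2))"
  proof (rule int)
    show "cmod (2 * c z / (r z)\<^sup>2) \<le> (2 * (1 + cmod a)) * rho z powr (-2)" for z
    proof -
      have "cmod (2 * c z / (r z)\<^sup>2) \<le> (2 * (1 + cmod a)) * rho z powr (-3)"
        by (rule r_square_bound[OF norm_2c_le]) simp
      also have "\<dots> \<le> (2 * (1 + cmod a)) * rho z powr (-2)" by (intro mult_left_mono rho_powr_mono) auto
      finally show ?thesis .
    qed
  qed simp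
  have sum: "h z * (of_real (t\<^sup>2) * c z / (q z)\<^sup>2)
      = (h z * dv z + h z * (w z / r z)) - h z * (of_real (t\<^sup>2) / (r z * q z)) + h z * (2 * c z / (r z)\<^sup>2)" for z
  proof -
    have "w z / r z = c z * l z / (r z)\<^sup>2" by (simp add: w_def power2_eq_square)
    then show ?thesis by (simp only: dv_def distrib_left[symmetric] right_diff_distrib[symmetric]) simp
  qed
  have "(\<integral>z. h z * (of_real (t\<^sup>2) * c z / (q z)\<^sup>2) \<partial>lborel)
    = ((\<integral>z. h z * dv z \<partial>lborel) + (\<integral>z. h z * (w z / r z) \<partial>lborel))
      - (\<integral>z. h z * (of_real (t\<^sup>2) / (r z * q z)) \<partial>lborel) + (\<integral>z. h z * (2 * c z / (r z)\<^sup>2) \<partial>lborel)"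
    unfolding sum using iv iw i2 i3
    by (simp only: Bochner_Integration.integral_add Bochner_Integration.integral_diff
        Bochner_Integration.integrable_add Bochner_Integration.integrable_diff)
  then have "(\<integral>z. h z * (of_real (t\<^sup>2) * c z / (q z)\<^sup>2) \<partial>lborel) + (\<integral>z. h z * (of_real (t\<^sup>2) / (r z * q z)) \<partial>lborel)
    = (\<integral>z. h z * (2 * c z / (r z)\<^sup>2) \<partial>lborel)"
    unfolding eq by simp
  also have "(\<integral>z. h z * (2 * c z / (r z)\<^sup>2) \<partial>lborel) = (\<integral>z. 2 * (h z * c z / (r z)\<^sup>2) \<partial>lborel)"
    by (intro Bochner_Integration.integral_cong) auto
  also have "\<dots> = 2 * (\<integral>z. h z * c z / (r z)\<^sup>2 \<partial>lborel)"
    by (rule Bochner_Integration.integral_mult_right_zero)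
  also have "(\<integral>z. h z * (of_real (t\<^sup>2) * c z / (q z)\<^sup>2) \<partial>lborel)
    = (\<integral>z. h z * c z * of_real (t\<^sup>2 / ((cmod (z - a))\<^sup>2 + t\<^sup>2)\<^sup>2) \<partial>lborel)"
    by (intro Bochner_Integration.integral_cong) (auto simp: q_real)
  also have "(\<integral>z. h z * (of_real (t\<^sup>2) / (r z * q z)) \<partial>lborel)
    = (\<integral>z. h z / r z * of_real (t\<^sup>2 / ((cmod (z - a))\<^sup>2 + t\<^sup>2)) \<partial>lborel)"
    by (intro Bochner_Integration.integral_cong) (auto simp: q_real)
  finally show ?thesis .
qed

end

section \<open>The eigenvalue equation\<close>

text \<open>Phrased through a bound on the inner transform, so that it serves both for bounded
  \<open>h\<close> and for \<open>h\<close> with integrable \<open>p\<close>-th power, where this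
  bound is obtained in different ways.\<close>

lemma T0_fun_bounds:
  assumes b: "0 \<le> b" "b < 1"
  obtains K where "K \<ge> 0"
    and "\<And>h M z. h \<in> borel_measurable borel \<Longrightarrow>
      \<forall>x. cmod (conj_cauchy_transform (\<lambda>x. of_real (rho x powi (-2)) * h x) x) \<le> M \<Longrightarrow>
      cmod (T0_fun h z) \<le> M * (K * rho z powr (-b))"
    and "\<And>h M z y. h \<in> borel_measurable borel \<Longrightarrow>
      \<forall>x. cmod (conj_cauchy_transform (\<lambda>x. of_real (rho x powi (-2)) * h x) x) \<le> M \<Longrightarrow>
      cmod (T0_fun h z - T0_fun h y) \<le> M * K * sqrt (cmod (z - y))"
proof -
  obtain K where K: "K \<ge> 0" "\<And>f M z. f \<in> borel_measurable borel \<Longrightarrow> (\<And>x. cmod (f x) \<le> M * rho x powr (-2)) \<Longrightarrow>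
      cmod (cauchy_transform f z) \<le> M * (K * rho z powr (-b))"
    using cauchy_decay[OF b] by metis
  obtain L where L: "L \<ge> 0" "\<And>f M z y. f \<in> borel_measurable borel \<Longrightarrow> (\<And>x. cmod (f x) \<le> M * rho x powr (-2)) \<Longrightarrow>
      cmod (cauchy_transform f z - cauchy_transform f y) \<le> M * L * sqrt (cmod (z - y))"
    using cauchy_holder by metis
  show thesis
  proof (rule that[of "K + L"])
    fix h :: "complex \<Rightarrow> complex" and M z y
    let ?g = "conj_cauchy_transform (\<lambda>x. of_real (rho x powi (-2)) * h x)"
    let ?f = "\<lambda>w. of_real (rho w powi (-2)) * ?g w"
    assume [measurable]: "h \<in> borel_measurable borel" and "\<forall>x. cmod (?g x) \<le> M"
    then have g: "cmod (?g x) \<le> M" for x by blast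
    have M: "M \<ge> 0" using g[of 0] by (meson norm_ge_zero order_trans)
    have f: "cmod (?f x) \<le> M * rho x powr (-2)" for x
      unfolding norm_weight_mult by (intro mult_right_mono g) simp
    have "cmod (T0_fun h z) \<le> M * (K * rho z powr (-b))"
      unfolding T0_fun_def norm_minus_cancel by (rule K(2)[OF _ f]) simp
    also have "\<dots> \<le> M * ((K + L) * rho z powr (-b))"
      using M L(1) by (intro mult_left_mono mult_right_mono) auto
    finally show "cmod (T0_fun h z) \<le> M * ((K + L) * rho z powr (-b))" .
    have "cmod (T0_fun h z - T0_fun h y) = cmod (cauchy_transform ?f z - cauchy_transform ?f y)"
      unfolding T0_fun_def minus_diff_minus norm_minus_cancel ..
    also have "\<dots> \<le> M * L * sqrt (cmod (z - y))"
      by (rule L(2)[OF _ f]) simp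
    also have "\<dots> \<le> M * (K + L) * sqrt (cmod (z - y))"
      using M K(1) by (intro mult_left_mono mult_right_mono) auto
    finally show "cmod (T0_fun h z - T0_fun h y) \<le> M * (K + L) * sqrt (cmod (z - y))" .
  qed (use K L in simp)
qed

lemma holder_half_isCont:
  assumes "\<And>y. cmod (f z - f y) \<le> C * sqrt (cmod (z - y))"
  shows "isCont f z"
proof -
  have "(\<lambda>y. C * sqrt (cmod (z - y))) \<midarrow>z\<rightarrow> C * sqrt (cmod (z - z))" by (intro tendsto_intros)
  then have "(\<lambda>y. C * sqrt (cmod (z - y))) \<midarrow>z\<rightarrow> 0" by simp
  then have "(\<lambda>y. f y - f z) \<midarrow>z\<rightarrow> 0"
  proof (rule Lim_null_comparison[rotated])
    show "\<forall>\<^sub>F y in at z. cmod (f y - f z) \<le> C * sqrt (cmod (z - y))"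
      by (intro always_eventually allI) (metis assms norm_minus_commute)
  qed
  then show ?thesis unfolding isCont_def by (rule LIM_zero_cancel)
qed

text \<open>As the regularisation in \<open>fixed_point_tested\<close> tends to 0, the first
  integral concentrates at \<open>a\<close> and gives \<open>pi * h a * (1 + a * cnj a)\<close>.
  Evaluating \<open>h\<close> there needs continuity, which the fixed point inherits from the
  Hoelder bound for \<open>T0_fun\<close>.\<close>

lemma fixed_point_is_eigenfun:
  assumes [measurable]: "h \<in> borel_measurable borel" and fp: "T0_fun h = h"
    and h: "\<And>z. cmod (h z) \<le> M * rho z powr (-(1/2))"
  obtains \<alpha> \<beta> where "h = eigenfun \<alpha> \<beta>"
proof -
  let ?r = "\<lambda>z. 1 + z * cnj z"
  have M: "M \<ge> 0" using h[of 0] by (simp add: rho_def) (meson norm_ge_zero order_trans)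
  have hM: "cmod (h z) \<le> M" for z
    by (rule order_trans[OF h mult_left_le[OF rho_powr_le_1 M]]) simp
  obtain K where K: "\<And>z. cmod (conj_cauchy_transform (\<lambda>x. of_real (rho x powi (-2)) * h x) z) \<le> M * K"
    using conj_cauchy_weighted_bounded hM by (metis assms(1))
  obtain L where L: "\<And>z y. cmod (T0_fun h z - T0_fun h y) \<le> M * K * L * sqrt (cmod (z - y))"
  proof -
    obtain L where "\<And>h M z y. h \<in> borel_measurable borel \<Longrightarrow>
      \<forall>x. cmod (conj_cauchy_transform (\<lambda>x. of_real (rho x powi (-2)) * h x) x) \<le> M \<Longrightarrow>
      cmod (T0_fun h z - T0_fun h y) \<le> M * L * sqrt (cmod (z - y))"
      by (rule T0_fun_bounds[of 0]) auto
    from that[OF this[OF assms(1)]] K show thesis by blast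
  qed
  have cont: "isCont h z" for z
    using L[unfolded fp] by (rule holder_half_isCont)
  \<comment> \<open>\<open>\<alpha>\<close> and \<open>\<beta>\<close> are the coefficients of
    \<open>1\<close> and \<open>cnj a\<close> on the right-hand side of the tested equation, divided
    by \<open>pi\<close>.\<close>
  define \<alpha> where "\<alpha> = 2 / pi * (\<integral>z. h z / (?r z)\<^sup>2 \<partial>lborel)"
  define \<beta> where "\<beta> = 2 / pi * (\<integral>z. h z * z / (?r z)\<^sup>2 \<partial>lborel)"
  have i3: "integrable lborel (\<lambda>z. h z * u z / (?r z)\<^sup>2)"
    if [measurable]: "u \<in> borel_measurable borel" and u: "\<And>z. cmod (u z) \<le> 1 * rho z" for u
  proof (rule Bochner_Integration.integrable_bound[OF integrable_mult_right[OF integrable_rho_powr[of 3]]])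
    show "AE z in lborel. norm (h z * u z / (?r z)\<^sup>2) \<le> norm (M * rho z powr (-3))"
    proof (rule AE_I2)
      fix z
      have "norm (h z * u z / (?r z)\<^sup>2) \<le> (M * rho z) / (rho z) ^ 4"
        unfolding rho_square_complex norm_divide norm_mult norm_power norm_of_real
        using M rho_pos[of z] u[of z] by (intro frac_le mult_mono hM) auto
      also have "\<dots> = M * rho z powr (-3)"
        using rho_pos[of z] by (simp add: powr_minus_divide power_numeral_reduce)
      finally show "norm (h z * u z / (?r z)\<^sup>2) \<le> norm (M * rho z powr (-3))" by simp
    qed
  qed simp_all
  have "h a = eigenfun \<alpha> \<beta> a" for a
  proof -
    define k where "k z = 1 + z * cnj a" for z
    define t where "t n = 1 / real (Suc n)" for n
    have t: "t n > 0" for n by (simp add: t_def)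
    define R where "R = 2 * (\<integral>z. h z * k z / (?r z)\<^sup>2 \<partial>lborel)"
    have [measurable]: "k \<in> borel_measurable borel" unfolding k_def by measurable
    let ?A = "\<lambda>n. \<integral>z. h z * k z * of_real ((t n)\<^sup>2 / ((cmod (z - a))\<^sup>2 + (t n)\<^sup>2)\<^sup>2) \<partial>lborel"
    let ?B = "\<lambda>n. \<integral>z. h z / ?r z * of_real ((t n)\<^sup>2 / ((cmod (z - a))\<^sup>2 + (t n)\<^sup>2)) \<partial>lborel"
    have eq: "?A n + ?B n = R" for n
    proof -
      interpret test_functions a "t n" by standard (rule t)
      show ?thesis
        using fixed_point_tested[OF assms(1) fp h] unfolding r_def c_def k_def R_def .
    qed
    have 1: "?A \<longlonglongrightarrow> of_real pi * (h a * k a)"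
      unfolding t_def
    proof (rule approximate_identity)
      show "isCont (\<lambda>z. h z * k z) a" unfolding k_def by (intro continuous_intros cont)
      fix z
      have "cmod (k z) = cmod ((1 + a * cnj a) + (z - a) * cnj a)" by (simp add: k_def algebra_simps)
      also have "\<dots> \<le> cmod (1 + a * cnj a) + cmod (z - a) * cmod a"
        by (metis complex_mod_cnj norm_mult norm_triangle_ineq)
      also have "\<dots> \<le> (cmod (1 + a * cnj a) + cmod a) * (1 + cmod (z - a))"
        by (simp add: algebra_simps)
      finally show "cmod (h z * k z) \<le> (M * (cmod (1 + a * cnj a) + cmod a)) * (1 + cmod (z - a))"
        unfolding norm_mult mult.assoc using M by (intro mult_mono hM) auto
    qed simp
    \<comment> \<open>This fraction has only a first power in its denominator: it stays below 1 and
      tends to 0 off \<open>a\<close>, so it does not concentrate.\<close>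
    have 2: "?B \<longlonglongrightarrow> (\<integral>z. (0 :: complex) \<partial>(lborel :: complex measure))"
    proof (rule integral_dominated_convergence)
      show "integrable lborel (\<lambda>z. M * rho z powr (-(5/2)))"
        by (intro integrable_mult_right integrable_rho_powr) simp
      have "AE z in lborel. z \<noteq> a" by (rule AE_lborel_singleton)
      then show "AE z in lborel. (\<lambda>n. h z / ?r z * of_real ((t n)\<^sup>2 / ((cmod (z - a))\<^sup>2 + (t n)\<^sup>2))) \<longlonglongrightarrow> 0"
      proof eventually_elim
        case (elim z)
        have "(\<lambda>n. h z / ?r z * of_real ((t n)\<^sup>2 / ((cmod (z - a))\<^sup>2 + (t n)\<^sup>2)))
          \<longlonglongrightarrow> h z / ?r z * of_real (0\<^sup>2 / ((cmod (z - a))\<^sup>2 + 0\<^sup>2))"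
          unfolding t_def using elim by (intro tendsto_intros lim_inverse_n'[THEN LIMSEQ_Suc]) auto
        then show ?case by simp
      qed
      show "AE z in lborel. norm (h z / ?r z * of_real ((t n)\<^sup>2 / ((cmod (z - a))\<^sup>2 + (t n)\<^sup>2))) \<le> M * rho z powr (-(5/2))" for n
      proof (rule AE_I2)
        fix z
        have "norm (h z / ?r z * of_real ((t n)\<^sup>2 / ((cmod (z - a))\<^sup>2 + (t n)\<^sup>2)))
          = (cmod (h z) * rho z powr (-2)) * ((t n)\<^sup>2 / ((cmod (z - a))\<^sup>2 + (t n)\<^sup>2))"
          unfolding rho_square_complex rho_powr_minus norm_mult norm_divide norm_of_real by simp
        also have "\<dots> \<le> ((M * rho z powr (-(1/2))) * rho z powr (-2)) * 1"
        proof (intro mult_mono h order_refl)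
          show "(t n)\<^sup>2 / ((cmod (z - a))\<^sup>2 + (t n)\<^sup>2) \<le> 1"
            using t[of n] by (subst divide_le_eq_1_pos) (auto intro: add_nonneg_pos)
        qed (use M in auto)
        also have "\<dots> = M * (rho z powr (-(1/2)) * rho z powr (-2))" by simp
        also have "rho z powr (-(1/2)) * rho z powr (-2) = rho z powr (-(5/2))"
          by (simp only: powr_add[symmetric]) simp
        finally show "norm (h z / ?r z * of_real ((t n)\<^sup>2 / ((cmod (z - a))\<^sup>2 + (t n)\<^sup>2))) \<le> M * rho z powr (-(5/2))" .
      qed
    qed simp_all
    have "(\<lambda>n. R) \<longlonglongrightarrow> of_real pi * (h a * k a) + 0"
      using tendsto_add[OF 1 2] unfolding eq by simp
    then have R: "R = of_real pi * (h a * k a)" by (simp add: LIMSEQ_const_iff)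
    have "(\<integral>z. h z * k z / (?r z)\<^sup>2 \<partial>lborel) = (\<integral>z. h z * 1 / (?r z)\<^sup>2 + cnj a * (h z * z / (?r z)\<^sup>2) \<partial>lborel)"
      by (intro Bochner_Integration.integral_cong) (auto simp: k_def add_divide_distrib algebra_simps)
    also have "\<dots> = (\<integral>z. h z * 1 / (?r z)\<^sup>2 \<partial>lborel) + (\<integral>z. cnj a * (h z * z / (?r z)\<^sup>2) \<partial>lborel)"
      using rho_ge_1 rho_ge_cmod by (intro Bochner_Integration.integral_add integrable_mult_right i3) auto
    also have "(\<integral>z. cnj a * (h z * z / (?r z)\<^sup>2) \<partial>lborel) = cnj a * (\<integral>z. h z * z / (?r z)\<^sup>2 \<partial>lborel)"
      by (rule Bochner_Integration.integral_mult_right_zero)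
    finally have "of_real pi * (\<alpha> + \<beta> * cnj a) = R"
      unfolding R_def \<alpha>_def \<beta>_def by (simp add: algebra_simps)
    then have "\<alpha> + \<beta> * cnj a = h a * k a" using R by (simp only: mult_cancel_left) simp
    then show ?thesis
      unfolding eigenfun_def by (simp add: k_def)
  qed
  then show thesis using that by blast
qed

text \<open>
  The operator is symmetric for the inner product with weight \<open>1 / rho\<^sup>2\<close>, so an eigenfunction of the
  form \<open>T x - x\<close> is orthogonal to itself.
\<close>

lemma no_jordan_block:
  assumes [measurable]: "x \<in> borel_measurable borel" and x: "\<And>z. cmod (x z) \<le> M"
    and T: "\<And>z. T0_fun x z = x z + eigenfun a b z"
  shows "a = 0 \<and> b = 0"
proof -
  let ?W = "\<lambda>z. complex_of_real (rho z powi (-2))"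
  let ?e = "eigenfun a b" and ?G = "coeigenfun a b"
  let ?C = "cmod a + cmod b"
  let ?g = "conj_cauchy_transform (\<lambda>z. ?W z * x z)"
  obtain K where K: "\<And>z. cmod (?g z) \<le> M * K"
    using conj_cauchy_weighted_bounded x by (metis assms(1))
  have bx: "cmod (?W z * x z) \<le> M * rho z powr (-2)" for z
    unfolding norm_weight_mult by (intro mult_right_mono x) simp
  have bg: "cmod (?W z * ?g z) \<le> (M * K) * rho z powr (-2)" for z
    unfolding norm_weight_mult by (intro mult_right_mono K) simp
  have be: "cmod (?W z * cnj (?e z)) \<le> ?C * rho z powr (-2)" for z
    using norm_eigenfun_le by (intro weight_decay) auto
  have bG: "cmod (?W z * cnj (?G z)) \<le> ?C * rho z powr (-2)" for z
    using norm_coeigenfun_le by (intro weight_decay) auto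
  have ce: "cauchy_transform (\<lambda>z. ?W z * cnj (?e z)) z = cnj (?G z)" for z
    using arg_cong[OF conj_cauchy_eigenfun[of a b z], of cnj] by (simp add: conj_cauchy_transform_cnj)
  have cG: "conj_cauchy_transform (\<lambda>z. ?W z * cnj (?G z)) z = - cnj (?e z)" for z
    using cauchy_coeigenfun[of a b z] by (simp add: conj_cauchy_transform_cnj)
  \<comment> \<open>Conjugation exchanges the two transforms, so \<open>ce\<close> and
    \<open>cG\<close> give the transforms of the conjugated eigenfunctions. The four minus signs,
    one from \<open>T0_fun\<close>, two from the dualities and one from \<open>cG\<close>,
    cancel.\<close>
  have "(\<integral>z. ?W z * cnj (?e z) * T0_fun x z \<partial>lborel)
    = - (\<integral>z. (?W z * cnj (?e z)) * cauchy_transform (\<lambda>z. ?W z * ?g z) z \<partial>lborel)"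
    unfolding T0_fun_def by simp
  also have "\<dots> = (\<integral>z. ?W z * ?g z * cnj (?G z) \<partial>lborel)"
    using cauchy_duality[OF _ _ bg be] unfolding ce by simp
  also have "\<dots> = (\<integral>z. ?W z * cnj (?G z) * ?g z \<partial>lborel)"
    by (simp only: mult_ac)
  also have "\<dots> = (\<integral>z. ?W z * x z * cnj (?e z) \<partial>lborel)"
    using conj_cauchy_duality[OF _ _ bx bG] unfolding cG by simp
  finally have 1: "(\<integral>z. ?W z * cnj (?e z) * T0_fun x z \<partial>lborel) = (\<integral>z. ?W z * cnj (?e z) * x z \<partial>lborel)"
    by (simp only: mult_ac)
  have int: "integrable lborel (\<lambda>z. ?W z * cnj (?e z) * y z)"
    if [measurable]: "y \<in> borel_measurable borel" and y: "\<And>z. cmod (y z) \<le> N" for y N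
  proof (rule Bochner_Integration.integrable_bound[OF integrable_mult_right[OF integrable_rho_powr[of 3]]])
    show "AE z in lborel. norm (?W z * cnj (?e z) * y z) \<le> norm ((?C * N) * rho z powr (-3))"
    proof (rule AE_I2)
      fix z
      have N: "N \<ge> 0" using y[of 0] by (meson norm_ge_zero order_trans)
      have "norm (?W z * cnj (?e z) * y z) \<le> ((?C * rho z powr (-1)) * rho z powr (-2)) * N"
        unfolding norm_mult[of "?W z * _"] norm_weight_mult complex_mod_cnj using N
        by (intro mult_mono norm_eigenfun_le y mult_nonneg_nonneg) auto
      also have "\<dots> = (?C * N) * (rho z powr (-1) * rho z powr (-2))" by (simp only: mult_ac)
      also have "rho z powr (-1) * rho z powr (-2) = rho z powr (-3)"
        by (simp only: powr_add[symmetric]) simp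
      finally show "norm (?W z * cnj (?e z) * y z) \<le> norm ((?C * N) * rho z powr (-3))" using N by simp
    qed
  qed simp_all
  have eb: "cmod (?e z) \<le> ?C" for z
    by (rule order_trans[OF norm_eigenfun_le mult_left_le[OF rho_powr_le_1]]) auto
  have ie: "integrable lborel (\<lambda>z. ?W z * cnj (?e z) * ?e z)" using eb by (intro int) auto
  have "(\<integral>z. ?W z * cnj (?e z) * T0_fun x z \<partial>lborel)
    = (\<integral>z. ?W z * cnj (?e z) * x z + ?W z * cnj (?e z) * ?e z \<partial>lborel)"
    by (simp only: T distrib_left)
  also have "\<dots> = (\<integral>z. ?W z * cnj (?e z) * x z \<partial>lborel) + (\<integral>z. ?W z * cnj (?e z) * ?e z \<partial>lborel)"
    using int[OF assms(1) x] ie by (rule Bochner_Integration.integral_add)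
  finally have 2: "(\<integral>z. ?W z * cnj (?e z) * ?e z \<partial>lborel) = 0" using 1 by simp
  have sq: "?W z * cnj (?e z) * ?e z = of_real ((cmod (?e z))\<^sup>2 / (rho z)\<^sup>2)" for z
  proof -
    have "?W z * cnj (?e z) * ?e z = (?e z * cnj (?e z)) / (1 + z * cnj z)" by (simp only: weight_eq) simp
    then show ?thesis unfolding rho_square_complex unfolding complex_norm_square[symmetric] by simp
  qed
  have "(\<integral>z. (cmod (?e z))\<^sup>2 / (rho z)\<^sup>2 \<partial>lborel) = 0"
    using 2 unfolding sq integral_complex_of_real by simp
  moreover have "integrable lborel (\<lambda>z. (cmod (?e z))\<^sup>2 / (rho z)\<^sup>2)"
    using ie unfolding sq by (simp only: complex_of_real_integrable_eq)
  ultimately have "AE z in lborel. (cmod (?e z))\<^sup>2 / (rho z)\<^sup>2 = 0"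
    using integral_nonneg_eq_0_iff_AE[of lborel "\<lambda>z. (cmod (?e z))\<^sup>2 / (rho z)\<^sup>2"] by simp
  then have "AE z in lborel. ?e z = 0"
  proof eventually_elim
    case (elim z)
    then show ?case using rho_pos[of z] by simp
  qed
  then show ?thesis by (rule eigenfun_AE_eq_0)
qed

section \<open>The operator on classes of functions\<close>

text \<open>Young's inequality with the dual exponent \<open>q\<close> splits the integrand;
  \<open>p > 2\<close> gives \<open>q < 2\<close>, so that the power \<open>q\<close> of the kernel
  is locally integrable. The resulting bound is additive rather than linear in the norm, which is
  enough for boundedness on bounded sets.\<close>

lemma Lp_inner_bound:
  assumes p: "p > 2"
  obtains K where "K \<ge> 0"
    and "\<And>h z. h \<in> borel_measurable borel \<Longrightarrow> integrable lborel (\<lambda>x. cmod (h x) powr p) \<Longrightarrow>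
      integrable lborel (\<lambda>x. of_real (rho x powi (-2)) * h x / (cnj z - cnj x))"
    and "\<And>h z. h \<in> borel_measurable borel \<Longrightarrow> integrable lborel (\<lambda>x. cmod (h x) powr p) \<Longrightarrow>
      cmod (conj_cauchy_transform (\<lambda>x. of_real (rho x powi (-2)) * h x) z) \<le> (\<integral>x. cmod (h x) powr p \<partial>lborel) + K"
proof -
  define q where "q = p / (p - 1)"
  have q: "1 < q" "q < 2" and pq: "1 / p + 1 / q = 1"
    using p by (auto simp: q_def field_simps)
  obtain K where K: "K \<ge> 0"
    "\<And>z. integrable lborel (\<lambda>x. rho x powr (-2) * cmod (z - x) powr (-q))"
    "\<And>z. (\<integral>x. rho x powr (-2) * cmod (z - x) powr (-q) \<partial>lborel) \<le> K"
    by (rule kernel_bound[of q 2]) (use q in auto)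
  have le: "cmod (of_real (rho x powi (-2)) * h x / (cnj z - cnj x))
      \<le> cmod (h x) powr p + rho x powr (-2) * cmod (z - x) powr (-q)" for h :: "complex \<Rightarrow> complex" and x z
  proof -
    have "cmod (of_real (rho x powi (-2)) * h x / (cnj z - cnj x))
      = cmod (h x) * (rho x powr (-2) * cmod (z - x) powr (-1))"
    proof -
      have "cmod (cnj z - cnj x) = cmod (z - x)" by (metis complex_cnj_diff complex_mod_cnj)
      then show ?thesis
        unfolding norm_cauchy_kernel norm_weight_mult by simp
    qed
    also have "\<dots> \<le> cmod (h x) powr p / p + (rho x powr (-2) * cmod (z - x) powr (-1)) powr q / q"
      using p q pq by (intro Youngs_inequality) auto
    also have "\<dots> \<le> cmod (h x) powr p + (rho x powr (-2) * cmod (z - x) powr (-1)) powr q"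
      using p q by (intro add_mono) (simp_all add: divide_le_eq mult_le_cancel_left1)
    also have "(rho x powr (-2) * cmod (z - x) powr (-1)) powr q = rho x powr (-(2 * q)) * cmod (z - x) powr (-q)"
      by (simp only: powr_mult powr_powr powr_ge_zero) simp
    also have "\<dots> \<le> rho x powr (-2) * cmod (z - x) powr (-q)"
      using q by (intro mult_right_mono rho_powr_mono) auto
    finally show ?thesis by simp
  qed
  show thesis
  proof (rule that[OF K(1)])
    fix h :: "complex \<Rightarrow> complex" and z
    assume [measurable]: "h \<in> borel_measurable borel" and i: "integrable lborel (\<lambda>x. cmod (h x) powr p)"
    have iG: "integrable lborel (\<lambda>x. cmod (h x) powr p + rho x powr (-2) * cmod (z - x) powr (-q))"
      by (intro Bochner_Integration.integrable_add i K)
    show int: "integrable lborel (\<lambda>x. of_real (rho x powi (-2)) * h x / (cnj z - cnj x))"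
    proof (rule Bochner_Integration.integrable_bound[OF iG])
      show "AE x in lborel. norm (of_real (rho x powi (-2)) * h x / (cnj z - cnj x))
          \<le> norm (cmod (h x) powr p + rho x powr (-2) * cmod (z - x) powr (-q))"
        using order_trans[OF le abs_ge_self] by (intro AE_I2) (simp only: real_norm_def)
    qed measurable
    have "cmod (conj_cauchy_transform (\<lambda>x. of_real (rho x powi (-2)) * h x) z)
      = 1 / pi * cmod (\<integral>x. of_real (rho x powi (-2)) * h x / (cnj z - cnj x) \<partial>lborel)"
      by (simp add: conj_cauchy_transform_def norm_mult norm_divide)
    also have "\<dots> \<le> cmod (\<integral>x. of_real (rho x powi (-2)) * h x / (cnj z - cnj x) \<partial>lborel)"
      by (rule one_div_pi_le) simp
    also have "\<dots> \<le> (\<integral>x. cmod (of_real (rho x powi (-2)) * h x / (cnj z - cnj x)) \<partial>lborel)"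
      by (rule integral_norm_bound)
    also have "\<dots> \<le> (\<integral>x. cmod (h x) powr p + rho x powr (-2) * cmod (z - x) powr (-q) \<partial>lborel)"
      by (rule integral_mono[OF integrable_norm[OF int] iG]) (rule le)
    also have "\<dots> = (\<integral>x. cmod (h x) powr p \<partial>lborel) + (\<integral>x. rho x powr (-2) * cmod (z - x) powr (-q) \<partial>lborel)"
      by (rule Bochner_Integration.integral_add[OF i K(2)])
    also have "\<dots> \<le> (\<integral>x. cmod (h x) powr p \<partial>lborel) + K"
      by (intro add_left_mono K)
    finally show "cmod (conj_cauchy_transform (\<lambda>x. of_real (rho x powi (-2)) * h x) z)
      \<le> (\<integral>x. cmod (h x) powr p \<partial>lborel) + K" .
  qed
qed

lemma integrable_decay_powr:
  fixes f :: "complex \<Rightarrow> complex"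
  assumes [measurable]: "f \<in> borel_measurable borel"
    and f: "\<And>z. cmod (f z) \<le> C * rho z powr (-b)" and p: "p > 0" "p * b > 2"
  shows "integrable lborel (\<lambda>z. cmod (f z) powr p)"
proof (rule Bochner_Integration.integrable_bound)
  have C: "C \<ge> 0" using f[of 0] by (simp add: rho_def) (meson norm_ge_zero order_trans)
  show "integrable lborel (\<lambda>z. C powr p * rho z powr (-(p * b)))"
    using p by (intro integrable_mult_right integrable_rho_powr) auto
  show "AE z in lborel. norm (cmod (f z) powr p) \<le> norm (C powr p * rho z powr (-(p * b)))"
  proof (rule AE_I2)
    fix z
    have "cmod (f z) powr p \<le> (C * rho z powr (-b)) powr p"
      using p by (intro powr_mono2 f) auto
    also have "\<dots> = C powr p * rho z powr (-(p * b))"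
      using C by (simp add: powr_mult powr_powr mult.commute)
    finally show "norm (cmod (f z) powr p) \<le> norm (C powr p * rho z powr (-(p * b)))" by simp
  qed
qed simp

lemma integrable_add_powr:
  fixes f g :: "complex \<Rightarrow> complex"
  assumes [measurable]: "f \<in> borel_measurable borel" "g \<in> borel_measurable borel"
    and i: "integrable lborel (\<lambda>z. cmod (f z) powr p)" "integrable lborel (\<lambda>z. cmod (g z) powr p)"
    and p: "p \<ge> 0"
  shows "integrable lborel (\<lambda>z. cmod (f z + g z) powr p)"
proof (rule Bochner_Integration.integrable_bound)
  show "integrable lborel (\<lambda>z. 2 powr p * (cmod (f z) powr p + cmod (g z) powr p))"
    by (intro integrable_mult_right Bochner_Integration.integrable_add i)
  show "AE z in lborel. norm (cmod (f z + g z) powr p) \<le> norm (2 powr p * (cmod (f z) powr p + cmod (g z) powr p))"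
  proof (rule AE_I2)
    fix z
    have "cmod (f z + g z) powr p \<le> (cmod (f z) + cmod (g z)) powr p"
      using p by (intro powr_mono2 norm_triangle_ineq) auto
    also have "\<dots> \<le> 2 powr p * (cmod (f z) powr p + cmod (g z) powr p)"
      using p by (intro powr_add_le) auto
    finally show "norm (cmod (f z + g z) powr p) \<le> norm (2 powr p * (cmod (f z) powr p + cmod (g z) powr p))" by simp
  qed
qed simp

text \<open>The pointwise half of the Ascoli argument. Dominated convergence later turns pointwise
  convergence into convergence in norm.\<close>

lemma convergent_of_dense_equicontinuous:
  fixes F :: "nat \<Rightarrow> complex \<Rightarrow> complex"
  assumes D: "\<And>X. open X \<Longrightarrow> X \<noteq> {} \<Longrightarrow> \<exists>d\<in>D. d \<in> X"
    and conv: "\<And>d. d \<in> D \<Longrightarrow> convergent (\<lambda>n. F n d)"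
    and eq: "\<And>n z y. cmod (F n z - F n y) \<le> C * sqrt (cmod (z - y))"
  shows "convergent (\<lambda>n. F n z)"
proof (rule Cauchy_convergent, rule metric_CauchyI)
  fix e :: real assume e: "e > 0"
  define g where "g y = C * sqrt (cmod (z - y))" for y
  have "g \<midarrow>z\<rightarrow> g z" unfolding g_def by (intro tendsto_intros)
  then have "(g \<longlongrightarrow> g z) (nhds z)" by (simp only: tendsto_at_iff_tendsto_nhds)
  then have "\<forall>\<^sub>F y in nhds z. g y < e / 3"
    by (rule order_tendstoD(2)) (use e in \<open>simp add: g_def\<close>)
  then have "\<forall>\<^sub>F y in nhds z. C * sqrt (cmod (z - y)) < e / 3" by (simp only: g_def)
  then obtain X where X: "open X" "z \<in> X" "\<And>y. y \<in> X \<Longrightarrow> C * sqrt (cmod (z - y)) < e / 3"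
    unfolding eventually_nhds by blast
  then obtain d where d: "d \<in> D" "C * sqrt (cmod (z - d)) < e / 3" using D[of X] by blast
  from conv[OF d(1)] have "Cauchy (\<lambda>n. F n d)" by (rule convergent_Cauchy)
  then obtain N where N: "\<And>m n. m \<ge> N \<Longrightarrow> n \<ge> N \<Longrightarrow> dist (F m d) (F n d) < e / 3"
    using e unfolding Cauchy_def by (metis divide_pos_pos zero_less_numeral)
  show "\<exists>M. \<forall>m\<ge>M. \<forall>n\<ge>M. dist (F m z) (F n z) < e"
  proof (intro exI[of _ N] allI impI)
    fix m n assume mn: "N \<le> m" "N \<le> n"
    have 1: "dist (F m z) (F m d) < e / 3" "dist (F n z) (F n d) < e / 3"
      using eq[of _ z d] d(2) unfolding dist_norm by (meson le_less_trans)+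
    have "dist (F m z) (F n z) \<le> dist (F m z) (F m d) + dist (F m d) (F n z)"
      by (rule dist_triangle)
    moreover have "dist (F m d) (F n z) \<le> dist (F m d) (F n d) + dist (F n d) (F n z)"
      by (rule dist_triangle)
    ultimately show "dist (F m z) (F n z) < e"
      using 1 N[OF mn] by (simp add: dist_commute[of "F n d"])
  qed
qed

section \<open>Passage between classes and representatives\<close>

lemma ae_eq_refl: "ae_eq f f \<longleftrightarrow> f \<in> borel_measurable borel"
  by (simp add: ae_eq_def)

lemma mclass_rep:
  obtains f where "f \<in> borel_measurable borel" "x = abs_mclass f"
  using Quotient_rep_reflp[OF Quotient_mclass, of x] Quotient_abs_rep[OF Quotient_mclass, of x]
  by (metis ae_eq_refl)

lemma abs_mclass_eq_iff:
  assumes "f \<in> borel_measurable borel" "g \<in> borel_measurable borel"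
  shows "abs_mclass f = abs_mclass g \<longleftrightarrow> (AE z in lborel. f z = g z)"
  using Quotient_rel[OF Quotient_mclass, of f g] assms by (auto simp: ae_eq_refl) (auto simp: ae_eq_def)

lemma abs_mclass_add_diff:
  assumes "f \<in> borel_measurable borel" "g \<in> borel_measurable borel"
  shows "abs_mclass f + abs_mclass g = abs_mclass (\<lambda>z. f z + g z)"
    and "abs_mclass f - abs_mclass g = abs_mclass (\<lambda>z. f z - g z)"
  using assms by (simp_all add: plus_mclass.abs_eq minus_mclass.abs_eq ae_eq_refl)

lemma abs_mclass_simps:
  assumes "f \<in> borel_measurable borel"
  shows "scale_mclass k (abs_mclass f) = abs_mclass (\<lambda>z. k * f z)"
    and "T0 (abs_mclass f) = abs_mclass (T0_fun f)"
    and "abs_mclass f \<in> Lp p \<longleftrightarrow> integrable lborel (\<lambda>z. cmod (f z) powr p)"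
    and "Lp_norm p (abs_mclass f) = (\<integral>z. cmod (f z) powr p \<partial>lborel) powr (1 / p)"
  using assms
  by (simp_all add: scale_mclass.abs_eq T0.abs_eq in_Lp.abs_eq Lp_norm.abs_eq Lp_def ae_eq_refl)

lemmas mclass_abs_simps = abs_mclass_add_diff abs_mclass_simps

lemma zero_mclass_abs: "0 = abs_mclass (\<lambda>_. 0)"
  by (simp add: zero_mclass_def)

lemma T0_fun_Lp:
  assumes p: "p > 2"
  obtains b K where "K \<ge> 0" "p * b > 2"
    and "\<And>f M z. f \<in> borel_measurable borel \<Longrightarrow> integrable lborel (\<lambda>z. cmod (f z) powr p) \<Longrightarrow>
      (\<integral>z. cmod (f z) powr p \<partial>lborel) \<le> M \<Longrightarrow> cmod (T0_fun f z) \<le> (M + K) * (K * rho z powr (-b))"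
    and "\<And>f M z y. f \<in> borel_measurable borel \<Longrightarrow> integrable lborel (\<lambda>z. cmod (f z) powr p) \<Longrightarrow>
      (\<integral>z. cmod (f z) powr p \<partial>lborel) \<le> M \<Longrightarrow>
      cmod (T0_fun f z - T0_fun f y) \<le> (M + K) * K * sqrt (cmod (z - y))"
    and "b \<ge> 1 / 2"
proof -
  \<comment> \<open>The exponent must lie between \<open>2 / p\<close>, for integrability of the
    \<open>p\<close>-th power, and 1, the limit of the decay of Cauchy transforms;
    \<open>p > 2\<close> leaves room, and the midpoint is taken. The maximum with 1/2 guarantees the
    decay that \<open>fixed_point_is_eigenfun\<close> asks for.\<close>
  define b where "b = max (1 / 2) ((2 / p + 1) / 2)"
  have b: "0 \<le> b" "b < 1" "b \<ge> 1 / 2" using p by (auto simp: b_def)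
  have "p * ((2 / p + 1) / 2) > 2" using p by (simp add: field_simps)
  also have "p * ((2 / p + 1) / 2) \<le> p * b" using p by (intro mult_left_mono) (auto simp: b_def)
  finally have pb: "p * b > 2" .
  obtain K1 where K1: "K1 \<ge> 0"
      "\<And>h z. h \<in> borel_measurable borel \<Longrightarrow> integrable lborel (\<lambda>x. cmod (h x) powr p) \<Longrightarrow>
        integrable lborel (\<lambda>x. of_real (rho x powi (-2)) * h x / (cnj z - cnj x))"
      "\<And>h z. h \<in> borel_measurable borel \<Longrightarrow> integrable lborel (\<lambda>x. cmod (h x) powr p) \<Longrightarrow>
      cmod (conj_cauchy_transform (\<lambda>x. of_real (rho x powi (-2)) * h x) z) \<le> (\<integral>x. cmod (h x) powr p \<partial>lborel) + K1"
    by (rule Lp_inner_bound[OF p]) (rule that; assumption)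
  obtain K2 where K2: "K2 \<ge> 0"
    "\<And>h M z. h \<in> borel_measurable borel \<Longrightarrow>
      \<forall>x. cmod (conj_cauchy_transform (\<lambda>x. of_real (rho x powi (-2)) * h x) x) \<le> M \<Longrightarrow>
      cmod (T0_fun h z) \<le> M * (K2 * rho z powr (-b))"
    "\<And>h M z y. h \<in> borel_measurable borel \<Longrightarrow>
      \<forall>x. cmod (conj_cauchy_transform (\<lambda>x. of_real (rho x powi (-2)) * h x) x) \<le> M \<Longrightarrow>
      cmod (T0_fun h z - T0_fun h y) \<le> M * K2 * sqrt (cmod (z - y))"
    by (rule T0_fun_bounds[OF b(1,2)]) (rule that; assumption)
  show thesis
  proof (rule that[of "K1 + K2" b])
    fix f :: "complex \<Rightarrow> complex" and M :: real and z y
    assume f: "f \<in> borel_measurable borel" "integrable lborel (\<lambda>z. cmod (f z) powr p)"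
      and M: "(\<integral>z. cmod (f z) powr p \<partial>lborel) \<le> M"
    have M0: "M \<ge> 0" by (rule order_trans[OF integral_nonneg_AE M]) simp
    have g: "\<forall>x. cmod (conj_cauchy_transform (\<lambda>x. of_real (rho x powi (-2)) * f x) x) \<le> M + (K1 + K2)"
    proof
      fix x
      show "cmod (conj_cauchy_transform (\<lambda>x. of_real (rho x powi (-2)) * f x) x) \<le> M + (K1 + K2)"
        using K1(3)[OF f, of x] M K2(1) by linarith
    qed
    have "cmod (T0_fun f z) \<le> (M + (K1 + K2)) * (K2 * rho z powr (-b))" by (rule K2(2)[OF f(1) g])
    also have "\<dots> \<le> (M + (K1 + K2)) * ((K1 + K2) * rho z powr (-b))"
      using K1(1) K2(1) M0 by (intro mult_left_mono mult_right_mono) auto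
    finally show "cmod (T0_fun f z) \<le> (M + (K1 + K2)) * ((K1 + K2) * rho z powr (-b))" .
    have "cmod (T0_fun f z - T0_fun f y) \<le> (M + (K1 + K2)) * K2 * sqrt (cmod (z - y))" by (rule K2(3)[OF f(1) g])
    also have "\<dots> \<le> (M + (K1 + K2)) * (K1 + K2) * sqrt (cmod (z - y))"
      using K1(1) K2(1) M0 by (intro mult_left_mono mult_right_mono) auto
    finally show "cmod (T0_fun f z - T0_fun f y) \<le> (M + (K1 + K2)) * (K1 + K2) * sqrt (cmod (z - y))" .
  qed (use K1 K2 b pb in auto)
qed

text \<open>Additivity is not automatic, because the integral of a nonintegrable function defaults
  to 0. Integrability of the \<open>p\<close>-th powers ensures that the inner and the outer
  integrals all exist.\<close>

lemma T0_fun_add: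
  assumes p: "p > 2"
    and f [measurable]: "f \<in> borel_measurable borel" and fi: "integrable lborel (\<lambda>z. cmod (f z) powr p)"
    and g [measurable]: "g \<in> borel_measurable borel" and gi: "integrable lborel (\<lambda>z. cmod (g z) powr p)"
  shows "T0_fun (\<lambda>z. f z + g z) = (\<lambda>z. T0_fun f z + T0_fun g z)"
proof -
  let ?W = "\<lambda>z. complex_of_real (rho z powi (-2))"
  let ?C = "\<lambda>f. conj_cauchy_transform (\<lambda>x. ?W x * f x)"
  obtain K where "K \<ge> 0" and K: "\<And>h z. h \<in> borel_measurable borel \<Longrightarrow> integrable lborel (\<lambda>x. cmod (h x) powr p) \<Longrightarrow>
      integrable lborel (\<lambda>x. ?W x * h x / (cnj z - cnj x))"
    "\<And>h z. h \<in> borel_measurable borel \<Longrightarrow> integrable lborel (\<lambda>x. cmod (h x) powr p) \<Longrightarrow>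
      cmod (?C h z) \<le> (\<integral>x. cmod (h x) powr p \<partial>lborel) + K"
    by (rule Lp_inner_bound[OF p]) (rule that; assumption)
  have 1: "?C (\<lambda>z. f z + g z) z = ?C f z + ?C g z" for z
    unfolding conj_cauchy_transform_def distrib_left add_divide_distrib
    by (simp only: Bochner_Integration.integral_add[OF K(1)[OF f fi] K(1)[OF g gi]] distrib_left)
  have i: "integrable lborel (\<lambda>x. ?W x * ?C h x / (z - x))"
    if [measurable]: "h \<in> borel_measurable borel" and "integrable lborel (\<lambda>z. cmod (h z) powr p)" for h z
  proof (rule cauchy_integrable)
    show "cmod (?W x * ?C h x) \<le> ((\<integral>x. cmod (h x) powr p \<partial>lborel) + K) * rho x powr (-2)" for x
      unfolding norm_weight_mult using that by (intro mult_right_mono K(2)) auto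
  qed simp
  have 2: "cauchy_transform (\<lambda>x. ?W x * (?C f x + ?C g x)) z
      = cauchy_transform (\<lambda>x. ?W x * ?C f x) z + cauchy_transform (\<lambda>x. ?W x * ?C g x) z" for z
    unfolding cauchy_transform_def distrib_left add_divide_distrib
    by (simp only: Bochner_Integration.integral_add[OF i[OF f fi] i[OF g gi]] distrib_left)
  show ?thesis
    unfolding T0_fun_def 1 2 by simp
qed

text \<open>No integrability is assumed: multiplication by a constant is compatible with the default
  value 0 of the integral.\<close>

lemma T0_fun_scale: "T0_fun (\<lambda>z. k * f z) = (\<lambda>z. k * T0_fun f z)"
proof -
  have 1: "conj_cauchy_transform (\<lambda>x. k * f x) z = k * conj_cauchy_transform f z" for f z
    unfolding conj_cauchy_transform_def times_divide_eq_right[symmetric]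
    by (simp only: Bochner_Integration.integral_mult_right_zero mult.left_commute)
  have 2: "cauchy_transform (\<lambda>x. k * f x) z = k * cauchy_transform f z" for f z
    unfolding cauchy_transform_def times_divide_eq_right[symmetric]
    by (simp only: Bochner_Integration.integral_mult_right_zero mult.left_commute)
  show ?thesis
    unfolding T0_fun_def mult.left_commute[of _ k] 1 2 by simp
qed

lemma T0_in_Lp:
  assumes p: "p > 2" and x: "x \<in> Lp p"
  shows "T0 x \<in> Lp p"
proof -
  obtain f where f: "f \<in> borel_measurable borel" "x = abs_mclass f" by (rule mclass_rep)
  obtain b K where K: "K \<ge> 0" "p * b > 2"
    "\<And>f M z. f \<in> borel_measurable borel \<Longrightarrow> integrable lborel (\<lambda>z. cmod (f z) powr p) \<Longrightarrow>
      (\<integral>z. cmod (f z) powr p \<partial>lborel) \<le> M \<Longrightarrow> cmod (T0_fun f z) \<le> (M + K) * (K * rho z powr (-b))"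
    "\<And>f M z y. f \<in> borel_measurable borel \<Longrightarrow> integrable lborel (\<lambda>z. cmod (f z) powr p) \<Longrightarrow>
      (\<integral>z. cmod (f z) powr p \<partial>lborel) \<le> M \<Longrightarrow>
      cmod (T0_fun f z - T0_fun f y) \<le> (M + K) * K * sqrt (cmod (z - y))"
    "b \<ge> 1 / 2"
    by (rule T0_fun_Lp[OF p]) (rule that; assumption)
  have fi: "integrable lborel (\<lambda>z. cmod (f z) powr p)"
    using x f by (simp add: mclass_abs_simps)
  have "integrable lborel (\<lambda>z. cmod (T0_fun f z) powr p)"
  proof (rule integrable_decay_powr[OF _ _ _ K(2)])
    show "cmod (T0_fun f z) \<le> (((\<integral>z. cmod (f z) powr p \<partial>lborel) + K) * K) * rho z powr (-b)" for z
      using K(3)[OF f(1) fi order_refl, of z] by (simp only: mult.assoc)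
  qed (use f p in auto)
  then show ?thesis using f by (simp add: mclass_abs_simps)
qed

lemma Lp_add: "p \<ge> 0 \<Longrightarrow> x \<in> Lp p \<Longrightarrow> y \<in> Lp p \<Longrightarrow> x + y \<in> Lp p"
  by (rule mclass_rep[of x], rule mclass_rep[of y]) (simp add: mclass_abs_simps integrable_add_powr)

lemma Lp_scale: "x \<in> Lp p \<Longrightarrow> scale_mclass k x \<in> Lp p"
  by (rule mclass_rep[of x]) (simp add: mclass_abs_simps norm_mult powr_mult)

lemma T0_add:
  assumes "p > 2" "x \<in> Lp p" "y \<in> Lp p"
  shows "T0 (x + y) = T0 x + T0 y"
proof -
  obtain f where f: "f \<in> borel_measurable borel" "x = abs_mclass f" by (rule mclass_rep)
  obtain g where g: "g \<in> borel_measurable borel" "y = abs_mclass g" by (rule mclass_rep)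
  from assms f g show ?thesis by (simp add: mclass_abs_simps T0_fun_add[of p f g])
qed

lemma T0_scale: "T0 (scale_mclass k x) = scale_mclass k (T0 x)"
  by (rule mclass_rep[of x]) (simp add: mclass_abs_simps T0_fun_scale)

section \<open>Compactness\<close>

lemma T0_compact_sequence:
  fixes X :: "nat \<Rightarrow> mclass"
  assumes p: "p > 2" and X: "\<And>n. X n \<in> Lp p" and bd: "bounded (range (\<lambda>n. Lp_norm p (X n)))"
  shows "\<exists>y\<in>Lp p. \<exists>r. strict_mono r \<and> (\<lambda>n. Lp_norm p (T0 (X (r n)) - y)) \<longlonglongrightarrow> 0"
proof -
  have "\<exists>f. f \<in> borel_measurable borel \<and> X n = abs_mclass f" for n by (rule mclass_rep[of "X n"]) blast
  then obtain f where f [measurable]: "\<And>n. f n \<in> borel_measurable borel" and Xf: "\<And>n. X n = abs_mclass (f n)"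
    by metis
  have fi: "integrable lborel (\<lambda>z. cmod (f n z) powr p)" for n
    using X[of n] by (simp add: Xf mclass_abs_simps f)
  let ?I = "\<lambda>n. \<integral>z. cmod (f n z) powr p \<partial>lborel"
  obtain B where B: "\<And>n. \<bar>Lp_norm p (X n)\<bar> \<le> B" using bd by (auto simp: bounded_iff)
  \<comment> \<open>The estimates for \<open>T0_fun\<close> are in terms of the \<open>p\<close>-th
    power of the norm, so the bound on the norms is converted first.\<close>
  have I: "?I n \<le> B powr p" for n
  proof -
    have n: "?I n \<ge> 0" by (intro integral_nonneg_AE) simp
    have "?I n powr (1 / p) \<le> B" using B[of n] by (simp add: Xf mclass_abs_simps f)
    then have "(?I n powr (1 / p)) powr p \<le> B powr p" using p by (intro powr_mono2) auto
    then show ?thesis using n p by (simp add: powr_powr)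
  qed
  obtain b K where K: "K \<ge> 0" "p * b > 2"
    "\<And>f M z. f \<in> borel_measurable borel \<Longrightarrow> integrable lborel (\<lambda>z. cmod (f z) powr p) \<Longrightarrow>
      (\<integral>z. cmod (f z) powr p \<partial>lborel) \<le> M \<Longrightarrow> cmod (T0_fun f z) \<le> (M + K) * (K * rho z powr (-b))"
    "\<And>f M z y. f \<in> borel_measurable borel \<Longrightarrow> integrable lborel (\<lambda>z. cmod (f z) powr p) \<Longrightarrow>
      (\<integral>z. cmod (f z) powr p \<partial>lborel) \<le> M \<Longrightarrow>
      cmod (T0_fun f z - T0_fun f y) \<le> (M + K) * K * sqrt (cmod (z - y))"
    "b \<ge> 1 / 2"
    by (rule T0_fun_Lp[OF p]) (rule that; assumption)
  define C where "C = (B powr p + K) * K"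
  have C: "C \<ge> 0" using K(1) by (simp add: C_def)
  define F where "F n = T0_fun (f n)" for n
  have [measurable]: "F n \<in> borel_measurable borel" for n unfolding F_def by measurable
  have Fle: "cmod (F n z) \<le> C * rho z powr (-b)" for n z
    using K(3)[OF f fi I, of n z] by (simp add: F_def C_def mult.assoc)
  have Feq: "cmod (F n z - F n y) \<le> C * sqrt (cmod (z - y))" for n z y
    using K(4)[OF f fi I, of n z y] by (simp add: F_def C_def)
  obtain D :: "complex set" where D: "countable D" "\<And>X. open X \<Longrightarrow> X \<noteq> {} \<Longrightarrow> \<exists>d\<in>D. d \<in> X"
    using countable_dense_exists by blast
  have FC: "cmod (F n z) \<le> C" for n z
    by (rule order_trans[OF Fle mult_left_le[OF rho_powr_le_1 C]]) (use K in simp)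
  \<comment> \<open>Diagonal extraction over a countable dense set; the uniform Hoelder bound then
    carries convergence to every point.\<close>
  obtain r :: "nat \<Rightarrow> nat" where r: "strict_mono r" "\<And>d. d \<in> D \<Longrightarrow> \<exists>l. (\<lambda>n. F (r n) d) \<longlonglongrightarrow> l"
    using function_convergent_subsequence[OF D(1), of F C] FC by blast
  have conv: "convergent (\<lambda>n. F (r n) z)" for z
    by (rule convergent_of_dense_equicontinuous[OF D(2), of "\<lambda>n. F (r n)"])
       (use r(2) Feq in \<open>auto simp: convergent_def\<close>)
  define y where "y z = lim (\<lambda>n. F (r n) z)" for z
  have lim: "(\<lambda>n. F (r n) z) \<longlonglongrightarrow> y z" for z
    using conv[of z] by (simp add: y_def convergent_LIMSEQ_iff)
  have [measurable]: "y \<in> borel_measurable borel"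
    by (rule borel_measurable_LIMSEQ_metric[of "\<lambda>n. F (r n)"]) (use lim in auto)
  have yle: "cmod (y z) \<le> C * rho z powr (-b)" for z
    by (rule Lim_norm_ubound[OF _ lim]) (use Fle in auto)
  have dle: "cmod (F n z - y z) \<le> (2 * C) * rho z powr (-b)" for n z
    using norm_triangle_ineq4[of "F n z" "y z"] Fle[of n z] yle[of z] by linarith
  have int0: "(\<lambda>n. \<integral>z. cmod (F (r n) z - y z) powr p \<partial>lborel) \<longlonglongrightarrow> (\<integral>z. 0 \<partial>(lborel :: complex measure))"
  proof (rule integral_dominated_convergence)
    \<comment> \<open>The dominating function is written as the norm of a complex function to fit
      \<open>integrable_decay_powr\<close>; its integrability is \<open>p * b > 2\<close>.\<close>
    show "integrable lborel (\<lambda>z. cmod (of_real ((2 * C) * rho z powr (-b))) powr p)"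
      by (rule integrable_decay_powr[of _ "2 * C" b]) (use p K C in \<open>auto simp: norm_mult abs_mult\<close>)
    show "AE z in lborel. (\<lambda>n. cmod (F (r n) z - y z) powr p) \<longlonglongrightarrow> 0"
    proof (rule AE_I2)
      fix z
      have "(\<lambda>n. cmod (F (r n) z - y z)) \<longlonglongrightarrow> 0"
        using lim[of z] by (intro tendsto_norm_zero LIM_zero)
      then show "(\<lambda>n. cmod (F (r n) z - y z) powr p) \<longlonglongrightarrow> 0"
        by (rule tendsto_zero_powrI[OF _ tendsto_const]) (use p in auto)
    qed
    show "AE z in lborel. norm (cmod (F (r n) z - y z) powr p) \<le> cmod (of_real ((2 * C) * rho z powr (-b))) powr p" for n
    proof (rule AE_I2)
      fix z
      have "cmod (F (r n) z - y z) powr p \<le> cmod (of_real ((2 * C) * rho z powr (-b))) powr p"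
        using p dle[of "r n" z] C by (intro powr_mono2) (auto simp: abs_mult norm_mult)
      then show "norm (cmod (F (r n) z - y z) powr p) \<le> cmod (of_real ((2 * C) * rho z powr (-b))) powr p" by simp
    qed
  qed simp_all
  have "(\<lambda>n. (\<integral>z. cmod (F (r n) z - y z) powr p \<partial>lborel) powr (1 / p)) \<longlonglongrightarrow> 0"
    by (rule tendsto_zero_powrI[OF _ tendsto_const]) (use int0 p in \<open>auto intro!: always_eventually integral_nonneg_AE\<close>)
  then have "(\<lambda>n. Lp_norm p (T0 (X (r n)) - abs_mclass y)) \<longlonglongrightarrow> 0"
    by (simp add: Xf mclass_abs_simps F_def)
  moreover have "abs_mclass y \<in> Lp p"
    using integrable_decay_powr[OF _ yle _ K(2)] p by (simp add: mclass_abs_simps)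
  ultimately show ?thesis using r(1) by blast
qed

lemma T0_compact: "p > 2 \<Longrightarrow> mclass.compact_operator_on (Lp p) (Lp_norm p) T0"
  unfolding mclass.compact_operator_on_def
  by (auto intro: T0_in_Lp T0_add T0_scale T0_compact_sequence)

section \<open>The eigenspace for the eigenvalue 1\<close>

lemma T0_fun_cong_AE:
  assumes f [measurable]: "f \<in> borel_measurable borel" and g [measurable]: "g \<in> borel_measurable borel"
    and eq: "AE z in lborel. f z = g z"
  shows "T0_fun f = T0_fun g"
proof -
  have "conj_cauchy_transform (\<lambda>x. of_real (rho x powi (-2)) * f x) = conj_cauchy_transform (\<lambda>x. of_real (rho x powi (-2)) * g x)"
    by (rule conj_cauchy_transform_cong_AE) (measurable, use eq in auto)
  then show ?thesis by (simp add: T0_fun_def)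
qed

lemma eigenfun_in_Lp: "p > 2 \<Longrightarrow> abs_mclass (eigenfun a b) \<in> Lp p"
  using integrable_decay_powr[OF _ norm_eigenfun_le, of a b p] by (simp add: abs_mclass_simps)

lemma T0_eigenfun: "T0 (abs_mclass (eigenfun a b)) = abs_mclass (eigenfun a b)"
  by (simp add: abs_mclass_simps T0_fun_eigenfun)

lemma T0_eigenspace:
  assumes p: "p > 2"
  shows "mclass.eigenspace (Lp p) T0 1 = range (\<lambda>(a, b). abs_mclass (eigenfun a b))"
proof (intro equalityI subsetI)
  fix x assume "x \<in> range (\<lambda>(a, b). abs_mclass (eigenfun a b))"
  then show "x \<in> mclass.eigenspace (Lp p) T0 1"
    using p by (auto simp: mclass.eigenspace_def T0_eigenfun eigenfun_in_Lp)
next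
  fix x assume "x \<in> mclass.eigenspace (Lp p) T0 1"
  then have x: "x \<in> Lp p" "T0 x = x" by (auto simp: mclass.eigenspace_def)
  obtain f where f [measurable]: "f \<in> borel_measurable borel" and xf: "x = abs_mclass f" by (rule mclass_rep)
  have fi: "integrable lborel (\<lambda>z. cmod (f z) powr p)" using x f by (simp add: xf abs_mclass_simps)
  have ae: "AE z in lborel. T0_fun f z = f z"
    using x(2) f by (simp add: xf abs_mclass_simps abs_mclass_eq_iff)
  \<comment> \<open>\<open>f\<close> is fixed only almost everywhere. Its image represents the same
    class, is fixed at every point because \<open>T0_fun\<close> ignores null sets, and has the
    decay of a transform.\<close>
  define h where "h = T0_fun f"
  have [measurable]: "h \<in> borel_measurable borel" by (simp add: h_def)
  have fp: "T0_fun h = h"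
    unfolding h_def by (rule T0_fun_cong_AE) (use ae in simp_all)
  obtain b K where K: "K \<ge> 0" "p * b > 2"
    "\<And>f M z. f \<in> borel_measurable borel \<Longrightarrow> integrable lborel (\<lambda>z. cmod (f z) powr p) \<Longrightarrow>
      (\<integral>z. cmod (f z) powr p \<partial>lborel) \<le> M \<Longrightarrow> cmod (T0_fun f z) \<le> (M + K) * (K * rho z powr (-b))"
    "\<And>f M z y. f \<in> borel_measurable borel \<Longrightarrow> integrable lborel (\<lambda>z. cmod (f z) powr p) \<Longrightarrow>
      (\<integral>z. cmod (f z) powr p \<partial>lborel) \<le> M \<Longrightarrow>
      cmod (T0_fun f z - T0_fun f y) \<le> (M + K) * K * sqrt (cmod (z - y))"
    "b \<ge> 1 / 2"
    by (rule T0_fun_Lp[OF p]) (rule that; assumption)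
  let ?M = "\<integral>z. cmod (f z) powr p \<partial>lborel"
  have M: "?M \<ge> 0" by (intro integral_nonneg_AE) simp
  have hle: "cmod (h z) \<le> ((?M + K) * K) * rho z powr (-(1/2))" for z
  proof -
    have "cmod (h z) \<le> (?M + K) * (K * rho z powr (-b))"
      unfolding h_def by (rule K(3)[OF f fi order_refl])
    also have "\<dots> \<le> (?M + K) * (K * rho z powr (-(1/2)))"
      using M K(1,5) by (intro mult_left_mono rho_powr_mono) auto
    finally show ?thesis by (simp only: mult.assoc)
  qed
  obtain \<alpha> \<beta> where "h = eigenfun \<alpha> \<beta>"
    using fixed_point_is_eigenfun[OF _ fp hle] by auto
  moreover have "x = abs_mclass h" using x(2) f by (simp add: xf abs_mclass_simps h_def)
  ultimately show "x \<in> range (\<lambda>(a, b). abs_mclass (eigenfun a b))" by auto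
qed

lemma abs_mclass_eigenfun_eq_0_iff: "abs_mclass (eigenfun a b) = 0 \<longleftrightarrow> a = 0 \<and> b = 0"
  unfolding zero_mclass_abs
  using eigenfun_AE_eq_0[of a b] by (subst abs_mclass_eq_iff) (auto simp: eigenfun_def[of 0 0])

lemma abs_mclass_eigenfun:
  "abs_mclass (eigenfun a b)
    = scale_mclass a (abs_mclass (eigenfun 1 0)) + scale_mclass b (abs_mclass (eigenfun 0 1))"
proof -
  have "eigenfun a b = (\<lambda>z. a * eigenfun 1 0 z + b * eigenfun 0 1 z)"
    by (auto simp: eigenfun_def add_divide_distrib)
  then show ?thesis by (simp add: mclass_abs_simps)
qed

lemma dim_eigenspace:
  assumes p: "p > 2"
  shows "mclass.dim (mclass.eigenspace (Lp p) T0 1) = 2"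
proof -
  let ?e = "abs_mclass (eigenfun 1 0)" and ?f = "abs_mclass (eigenfun 0 1)"
  have ne: "?e \<notin> mclass.span {?f}"
  proof
    assume "?e \<in> mclass.span {?f}"
    then obtain k where "?e = scale_mclass k ?f" by (auto simp: mclass.span_singleton)
    then have "scale_mclass 1 ?e + scale_mclass (-k) ?f = 0" by simp
    then have "abs_mclass (eigenfun 1 (-k)) = 0" by (simp only: abs_mclass_eigenfun[of 1 "-k", symmetric])
    then show False by (simp add: abs_mclass_eigenfun_eq_0_iff)
  qed
  moreover have "?f \<noteq> 0" by (simp add: abs_mclass_eigenfun_eq_0_iff)
  ultimately have "mclass.independent {?e, ?f}" and "?e \<noteq> ?f"
    by (auto simp: mclass.independent_insert mclass.span_base)
  show ?thesis
  proof (rule mclass.dim_unique)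
    show "{?e, ?f} \<subseteq> mclass.eigenspace (Lp p) T0 1" unfolding T0_eigenspace[OF p] by auto
    show "mclass.eigenspace (Lp p) T0 1 \<subseteq> mclass.span {?e, ?f}"
    proof
      fix x assume "x \<in> mclass.eigenspace (Lp p) T0 1"
      then obtain a b where "x = abs_mclass (eigenfun a b)" unfolding T0_eigenspace[OF p] by auto
      then show "x \<in> mclass.span {?e, ?f}"
        unfolding abs_mclass_eigenfun[of a b]
        by (simp only:) (intro mclass.span_add mclass.span_scale mclass.span_base; simp)
    qed
    show "card {?e, ?f} = 2" using \<open>?e \<noteq> ?f\<close> by simp
  qed fact
qed

text \<open>Excludes Jordan chains of length two; longer chains reduce to these by
  induction.\<close>

lemma T0_minus_id_square:
  assumes p: "p > 2" and x: "x \<in> Lp p" and e: "T0 x - x \<in> mclass.eigenspace (Lp p) T0 1"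
  shows "T0 x = x"
proof -
  obtain a b where ab: "T0 x - x = abs_mclass (eigenfun a b)"
    using e unfolding T0_eigenspace[OF p] by auto
  obtain f where f [measurable]: "f \<in> borel_measurable borel" and xf: "x = abs_mclass f" by (rule mclass_rep)
  have fi: "integrable lborel (\<lambda>z. cmod (f z) powr p)" using x f by (simp add: xf abs_mclass_simps)
  have ae: "AE z in lborel. T0_fun f z - f z = eigenfun a b z"
    using ab f by (simp add: xf mclass_abs_simps abs_mclass_eq_iff)
  \<comment> \<open>A representative of \<open>x\<close> for which the relation of the chain holds
    at every point, and which is bounded as a difference of bounded functions;
    \<open>no_jordan_block\<close> needs both.\<close>
  define h where "h z = T0_fun f z - eigenfun a b z" for z
  have [measurable]: "h \<in> borel_measurable borel" unfolding h_def by measurable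
  have "AE z in lborel. h z = f z"
    using ae by eventually_elim (simp add: h_def algebra_simps)
  then have "T0_fun h = T0_fun f" by (intro T0_fun_cong_AE) auto
  then have T: "T0_fun h z = h z + eigenfun a b z" for z by (simp add: h_def)
  obtain c K where K: "K \<ge> 0" "p * c > 2"
    "\<And>f M z. f \<in> borel_measurable borel \<Longrightarrow> integrable lborel (\<lambda>z. cmod (f z) powr p) \<Longrightarrow>
      (\<integral>z. cmod (f z) powr p \<partial>lborel) \<le> M \<Longrightarrow> cmod (T0_fun f z) \<le> (M + K) * (K * rho z powr (-c))"
    "\<And>f M z y. f \<in> borel_measurable borel \<Longrightarrow> integrable lborel (\<lambda>z. cmod (f z) powr p) \<Longrightarrow>
      (\<integral>z. cmod (f z) powr p \<partial>lborel) \<le> M \<Longrightarrow>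
      cmod (T0_fun f z - T0_fun f y) \<le> (M + K) * K * sqrt (cmod (z - y))"
    "c \<ge> 1 / 2"
    by (rule T0_fun_Lp[OF p]) (rule that; assumption)
  let ?M = "\<integral>z. cmod (f z) powr p \<partial>lborel"
  have M: "?M \<ge> 0" by (intro integral_nonneg_AE) simp
  have hle: "cmod (h z) \<le> (?M + K) * K + (cmod a + cmod b)" for z
  proof -
    have "cmod (T0_fun f z) \<le> (?M + K) * (K * rho z powr (-c))"
      by (rule K(3)[OF f fi order_refl])
    also have "\<dots> \<le> (?M + K) * (K * 1)"
      using M K(1,5) by (intro mult_left_mono rho_powr_le_1) auto
    finally have 1: "cmod (T0_fun f z) \<le> (?M + K) * K" by simp
    have 2: "cmod (eigenfun a b z) \<le> cmod a + cmod b"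
      by (rule order_trans[OF norm_eigenfun_le mult_left_le[OF rho_powr_le_1]]) auto
    show ?thesis unfolding h_def using norm_triangle_ineq4[of "T0_fun f z" "eigenfun a b z"] 1 2 by linarith
  qed
  have "a = 0 \<and> b = 0" by (rule no_jordan_block[OF _ hle T]) simp
  then have "T0 x - x = 0" using ab by (simp add: abs_mclass_eigenfun_eq_0_iff)
  then show ?thesis by simp
qed

section \<open>Generalized eigenspaces and multiplicities\<close>

lemma Lp_diff: "p \<ge> 0 \<Longrightarrow> x \<in> Lp p \<Longrightarrow> y \<in> Lp p \<Longrightarrow> x - y \<in> Lp p"
  using Lp_add[of p x "scale_mclass (-1) y"] Lp_scale[of y p "-1"] by simp

lemma T0_minus_id_funpow:
  assumes p: "p > 2" and x: "x \<in> Lp p" and "((\<lambda>y. T0 y - y) ^^ k) x = 0"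
  shows "T0 x = x"
  using x assms(3)
proof (induction k arbitrary: x)
  \<comment> \<open>Here \<open>x = 0\<close>, and \<open>T0 0 = 0\<close> is read off from the
    eigenfunction with both coefficients 0.\<close>
  case 0
  then show ?case
    using T0_eigenfun[of 0 0] by (simp add: abs_mclass_eigenfun_eq_0_iff[THEN iffD2])
next
  case (Suc k)
  have y: "T0 x - x \<in> Lp p" using p Suc.prems by (intro Lp_diff T0_in_Lp) auto
  \<comment> \<open>Read with its first application innermost, the power \<open>Suc k\<close> at
    \<open>x\<close> is the power \<open>k\<close> at \<open>T0 x - x\<close>, to which the
    induction hypothesis applies.\<close>
  have "T0 (T0 x - x) = T0 x - x"
    using Suc.prems by (intro Suc.IH y) (simp add: funpow_Suc_right del: funpow.simps)
  then show ?case using y by (intro T0_minus_id_square[OF p Suc.prems(1)]) (simp add: mclass.eigenspace_def)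
qed

lemma generalized_eigenspace_T0:
  assumes p: "p > 2"
  shows "mclass.generalized_eigenspace (Lp p) T0 1 = mclass.eigenspace (Lp p) T0 1"
proof (intro equalityI subsetI)
  fix x assume "x \<in> mclass.generalized_eigenspace (Lp p) T0 1"
  then show "x \<in> mclass.eigenspace (Lp p) T0 1"
    using T0_minus_id_funpow[OF p] by (auto simp: mclass.generalized_eigenspace_def mclass.eigenspace_def)
next
  fix x assume "x \<in> mclass.eigenspace (Lp p) T0 1"
  then show "x \<in> mclass.generalized_eigenspace (Lp p) T0 1"
    by (auto simp: mclass.generalized_eigenspace_def mclass.eigenspace_def intro!: exI[of _ "Suc 0"])
qed

text \<open>The operators \<open>T0 - 1\<close> and \<open>1 - T0\<close> differ by a sign, so their
  \<open>k\<close>-th powers differ by \<open>(-1) ^ k\<close> and have the same kernel.\<close>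

lemma generalized_eigenspace_id_minus_T0:
  assumes p: "p > 2"
  shows "mclass.generalized_eigenspace (Lp p) (\<lambda>h. h - T0 h) 0 = mclass.eigenspace (Lp p) T0 1"
proof (intro equalityI subsetI)
  fix x assume "x \<in> mclass.generalized_eigenspace (Lp p) (\<lambda>h. h - T0 h) 0"
  then obtain k where x: "x \<in> Lp p" and k: "((\<lambda>y. y - T0 y) ^^ k) x = 0"
    by (auto simp: mclass.generalized_eigenspace_def)
  have "((\<lambda>y. T0 y - y) ^^ n) x = scale_mclass ((-1) ^ n) (((\<lambda>y. y - T0 y) ^^ n) x)" for n
  proof (induction n)
    case (Suc n)
    then show ?case by (simp add: T0_scale mclass.scale_right_diff_distrib)
  qed simp
  with k have "((\<lambda>y. T0 y - y) ^^ k) x = 0" by simp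
  with x show "x \<in> mclass.eigenspace (Lp p) T0 1"
    using T0_minus_id_funpow[OF p] by (auto simp: mclass.eigenspace_def)
next
  fix x assume "x \<in> mclass.eigenspace (Lp p) T0 1"
  then show "x \<in> mclass.generalized_eigenspace (Lp p) (\<lambda>h. h - T0 h) 0"
    by (auto simp: mclass.generalized_eigenspace_def mclass.eigenspace_def intro!: exI[of _ "Suc 0"])
qed

lemma eigenspace_id_minus_T0:
  "mclass.eigenspace (Lp p) (\<lambda>h. h - T0 h) 0 = mclass.eigenspace (Lp p) T0 1"
  by (auto simp: mclass.eigenspace_def)

theorem proposition4p4:
  fixes p :: real
  assumes "p > 2"
  shows "mclass.compact_operator_on (Lp p) (Lp_norm p) T0
    \<and> mclass.semisimple_eigenvalue (Lp p) T0 1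
    \<and> mclass.algebraic_multiplicity (Lp p) T0 1 = 2
    \<and> mclass.semisimple_eigenvalue (Lp p) (\<lambda>h. h - T0 h) 0
    \<and> mclass.algebraic_multiplicity (Lp p) (\<lambda>h. h - T0 h) 0 = 2"
proof -
  have e: "abs_mclass (eigenfun 1 0) \<in> Lp p" "abs_mclass (eigenfun 1 0) \<noteq> 0"
    using assms by (auto simp: eigenfun_in_Lp abs_mclass_eigenfun_eq_0_iff)
  then have "mclass.eigenvalue_on (Lp p) T0 1" "mclass.eigenvalue_on (Lp p) (\<lambda>h. h - T0 h) 0"
    unfolding mclass.eigenvalue_on_def by (auto intro!: bexI[of _ "abs_mclass (eigenfun 1 0)"] simp: T0_eigenfun)
  then show ?thesis
    using assms
    by (simp add: T0_compact mclass.semisimple_eigenvalue_def mclass.algebraic_multiplicity_def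
        mclass.geometric_multiplicity_def generalized_eigenspace_T0 generalized_eigenspace_id_minus_T0
        eigenspace_id_minus_T0 dim_eigenspace)
qed

end
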